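(* Assume (ν), (B1)–(B2), (H1)–(H4), (F1) and (F2) (listed in the context), and let $k\in(0,\sigma)$. Then there exists at most one solution $(\lambda,u,m)\in\mathbb R\times\big(W^{1,\infty}(\mathbb R^d)\cap W^{2,\infty}_{loc}(\mathbb R^d)\big)\times\mathcal P_k(\mathbb R^d)$ of the stationary ergodic mean field game system $$\begin{cases}\lambda-\mathcal Lu+H(x,Du)+b(x)\cdot Du=F(x,m)&\text{in }\mathbb R^d,\\ -\mathcal L^*m-\mathrm{div}\big(m\,(b(x)+D_pH(x,Du))\big)=0&\text{in }\mathbb R^d,\\ \int_{\mathbb R^d}m=1,\qquad u(0)=0.\end{cases}$$
   Context: **Notation.** $d\ge1$; $\langle x\rangle=\sqrt{1+|x|^2}$; $Q_t=(0,t)\times\mathbb R^d$, $\overline Q_t=[0,t]\times\mathbb R^d$. $C_b$: bounded continuous functions. $W^{1,\infty}(\mathbb R^d)$: bounded functions with bounded (Sobolev) derivatives, with its usual norm. $W^{2,\infty}_{loc}(\mathbb R^d)$: functions belonging to $W^{2,\infty}(B)$ for every ball $B$. $\mathcal P(\mathbb R^d)$: Borel probability measures, with the metric $d_0(\mu_1,\mu_2)=\sup\{\int f\,d(\mu_1-\mu_2): f \text{ Lipschitz},\ \|f\|_\infty\le1,\ \|Df\|_\infty\le1\}$. $\mathcal P_k(\mathbb R^d)=\{m\in\mathcal P(\mathbb R^d):\int\langle x\rangle^k\,dm<\infty\}$. **Nonlocal operator.** $\mathcal L\varphi(x)=\int_{\mathbb R^d}\{\varphi(x+z)-\varphi(x)-D\varphi(x)\cdot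 z\,\mathbf 1_{|z|\le1}\}\,\nu(dz)$, and $\mathcal L^*$ is its formal adjoint. **Assumptions.** (ν) $\nu$ is a positive absolutely continuous measure such that, for some $\sigma\in(1,2)$ and $c_{\sigma,d}>0$, $\frac1{c_{\sigma,d}}|z|^{-d-\sigma}\le\frac{d\nu}{dz}\le c_{\sigma,d}|z|^{-d-\sigma}$ for all $z$. (B1) $b:\mathbb R^d\to\mathbb R^d$ is continuous and there are $\alpha,\beta>0$ with $(b(x)-b(y))\cdot(x-y)\ge\alpha|x-y|^2-\beta|x-y|$ for all $x,y$. (B2) $b$ is locally Lipschitz. (H1) $H:\mathbb R^d\times\mathbb R^d\to\mathbb R$ is continuous and there is $C_H>0$ with $|H(x,p)|\le C_H(1+|p|)$ for all $x,p$. (H2) There is $L_H>0$ with $|H(x,p)-H(x,q)|\le L_H|p-q|$ for all $x,p,q$. (H3) There is $C>0$ with $|H(x,p)-H(y,p)|\le C(1+|p|)|x-y|$ for all $x,y,p$. (H4) $H\in C^2(\mathbb R^d\times\mathbb R^d)$ and for every $K>0$ there are $\alpha_K,C_K>0$ with $\alpha_KI_d\le H_{pp}(x,p)\le C_KI_d$ for all $x$ and $|p|\le K$. $F:\mathbb R^d\times\mathcal P(\mathbb R^d)\to\mathbb R$ is continuous. (F1) $\int_{\mathbb R^d}(F(x,m_1)-F(x,m_2))\,d(m_1-m_2)\ge0$ for all $m_1,m_2\in\mathcal P(\mathbb R^d)$. (F2) There is $C_F>0$ with $|F(x,\mu)|+\frac{|F(x,\mu)-F(y,\mu')|}{|x-y|+d_0(\mu,\mu')}\le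 C_F$ for all $x,y$ and $\mu,\mu'\in\mathcal P(\mathbb R^d)$. **Viscosity solutions.** For $0<r\le1$ put $\mathcal L_r(x,u,p)=\int_{|z|\le r}[u(x+z)-u(x)-p\cdot z\mathbf 1_{|z|\le1}]\nu(dz)$ and $\mathcal L^r(x,u,p)=\int_{|z|>r}[u(x+z)-u(x)-p\cdot z\mathbf 1_{|z|\le1}]\nu(dz)$. A bounded upper semicontinuous $u$ on $Q_T$ is a viscosity subsolution of $\partial_tu-\mathcal Lu+G(t,x,Du)=0$ if, for every $0<r\le1$, $\phi\in C^2(Q_T)$ and maximum point $(\hat t,\hat x)$ of $u-\phi$ in $(\frac{\hat t}2,\frac32\hat t\wedge T)\times B_r(\hat x)$, one has $\partial_t\phi(\hat t,\hat x)-\mathcal L_r(\hat x,\phi,p)-\mathcal L^r(\hat x,u,p)+G(\hat t,\hat x,p)\le0$ with $p=D\phi(\hat t,\hat x)$; supersolutions are defined symmetrically, and solutions are both. For backward equations the notion is applied after reversing time; for stationary equations it is the analogous notion without the time variable. **Solution of the ergodic system.** $(\lambda,u,m)$ is a solution if $u$ satisfies the first equation (in the viscosity sense; for $u\in W^{1,\infty}\cap W^{2,\infty}_{loc}$ it holds classically), $u(0)=0$, and $m$ solves the second equation by duality, that is, with $\mathcal B=b+D_pH(x,Du)$, $\int\xi\,dm+\int_0^t\int f(s,x)\,dm(x)\,ds=\int\phi(0,x)\,dm$ for all $t>0$, $\xi\in C_b(\mathbb R^d)$, $f\in C_b(Q_t)$ and viscosity solutions $\phi\in C_b(\overline Q_t)$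 of $-\partial_s\phi-\mathcal L\phi+\mathcal B\cdot D\phi=f$ in $(0,t)\times\mathbb R^d$, $\phi(t,\cdot)=\xi$. *)

theory Defs
  imports "HOL-Analysis.Analysis" "HOL-Probability.Probability"
begin

definition grad :: "('a::euclidean_space \<Rightarrow> real) \<Rightarrow> 'a \<Rightarrow> 'a" where
  "grad f x = (THE D. GDERIV f x :> D)"

text \<open>For open \<open>S\<close> this is the class of \<open>k\<close> times continuously differentiable functions on \<open>S\<close>,
  via iterated partial derivatives.\<close>

fun Ck_on :: "nat \<Rightarrow> 'a::euclidean_space set \<Rightarrow> ('a \<Rightarrow> real) \<Rightarrow> bool" where
  "Ck_on 0 S f \<longleftrightarrow> continuous_on S f"
| "Ck_on (Suc k) S f \<longleftrightarrow>
     (\<forall>x\<in>S. f differentiable (at x)) \<and>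
     (\<forall>i\<in>Basis. Ck_on k S (\<lambda>x. frechet_derivative f (at x) i))"

definition Cb :: "'a::topological_space set \<Rightarrow> ('a \<Rightarrow> real) set" where
  "Cb S = {f. continuous_on S f \<and> bounded (f ` S)}"

definition test_functions :: "'a::euclidean_space set \<Rightarrow> ('a \<Rightarrow> real) set" where
  "test_functions \<Omega> = {\<phi>. (\<forall>k. Ck_on k UNIV \<phi>) \<and>
     (\<exists>K. compact K \<and> K \<subseteq> \<Omega> \<and> (\<forall>x. x \<notin> K \<longrightarrow> \<phi> x = 0))}"

definition Linfty :: "'a::euclidean_space set \<Rightarrow> ('a \<Rightarrow> real) set" where
  "Linfty \<Omega> = {f. f \<in> borel_measurable (lebesgue_on \<Omega>) \<and>
     (\<exists>C. AE x in lebesgue_on \<Omega>. \<bar>f x\<bar> \<le> C)}"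

text \<open>\<open>g\<close> is the weak \<open>i\<close>-th partial derivative of \<open>f\<close> on the open set \<open>\<Omega>\<close>; only used for
  \<open>f, g \<in> Linfty \<Omega>\<close>, so that both integrals converge.\<close>

definition weak_derivative ::
    "'a::euclidean_space set \<Rightarrow> 'a \<Rightarrow> ('a \<Rightarrow> real) \<Rightarrow> ('a \<Rightarrow> real) \<Rightarrow> bool" where
  "weak_derivative \<Omega> i f g \<longleftrightarrow> (\<forall>\<phi>\<in>test_functions \<Omega>.
     (LINT x|lebesgue_on \<Omega>. f x * frechet_derivative \<phi> (at x) i) =
     - (LINT x|lebesgue_on \<Omega>. g x * \<phi> x))"

text \<open>Membership in \<open>Wk_infty\<close> does not depend on the representative; the continuous
  representative is selected by the (semi)continuity built into viscosity solutions below.\<close>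

fun Wk_infty :: "nat \<Rightarrow> 'a::euclidean_space set \<Rightarrow> ('a \<Rightarrow> real) set" where
  "Wk_infty 0 \<Omega> = Linfty \<Omega>"
| "Wk_infty (Suc k) \<Omega> =
     {f\<in>Linfty \<Omega>. \<forall>i\<in>Basis. \<exists>g\<in>Wk_infty k \<Omega>. weak_derivative \<Omega> i f g}"

definition Wk_infty_loc :: "nat \<Rightarrow> ('a::euclidean_space \<Rightarrow> real) set" where
  "Wk_infty_loc k = {f. \<forall>x r. 0 < r \<longrightarrow> f \<in> Wk_infty k (ball x r)}"

definition Prob :: "'a::euclidean_space measure set" where
  "Prob = {m. prob_space m \<and> sets m = sets borel}"

definition Prob_moment :: "real \<Rightarrow> 'a::euclidean_space measure set" where
  "Prob_moment k = {m\<in>Prob. integrable m (\<lambda>x. sqrt (1 + (norm x)\<^sup>2) powr k)}"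

text \<open>Lipschitz functions are differentiable almost everywhere, so the third condition is
  the bound on the essential supremum of the gradient.\<close>

definition d0 :: "'a::euclidean_space measure \<Rightarrow> 'a measure \<Rightarrow> real" where
  "d0 \<mu>1 \<mu>2 = (SUP f \<in> {f::'a \<Rightarrow> real. (\<exists>L. L-lipschitz_on UNIV f) \<and> (\<forall>x. \<bar>f x\<bar> \<le> 1) \<and>
                  (AE x in lebesgue. \<exists>D. GDERIV f x :> D \<and> norm D \<le> 1)}.
     (LINT x|\<mu>1. f x) - (LINT x|\<mu>2. f x))"

text \<open>The bounds on the density are imposed off the origin: at \<open>z = 0\<close> the reference kernel is
  infinite, and the value there is irrelevant.\<close>

definition cond_nu :: "real \<Rightarrow> 'a::euclidean_space measure \<Rightarrow> bool" where
  "cond_nu \<sigma> \<nu> \<longleftrightarrow> 1 < \<sigma> \<and> \<sigma> < 2 \<and>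
     (\<exists>c>0. \<exists>g\<in>borel_measurable borel. \<nu> = density lborel (\<lambda>z. ennreal (g z)) \<and>
        (\<forall>z. z \<noteq> 0 \<longrightarrow>
           1 / c * norm z powr (- real DIM('a) - \<sigma>) \<le> g z \<and>
           g z \<le> c * norm z powr (- real DIM('a) - \<sigma>)))"

definition cond_B1 :: "('a::euclidean_space \<Rightarrow> 'a) \<Rightarrow> bool" where
  "cond_B1 b \<longleftrightarrow> continuous_on UNIV b \<and>
     (\<exists>\<alpha>>0. \<exists>\<beta>>0. \<forall>x y.
        (b x - b y) \<bullet> (x - y) \<ge> \<alpha> * (norm (x - y))\<^sup>2 - \<beta> * norm (x - y))"

definition cond_B2 :: "('a::euclidean_space \<Rightarrow> 'a) \<Rightarrow> bool" where
  "cond_B2 b \<longleftrightarrow> (\<forall>x. \<exists>r>0. \<exists>L. L-lipschitz_on (ball x r) b)"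

definition cond_H1 :: "('a::euclidean_space \<Rightarrow> 'a \<Rightarrow> real) \<Rightarrow> bool" where
  "cond_H1 H \<longleftrightarrow> continuous_on UNIV (\<lambda>(x, p). H x p) \<and>
     (\<exists>C>0. \<forall>x p. \<bar>H x p\<bar> \<le> C * (1 + norm p))"

definition cond_H2 :: "('a::euclidean_space \<Rightarrow> 'a \<Rightarrow> real) \<Rightarrow> bool" where
  "cond_H2 H \<longleftrightarrow> (\<exists>L>0. \<forall>x p q. \<bar>H x p - H x q\<bar> \<le> L * norm (p - q))"

definition cond_H3 :: "('a::euclidean_space \<Rightarrow> 'a \<Rightarrow> real) \<Rightarrow> bool" where
  "cond_H3 H \<longleftrightarrow> (\<exists>C>0. \<forall>x y p. \<bar>H x p - H y p\<bar> \<le> C * (1 + norm p) * norm (x - y))"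

definition D_p :: "('a::euclidean_space \<Rightarrow> 'a \<Rightarrow> real) \<Rightarrow> 'a \<Rightarrow> 'a \<Rightarrow> 'a" where
  "D_p H x p = grad (\<lambda>q. H x q) p"

text \<open>\<open>hess_p H x p\<close> is the Hessian \<open>H\<^sub>p\<^sub>p(x, p)\<close> as a linear map; matrix inequalities are
  inequalities of quadratic forms.\<close>

definition hess_p :: "('a::euclidean_space \<Rightarrow> 'a \<Rightarrow> real) \<Rightarrow> 'a \<Rightarrow> 'a \<Rightarrow> 'a \<Rightarrow> 'a" where
  "hess_p H x p = frechet_derivative (\<lambda>q. D_p H x q) (at p)"

definition cond_H4 :: "('a::euclidean_space \<Rightarrow> 'a \<Rightarrow> real) \<Rightarrow> bool" where
  "cond_H4 H \<longleftrightarrow> Ck_on 2 UNIV (\<lambda>(x, p). H x p) \<and>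
     (\<forall>K>0. \<exists>\<alpha>>0. \<exists>C>0. \<forall>x p. norm p \<le> K \<longrightarrow>
        (\<forall>v. \<alpha> * (v \<bullet> v) \<le> v \<bullet> hess_p H x p v \<and> v \<bullet> hess_p H x p v \<le> C * (v \<bullet> v)))"

definition F_continuous :: "('a::euclidean_space \<Rightarrow> 'a measure \<Rightarrow> real) \<Rightarrow> bool" where
  "F_continuous F \<longleftrightarrow>
     continuous_map (prod_topology euclidean (Metric_space.mtopology Prob d0)) euclideanreal
       (\<lambda>(x, m). F x m)"

definition cond_F1 :: "('a::euclidean_space \<Rightarrow> 'a measure \<Rightarrow> real) \<Rightarrow> bool" where
  "cond_F1 F \<longleftrightarrow> (\<forall>m1\<in>Prob. \<forall>m2\<in>Prob.
     (LINT x|m1. F x m1 - F x m2) - (LINT x|m2. F x m1 - F x m2) \<ge> 0)"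

text \<open>The difference quotient reads \<open>0 / 0 = 0\<close> when the two arguments coincide.\<close>

definition cond_F2 :: "('a::euclidean_space \<Rightarrow> 'a measure \<Rightarrow> real) \<Rightarrow> bool" where
  "cond_F2 F \<longleftrightarrow> (\<exists>C>0. \<forall>x y. \<forall>\<mu>\<in>Prob. \<forall>\<mu>'\<in>Prob.
     \<bar>F x \<mu>\<bar> + \<bar>F x \<mu> - F y \<mu>'\<bar> / (norm (x - y) + d0 \<mu> \<mu>') \<le> C)"

text \<open>The operator \<open>\<L>\<close> restricted to jumps \<open>z \<in> A\<close>, with \<open>p\<close> in place of the gradient.\<close>

definition nonlocal ::
    "'a::euclidean_space measure \<Rightarrow> 'a set \<Rightarrow> 'a \<Rightarrow> ('a \<Rightarrow> real) \<Rightarrow> 'a \<Rightarrow> real" where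
  "nonlocal \<nu> A x u p =
     (LINT z:A|\<nu>. u (x + z) - u x - (p \<bullet> z) * indicator {z. norm z \<le> 1} z)"

abbreviation nonlocal_le ::
    "'a::euclidean_space measure \<Rightarrow> real \<Rightarrow> 'a \<Rightarrow> ('a \<Rightarrow> real) \<Rightarrow> 'a \<Rightarrow> real" where
  "nonlocal_le \<nu> r \<equiv> nonlocal \<nu> {z. norm z \<le> r}"

abbreviation nonlocal_gt ::
    "'a::euclidean_space measure \<Rightarrow> real \<Rightarrow> 'a \<Rightarrow> ('a \<Rightarrow> real) \<Rightarrow> 'a \<Rightarrow> real" where
  "nonlocal_gt \<nu> r \<equiv> nonlocal \<nu> {z. norm z > r}"

definition usc_on :: "'a::topological_space set \<Rightarrow> ('a \<Rightarrow> real) \<Rightarrow> bool" where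
  "usc_on S u \<longleftrightarrow> (\<forall>x\<in>S. \<forall>c>u x. \<forall>\<^sub>F y in at x within S. u y < c)"

definition lsc_on :: "'a::topological_space set \<Rightarrow> ('a \<Rightarrow> real) \<Rightarrow> bool" where
  "lsc_on S u \<longleftrightarrow> (\<forall>x\<in>S. \<forall>c<u x. \<forall>\<^sub>F y in at x within S. u y > c)"

definition max_point :: "'b set \<Rightarrow> ('b \<Rightarrow> real) \<Rightarrow> 'b \<Rightarrow> bool" where
  "max_point S f y \<longleftrightarrow> y \<in> S \<and> (\<forall>x\<in>S. f x \<le> f y)"

definition min_point :: "'b set \<Rightarrow> ('b \<Rightarrow> real) \<Rightarrow> 'b \<Rightarrow> bool" where
  "min_point S f y \<longleftrightarrow> y \<in> S \<and> (\<forall>x\<in>S. f y \<le> f x)"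

text \<open>Stationary equation \<open>- \<L>u + G(x, Du) = 0\<close> in the whole space.\<close>

definition visc_subsol ::
    "'a::euclidean_space measure \<Rightarrow> ('a \<Rightarrow> 'a \<Rightarrow> real) \<Rightarrow> ('a \<Rightarrow> real) \<Rightarrow> bool" where
  "visc_subsol \<nu> G u \<longleftrightarrow> bounded (range u) \<and> usc_on UNIV u \<and>
     (\<forall>r \<phi> x. 0 < r \<and> r \<le> 1 \<and> Ck_on 2 UNIV \<phi> \<and>
        max_point (ball x r) (\<lambda>y. u y - \<phi> y) x \<longrightarrow>
        (let p = grad \<phi> x in
           - nonlocal_le \<nu> r x \<phi> p - nonlocal_gt \<nu> r x u p + G x p \<le> 0))"

definition visc_supersol ::
    "'a::euclidean_space measure \<Rightarrow> ('a \<Rightarrow> 'a \<Rightarrow> real) \<Rightarrow> ('a \<Rightarrow> real) \<Rightarrow> bool" where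
  "visc_supersol \<nu> G u \<longleftrightarrow> bounded (range u) \<and> lsc_on UNIV u \<and>
     (\<forall>r \<phi> x. 0 < r \<and> r \<le> 1 \<and> Ck_on 2 UNIV \<phi> \<and>
        min_point (ball x r) (\<lambda>y. u y - \<phi> y) x \<longrightarrow>
        (let p = grad \<phi> x in
           - nonlocal_le \<nu> r x \<phi> p - nonlocal_gt \<nu> r x u p + G x p \<ge> 0))"

definition visc_sol ::
    "'a::euclidean_space measure \<Rightarrow> ('a \<Rightarrow> 'a \<Rightarrow> real) \<Rightarrow> ('a \<Rightarrow> real) \<Rightarrow> bool" where
  "visc_sol \<nu> G u \<longleftrightarrow> visc_subsol \<nu> G u \<and> visc_supersol \<nu> G u"

text \<open>Evolution equation \<open>\<partial>\<^sub>t u - \<L>u + G(t, x, Du) = 0\<close> in \<open>Q\<^sub>T\<close>.\<close>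

definition Q :: "real \<Rightarrow> (real \<times> 'a::euclidean_space) set" where
  "Q T = {0<..<T} \<times> UNIV"

definition Qbar :: "real \<Rightarrow> (real \<times> 'a::euclidean_space) set" where
  "Qbar T = {0..T} \<times> UNIV"

definition dt :: "(real \<times> 'a::euclidean_space \<Rightarrow> real) \<Rightarrow> real \<Rightarrow> 'a \<Rightarrow> real" where
  "dt \<phi> t x = deriv (\<lambda>s. \<phi> (s, x)) t"

definition evol_visc_subsol ::
    "'a::euclidean_space measure \<Rightarrow> real \<Rightarrow> (real \<Rightarrow> 'a \<Rightarrow> 'a \<Rightarrow> real) \<Rightarrow>
     (real \<times> 'a \<Rightarrow> real) \<Rightarrow> bool" where
  "evol_visc_subsol \<nu> T G u \<longleftrightarrow> bounded (u ` Q T) \<and> usc_on (Q T) u \<and>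
     (\<forall>r \<phi> t x. 0 < r \<and> r \<le> 1 \<and> Ck_on 2 (Q T) \<phi> \<and> (t, x) \<in> Q T \<and>
        max_point ({t / 2<..<min (3 / 2 * t) T} \<times> ball x r) (\<lambda>y. u y - \<phi> y) (t, x) \<longrightarrow>
        (let p = grad (\<lambda>y. \<phi> (t, y)) x in
           dt \<phi> t x - nonlocal_le \<nu> r x (\<lambda>y. \<phi> (t, y)) p
             - nonlocal_gt \<nu> r x (\<lambda>y. u (t, y)) p + G t x p \<le> 0))"

definition evol_visc_supersol ::
    "'a::euclidean_space measure \<Rightarrow> real \<Rightarrow> (real \<Rightarrow> 'a \<Rightarrow> 'a \<Rightarrow> real) \<Rightarrow>
     (real \<times> 'a \<Rightarrow> real) \<Rightarrow> bool" where
  "evol_visc_supersol \<nu> T G u \<longleftrightarrow> bounded (u ` Q T) \<and> lsc_on (Q T) u \<and>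
     (\<forall>r \<phi> t x. 0 < r \<and> r \<le> 1 \<and> Ck_on 2 (Q T) \<phi> \<and> (t, x) \<in> Q T \<and>
        min_point ({t / 2<..<min (3 / 2 * t) T} \<times> ball x r) (\<lambda>y. u y - \<phi> y) (t, x) \<longrightarrow>
        (let p = grad (\<lambda>y. \<phi> (t, y)) x in
           dt \<phi> t x - nonlocal_le \<nu> r x (\<lambda>y. \<phi> (t, y)) p
             - nonlocal_gt \<nu> r x (\<lambda>y. u (t, y)) p + G t x p \<ge> 0))"

definition evol_visc_sol ::
    "'a::euclidean_space measure \<Rightarrow> real \<Rightarrow> (real \<Rightarrow> 'a \<Rightarrow> 'a \<Rightarrow> real) \<Rightarrow>
     (real \<times> 'a \<Rightarrow> real) \<Rightarrow> bool" where
  "evol_visc_sol \<nu> T G u \<longleftrightarrow> evol_visc_subsol \<nu> T G u \<and> evol_visc_supersol \<nu> T G u"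

text \<open>Backward equation \<open>- \<partial>\<^sub>s u - \<L>u + G(s, x, Du) = 0\<close> in \<open>Q\<^sub>T\<close>.\<close>

definition backward_visc_sol ::
    "'a::euclidean_space measure \<Rightarrow> real \<Rightarrow> (real \<Rightarrow> 'a \<Rightarrow> 'a \<Rightarrow> real) \<Rightarrow>
     (real \<times> 'a \<Rightarrow> real) \<Rightarrow> bool" where
  "backward_visc_sol \<nu> T G u \<longleftrightarrow>
     evol_visc_sol \<nu> T (\<lambda>t. G (T - t)) (\<lambda>(t, x). u (T - t, x))"

text \<open>\<open>m\<close> solves \<open>- \<L>\<^sup>* m - div (m B) = 0\<close> in the sense of duality.\<close>

definition duality_sol ::
    "'a::euclidean_space measure \<Rightarrow> ('a \<Rightarrow> 'a) \<Rightarrow> 'a measure \<Rightarrow> bool" where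
  "duality_sol \<nu> B m \<longleftrightarrow>
     (\<forall>t>0. \<forall>\<xi>\<in>Cb UNIV. \<forall>f\<in>Cb (Q t). \<forall>\<phi>\<in>Cb (Qbar t).
        backward_visc_sol \<nu> t (\<lambda>s x p. B x \<bullet> p - f (s, x)) \<phi> \<and> (\<forall>x. \<phi> (t, x) = \<xi> x) \<longrightarrow>
        (LINT x|m. \<xi> x) + (LINT s:{0<..<t}|lborel. LINT x|m. f (s, x)) = (LINT x|m. \<phi> (0, x)))"

definition ergodic_MFG_solution ::
    "'a::euclidean_space measure \<Rightarrow> ('a \<Rightarrow> 'a) \<Rightarrow> ('a \<Rightarrow> 'a \<Rightarrow> real) \<Rightarrow>
     ('a \<Rightarrow> 'a measure \<Rightarrow> real) \<Rightarrow> real \<Rightarrow> ('a \<Rightarrow> real) \<Rightarrow> 'a measure \<Rightarrow> bool" where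
  "ergodic_MFG_solution \<nu> b H F l u m \<longleftrightarrow>
     visc_sol \<nu> (\<lambda>x p. l + H x p + b x \<bullet> p - F x m) u \<and>
     duality_sol \<nu> (\<lambda>x. b x + D_p H x (grad u x)) m \<and>
     u 0 = 0"

end

theory Submission
  imports Defs
begin

text \<open>
  Both \<open>u\<^sub>i\<close> are classical solutions, and testing the equation of each \<open>m\<^sub>j\<close> with each \<open>u\<^sub>i\<close> gives
  the Lasry-Lions identity: the monotonicity of \<open>F\<close> and the convexity of \<open>H\<close> force the Bregman excess
  \<open>H(x, Du\<^sub>2) - H(x, Du\<^sub>1) - D\<^sub>pH(x, Du\<^sub>1) \<bullet> (Du\<^sub>2 - Du\<^sub>1)\<close> to vanish \<open>m\<^sub>1\<close>-almost everywhere. Since the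
  jumps reach every open set, \<open>m\<^sub>1\<close> has full support; hence \<open>Du\<^sub>1 = Du\<^sub>2\<close>, and \<open>u\<^sub>1 = u\<^sub>2\<close> by the
  normalisation at the origin.

  Now \<open>m\<^sub>1\<close> and \<open>m\<^sub>2\<close> are invariant for the same locally Lipschitz drift. Write
  \<open>m\<^sub>1 - m\<^sub>2 = n\<^sub>1 - n\<^sub>2\<close> with \<open>n\<^sub>1\<close> and \<open>n\<^sub>2\<close> mutually singular, and mollify both at scale \<open>\<epsilon>\<close> by a kernel whose
  gradient is controlled by the kernel itself. The minimum of the two mollifications is an approximate
  supersolution: jumps between the regions where one or the other of them is the larger make it strictly so,
  by an amount comparable to the masses of \<open>n\<^sub>1\<close> and \<open>n\<^sub>2\<close> in a ball. Testing with a cut-off at radius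
  \<open>R\<close> bounds this amount by the integral of the minimum, which tends to \<open>0\<close> with \<open>\<epsilon>\<close> because
  \<open>n\<^sub>1\<close> and \<open>n\<^sub>2\<close> are mutually singular, and by cut-off terms, which vanish as \<open>R\<close> grows because the drift
  is dissipative. Hence \<open>n\<^sub>1 = n\<^sub>2 = 0\<close>, and \<open>\<lambda>\<^sub>1 = \<lambda>\<^sub>2\<close> follows from the identity.
\<close>

section \<open>Functions with quadratic Taylor remainder\<close>

definition quad_approx :: "real \<Rightarrow> ('a::euclidean_space \<Rightarrow> real) \<Rightarrow> ('a \<Rightarrow> 'a) \<Rightarrow> bool" where
  "quad_approx C f f' \<longleftrightarrow> (\<forall>x h. \<bar>f (x + h) - f x - f' x \<bullet> h\<bar> \<le> C * (norm h)\<^sup>2)"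

definition quad_approx_loc :: "('a::euclidean_space \<Rightarrow> real) \<Rightarrow> ('a \<Rightarrow> 'a) \<Rightarrow> bool" where
  "quad_approx_loc f f' \<longleftrightarrow> (\<forall>R. \<exists>C\<ge>0. \<forall>x h. norm x \<le> R \<longrightarrow> norm h \<le> 1 \<longrightarrow>
     \<bar>f (x + h) - f x - f' x \<bullet> h\<bar> \<le> C * (norm h)\<^sup>2)"

lemma quad_approxD: "quad_approx C f f' \<Longrightarrow> \<bar>f (x + h) - f x - f' x \<bullet> h\<bar> \<le> C * (norm h)\<^sup>2"
  by (simp add: quad_approx_def)

lemma quad_approx_locE:
  assumes "quad_approx_loc f f'"
  obtains C where "C \<ge> 0" "\<And>x h. norm x \<le> R \<Longrightarrow> norm h \<le> 1 \<Longrightarrow>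
     \<bar>f (x + h) - f x - f' x \<bullet> h\<bar> \<le> C * (norm h)\<^sup>2"
  using assms unfolding quad_approx_loc_def by blast

lemma quad_approx_nonneg:
  fixes f :: "'a::euclidean_space \<Rightarrow> real"
  assumes "quad_approx C f f'"
  shows "C \<ge> 0"
proof -
  obtain b :: 'a where "b \<in> Basis" using nonempty_Basis by blast
  then have "norm b = 1" by simp
  then show ?thesis using quad_approxD[OF assms, of 0 b] by (smt (verit) mult_cancel_left1 one_power2)
qed

lemma quad_approx_imp_loc: "quad_approx C f f' \<Longrightarrow> quad_approx_loc f f'"
  using quad_approx_nonneg[of C f f'] unfolding quad_approx_loc_def
  by (metis quad_approxD)

lemma quad_approx_imp_GDERIV:
  assumes "d > 0" "\<And>h. norm h \<le> d \<Longrightarrow> \<bar>f (x + h) - f x - D \<bullet> h\<bar> \<le> C * (norm h)\<^sup>2"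
  shows "GDERIV f x :> D"
  unfolding gderiv_def
proof (rule has_derivativeI_sandwich[where e = d and H = "\<lambda>y. C * norm (y - x)"])
  show "bounded_linear (\<lambda>h. h \<bullet> D)" by (rule bounded_linear_inner_left)
  show "((\<lambda>y. C * norm (y - x)) \<longlongrightarrow> 0) (at x)"
    by (auto intro!: tendsto_eq_intros)
  fix y assume "y \<noteq> x" "dist y x < d"
  then have "\<bar>f (x + (y - x)) - f x - D \<bullet> (y - x)\<bar> \<le> C * (norm (y - x))\<^sup>2"
    by (intro assms(2)) (simp add: dist_norm)
  then show "norm ((f y - f x) - (y - x) \<bullet> D) / norm (y - x) \<le> C * norm (y - x)"
    using \<open>y \<noteq> x\<close> by (simp add: divide_le_eq power2_eq_square inner_commute ac_simps)
qed fact

lemma quad_approx_loc_GDERIV: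
  assumes "quad_approx_loc f f'"
  shows "GDERIV f x :> f' x"
proof -
  from assms obtain C where "C \<ge> 0" "\<And>y h. norm y \<le> norm x \<Longrightarrow> norm h \<le> 1 \<Longrightarrow>
     \<bar>f (y + h) - f y - f' y \<bullet> h\<bar> \<le> C * (norm h)\<^sup>2" by (rule quad_approx_locE) auto
  then show ?thesis by (intro quad_approx_imp_GDERIV[of 1]) auto
qed

lemma grad_eqI:
  assumes "GDERIV f x :> D"
  shows "grad f x = D"
  unfolding grad_def
proof (rule the_equality)
  fix D' assume "GDERIV f x :> D'"
  then have "(\<lambda>h. h \<bullet> D') = (\<lambda>h. h \<bullet> D)"
    using assms unfolding gderiv_def by (rule has_derivative_unique)
  then show "D' = D"
    by (metis inner_commute vector_eq_ldot)
qed fact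

lemma GDERIV_isCont: "GDERIV f x :> D \<Longrightarrow> isCont f x"
  unfolding gderiv_def by (rule has_derivative_continuous)

lemma quad_approx_loc_continuous:
  "quad_approx_loc f f' \<Longrightarrow> continuous_on S f"
  by (meson GDERIV_isCont continuous_at_imp_continuous_on quad_approx_loc_GDERIV)

lemma GDERIV_bound_imp_lipschitz:
  fixes f :: "'a::euclidean_space \<Rightarrow> real"
  assumes "\<And>x. GDERIV f x :> f' x" "\<And>x. norm (f' x) \<le> K"
  shows "\<bar>f y - f x\<bar> \<le> K * norm (y - x)"
proof -
  have "norm (f y - f x) \<le> K * norm (y - x)"
  proof (rule differentiable_bound[OF convex_UNIV])
    show "(f has_derivative (\<lambda>h. h \<bullet> f' z)) (at z within UNIV)" for z
      using assms(1)[of z] by (simp add: gderiv_def)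
    show "onorm (\<lambda>h. h \<bullet> f' z) \<le> K" for z
    proof (rule onorm_bound)
      show "0 \<le> K" using assms(2)[of 0] norm_ge_zero[of "f' 0"] by linarith
      fix h show "norm (h \<bullet> f' z) \<le> K * norm h"
        using Cauchy_Schwarz_ineq2[of h "f' z"] mult_left_mono[OF assms(2)[of z] norm_ge_zero[of h]]
        by (simp add: mult.commute)
    qed
  qed auto
  then show ?thesis by simp
qed

lemma quad_approx_grad_diff:
  fixes f :: "'a::euclidean_space \<Rightarrow> real"
  assumes "\<And>a h. a \<in> {x, y} \<Longrightarrow> norm h \<le> 2 * norm (x - y) \<Longrightarrow>
     \<bar>f (a + h) - f a - f' a \<bullet> h\<bar> \<le> C * (norm h)\<^sup>2"
    and C: "C \<ge> 0"
  shows "norm (f' x - f' y) \<le> 6 * C * norm (x - y)"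
proof (cases "f' x = f' y \<or> x = y")
  case False
  define d where "d = norm (x - y)"
  define w where "w = f' x - f' y"
  define z where "z = d *\<^sub>R sgn w"
  have d: "d > 0" and w: "norm w > 0" using False by (auto simp: d_def w_def)
  have z: "norm z = d" using d w by (simp add: z_def norm_sgn)
  have wz: "w \<bullet> z = norm w * d"
    using w by (simp add: z_def sgn_div_norm power2_norm_eq_inner[symmetric] power2_eq_square)
  have yx: "norm (y - x) = d" by (simp add: d_def norm_minus_commute)
  have n1: "norm (y - x + z) \<le> 2 * d" using norm_triangle_ineq[of "y - x" z] yx z by simp
  have 1: "\<bar>f (x + (y - x + z)) - f x - f' x \<bullet> (y - x + z)\<bar> \<le> C * (norm (y - x + z))\<^sup>2"
    using n1 by (intro assms(1)) (auto simp: d_def)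
  have "(norm (y - x + z))\<^sup>2 \<le> (2 * d)\<^sup>2" using n1 by (intro power_mono) auto
  then have "C * (norm (y - x + z))\<^sup>2 \<le> C * (4 * d\<^sup>2)" using C by (intro mult_left_mono) (auto simp: power_mult_distrib)
  note 1 = order_trans[OF 1 this]
  have 2: "\<bar>f (x + (y - x)) - f x - f' x \<bullet> (y - x)\<bar> \<le> C * d\<^sup>2"
    using assms(1)[of x "y - x"] yx d by (simp add: d_def)
  have 3: "\<bar>f (y + z) - f y - f' y \<bullet> z\<bar> \<le> C * d\<^sup>2"
    using assms(1)[of y z] z d by (simp add: d_def)
  have "w \<bullet> z \<le> 6 * C * d\<^sup>2"
    using 1 2 3 unfolding w_def by (simp add: inner_diff_left inner_diff_right inner_add_right algebra_simps)
  then have "norm w * d \<le> (6 * C * d) * d" using wz by (simp add: power2_eq_square)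
  then show ?thesis using d by (simp add: w_def d_def)
qed (use assms(2) in auto)

lemma quad_approx_grad_lipschitz:
  "quad_approx C f f' \<Longrightarrow> norm (f' x - f' y) \<le> 6 * C * norm (x - y)"
  by (intro quad_approx_grad_diff[where f = f]) (auto simp: quad_approxD quad_approx_nonneg)

lemma lipschitz_bound_imp_continuous:
  fixes g :: "'a::real_normed_vector \<Rightarrow> 'b::real_normed_vector"
  assumes "\<And>x y. norm (g x - g y) \<le> L * norm (x - y)"
  shows "continuous_on S g"
proof (rule continuous_on_subset[OF lipschitz_on_continuous_on[of "\<bar>L\<bar>" UNIV]])
  show "\<bar>L\<bar>-lipschitz_on UNIV g"
  proof (rule lipschitz_onI)
    fix x y show "dist (g x) (g y) \<le> \<bar>L\<bar> * dist x y"
      using assms[of x y] mult_right_mono[OF abs_ge_self[of L] norm_ge_zero[of "x - y"]]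
      by (simp add: dist_norm)
  qed simp
qed simp

lemma quad_approx_grad_continuous:
  "quad_approx C f f' \<Longrightarrow> continuous_on S f'"
  by (rule lipschitz_bound_imp_continuous[of _ "6 * C"]) (rule quad_approx_grad_lipschitz)

lemma quad_approx_loc_grad_lipschitz:
  fixes f :: "'a::euclidean_space \<Rightarrow> real"
  assumes "quad_approx_loc f f'"
  obtains L where "L \<ge> 0" "\<And>x y. norm x \<le> R \<Longrightarrow> norm y \<le> R \<Longrightarrow> norm (f' x - f' y) \<le> L * norm (x - y)"
proof -
  obtain C where C: "C \<ge> 0" "\<And>x h. norm x \<le> R \<Longrightarrow> norm h \<le> 1 \<Longrightarrow>
     \<bar>f (x + h) - f x - f' x \<bullet> h\<bar> \<le> C * (norm h)\<^sup>2"
    using quad_approx_locE[OF assms] by blast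
  have near: "norm (f' x - f' y) \<le> 6 * C * norm (x - y)"
    if "norm x \<le> R" "norm y \<le> R" "norm (x - y) \<le> 1 / 2" for x y
    using that C by (intro quad_approx_grad_diff[where f = f]) auto
  have "continuous_on (cball 0 R) f'"
    unfolding continuous_on_iff
  proof (intro ballI allI impI)
    fix x :: 'a and e :: real assume x: "x \<in> cball 0 R" and e: "e > 0"
    define d where "d = min (1 / 2) (e / (6 * C + 1))"
    have "d > 0" using e C(1) by (simp add: d_def)
    moreover have "dist (f' y) (f' x) < e" if y: "y \<in> cball 0 R" "dist y x < d" for y :: 'a
    proof -
      have "norm (f' y - f' x) \<le> 6 * C * norm (y - x)"
        using x y by (intro near) (auto simp: dist_norm d_def)
      also have "\<dots> \<le> (6 * C + 1) * norm (y - x)" by (simp add: algebra_simps)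
      also have "\<dots> < (6 * C + 1) * (e / (6 * C + 1))"
        using y C(1) by (intro mult_strict_left_mono) (auto simp: dist_norm d_def)
      also have "\<dots> = e" using C(1) by simp
      finally show ?thesis by (simp add: dist_norm)
    qed
    ultimately show "\<exists>d>0. \<forall>y\<in>cball 0 R. dist y x < d \<longrightarrow> dist (f' y) (f' x) < e" by blast
  qed
  then have "bounded (f' ` cball 0 R)"
    by (intro compact_imp_bounded compact_continuous_image) auto
  then obtain M where M: "M > 0" "\<And>x. norm x \<le> R \<Longrightarrow> norm (f' x) \<le> M"
    unfolding bounded_pos by auto
  have "norm (f' x - f' y) \<le> (6 * C + 4 * M) * norm (x - y)" if "norm x \<le> R" "norm y \<le> R" for x y
  proof (cases "norm (x - y) \<le> 1 / 2")
    case True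
    have "6 * C * norm (x - y) \<le> (6 * C + 4 * M) * norm (x - y)"
      using M(1) by (intro mult_right_mono) auto
    then show ?thesis using near[OF that True] by linarith
  next
    case False
    have "norm (f' x - f' y) \<le> M + M"
      using norm_triangle_ineq4[of "f' x" "f' y"] M(2)[OF that(1)] M(2)[OF that(2)] by linarith
    also have "\<dots> \<le> 4 * M * norm (x - y)" using False M(1) by simp
    also have "\<dots> \<le> (6 * C + 4 * M) * norm (x - y)"
      using C(1) by (intro mult_right_mono) auto
    finally show ?thesis .
  qed
  with C(1) M(1) show ?thesis by (intro that[of "6 * C + 4 * M"]) auto
qed

lemma quad_approx_loc_grad_continuous:
  fixes f :: "'a::euclidean_space \<Rightarrow> real"
  assumes "quad_approx_loc f f'"
  shows "continuous_on UNIV f'"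
proof -
  have "isCont f' x" for x
  proof -
    obtain L where L: "L \<ge> 0" "\<And>y z. norm y \<le> norm x + 1 \<Longrightarrow> norm z \<le> norm x + 1 \<Longrightarrow>
        norm (f' y - f' z) \<le> L * norm (y - z)"
      using quad_approx_loc_grad_lipschitz[OF assms] by blast
    have "L-lipschitz_on (ball 0 (norm x + 1)) f'"
      using L by (intro lipschitz_onI) (auto simp: dist_norm)
    then have "continuous_on (ball 0 (norm x + 1)) f'" by (rule lipschitz_on_continuous_on)
    then show ?thesis by (simp add: continuous_on_eq_continuous_at)
  qed
  then show ?thesis by (simp add: continuous_at_imp_continuous_on)
qed

lemma quad_approx_translate:
  "quad_approx C f f' \<Longrightarrow> quad_approx C (\<lambda>x. f (x - a)) (\<lambda>x. f' (x - a))"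
  unfolding quad_approx_def
  by (metis add_diff_eq add.commute diff_add_eq)

lemma quad_approx_scale:
  assumes "quad_approx C f f'"
  shows "quad_approx (\<bar>c\<bar> * C) (\<lambda>x. c * f x) (\<lambda>x. c *\<^sub>R f' x)"
  unfolding quad_approx_def
proof (intro allI)
  fix x h
  have "\<bar>c * f (x + h) - c * f x - c *\<^sub>R f' x \<bullet> h\<bar> = \<bar>c\<bar> * \<bar>f (x + h) - f x - f' x \<bullet> h\<bar>"
    unfolding abs_mult[symmetric] by (simp add: algebra_simps)
  also have "\<dots> \<le> \<bar>c\<bar> * (C * (norm h)\<^sup>2)"
    by (intro mult_left_mono quad_approxD[OF assms]) auto
  finally show "\<bar>c * f (x + h) - c * f x - c *\<^sub>R f' x \<bullet> h\<bar> \<le> \<bar>c\<bar> * C * (norm h)\<^sup>2" by (simp add: ac_simps)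
qed

definition bump :: "real \<Rightarrow> 'a::euclidean_space \<Rightarrow> real" where
  "bump r x = (max 0 (1 - (norm x / r)\<^sup>2))\<^sup>2"

definition bump' :: "real \<Rightarrow> 'a::euclidean_space \<Rightarrow> 'a" where
  "bump' r x = (- (4 / r\<^sup>2) * max 0 (1 - (norm x / r)\<^sup>2)) *\<^sub>R x"

lemma sq_pos_part_quad:
  fixes s t :: real
  shows "0 \<le> (max 0 t)\<^sup>2 - (max 0 s)\<^sup>2 - 2 * max 0 s * (t - s)"
    and "(max 0 t)\<^sup>2 - (max 0 s)\<^sup>2 - 2 * max 0 s * (t - s) \<le> (t - s)\<^sup>2"
proof -
  consider "s \<le> 0" "t \<le> 0" | "s \<le> 0" "t \<ge> 0" | "s \<ge> 0" "t \<ge> 0" | "s \<ge> 0" "t \<le> 0" by linarith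
  then have "0 \<le> (max 0 t)\<^sup>2 - (max 0 s)\<^sup>2 - 2 * max 0 s * (t - s) \<and>
     (max 0 t)\<^sup>2 - (max 0 s)\<^sup>2 - 2 * max 0 s * (t - s) \<le> (t - s)\<^sup>2"
  proof cases
    case 2
    then have "t\<^sup>2 \<le> (t - s)\<^sup>2" by (intro power_mono) auto
    with 2 show ?thesis by (simp add: max_def)
  next
    case 3
    have "t\<^sup>2 - s\<^sup>2 - 2 * s * (t - s) = (t - s)\<^sup>2" by (simp add: power2_eq_square algebra_simps)
    with 3 show ?thesis by (simp add: max_def)
  next
    case 4
    have "(0::real)\<^sup>2 - s\<^sup>2 - 2 * s * (t - s) = s\<^sup>2 - 2 * (s * t)" "(t - s)\<^sup>2 = s\<^sup>2 - 2 * (s * t) + t\<^sup>2"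
      by (auto simp add: power2_eq_square algebra_simps)
    moreover have "s * t \<le> 0" using 4 by (simp add: mult_nonneg_nonpos)
    moreover have "max 0 s = s" "max 0 t = 0" using 4 by auto
    ultimately show ?thesis using zero_le_power2[of s] zero_le_power2[of t] by (simp only:) linarith
  qed auto
  then show "0 \<le> (max 0 t)\<^sup>2 - (max 0 s)\<^sup>2 - 2 * max 0 s * (t - s)"
    and "(max 0 t)\<^sup>2 - (max 0 s)\<^sup>2 - 2 * max 0 s * (t - s) \<le> (t - s)\<^sup>2" by auto
qed

lemma bump_nonneg: "0 \<le> bump r x" by (simp add: bump_def)

lemma bump_le_1: "bump r x \<le> 1"
  unfolding bump_def by (simp add: power_le_one)

lemma bump_eq_0: "r > 0 \<Longrightarrow> norm x \<ge> r \<Longrightarrow> bump r x = 0"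
  by (simp add: bump_def max_def one_le_power antisym)

lemma bump'_eq_0: "r > 0 \<Longrightarrow> norm x \<ge> r \<Longrightarrow> bump' r x = 0"
  by (simp add: bump'_def max_def one_le_power antisym)

lemma bump_ge_half: "r > 0 \<Longrightarrow> norm x \<le> r / 2 \<Longrightarrow> bump r x \<ge> 1 / 2"
proof -
  assume r: "r > 0" "norm x \<le> r / 2"
  have "(norm x / r)\<^sup>2 \<le> (1 / 2)\<^sup>2" using r by (intro power_mono) (auto simp: field_simps)
  then have q: "3 / 4 \<le> max 0 (1 - (norm x / r)\<^sup>2)" unfolding power_one_over by simp
  have "(3 / 4)\<^sup>2 \<le> bump r x" unfolding bump_def by (rule power_mono[OF q]) simp
  moreover have "1 / 2 \<le> (3 / 4 :: real)\<^sup>2" by (simp add: power2_eq_square)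
  ultimately show ?thesis by linarith
qed

lemma sq_norm_scale: "(norm (x /\<^sub>R r))\<^sup>2 = (norm x / r)\<^sup>2"
  by (simp add: power_mult_distrib divide_inverse power_inverse mult.commute)

lemma bump_scale: "bump r x = bump 1 (x /\<^sub>R r)"
  unfolding bump_def div_by_1 sq_norm_scale ..

lemma bump'_scale: "bump' r x = (1 / r) *\<^sub>R bump' 1 (x /\<^sub>R r)"
  unfolding bump'_def div_by_1 sq_norm_scale by (simp add: power2_eq_square divide_inverse ac_simps)

lemma norm_bump'_le: "r > 0 \<Longrightarrow> norm (bump' r x) \<le> 4 / r"
proof -
  assume r: "r > 0"
  define y where "y = norm x / r"
  have y: "y \<ge> 0" using r by (simp add: y_def)
  have *: "max 0 (1 - y\<^sup>2) * y \<le> 1"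
  proof (cases "y \<le> 1")
    case True
    have "max 0 (1 - y\<^sup>2) * y \<le> 1 * 1" using y True by (intro mult_mono) auto
    then show ?thesis by simp
  next
    case False
    then have "y\<^sup>2 \<ge> 1" by (simp add: one_le_power)
    then show ?thesis by (simp add: max_def)
  qed
  have "norm (bump' r x) = (4 / r) * (max 0 (1 - y\<^sup>2) * y)"
    using r by (simp add: bump'_def y_def power2_eq_square abs_mult)
  also have "\<dots> \<le> (4 / r) * 1" using * r by (intro mult_left_mono) auto
  finally show ?thesis by simp
qed

lemma quad_approx_bump_1: "quad_approx 11 (bump 1) (bump' 1 :: 'a::euclidean_space \<Rightarrow> 'a)"
  unfolding quad_approx_def
proof (intro allI)
  fix x h :: 'a
  define s where "s = 1 - (norm x)\<^sup>2"
  define t where "t = 1 - (norm (x + h))\<^sup>2"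
  have ts: "t - s = - (2 * (x \<bullet> h) + (norm h)\<^sup>2)"
    unfolding t_def s_def power2_norm_eq_inner by (simp add: inner_add_left inner_add_right inner_commute)
  have eq: "bump 1 (x + h) - bump 1 x - bump' 1 x \<bullet> h =
     ((max 0 t)\<^sup>2 - (max 0 s)\<^sup>2 - 2 * max 0 s * (t - s)) - 2 * max 0 s * (norm h)\<^sup>2"
    unfolding ts by (simp add: bump_def bump'_def s_def t_def algebra_simps)
  have cs: "\<bar>x \<bullet> h\<bar> \<le> norm x * norm h" by (rule Cauchy_Schwarz_ineq2)
  consider "norm h \<ge> 1" | "norm h \<le> 1" "norm x \<le> 1" | "norm h \<le> 1" "norm x > 1" by linarith
  then show "\<bar>bump 1 (x + h) - bump 1 x - bump' 1 x \<bullet> h\<bar> \<le> 11 * (norm h)\<^sup>2"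
  proof cases
    case 1
    have "\<bar>bump' 1 x \<bullet> h\<bar> \<le> norm (bump' 1 x) * norm h" by (rule Cauchy_Schwarz_ineq2)
    also have "\<dots> \<le> 4 * norm h" using norm_bump'_le[of 1 x] by (intro mult_right_mono) auto
    finally have "\<bar>bump 1 (x + h) - bump 1 x - bump' 1 x \<bullet> h\<bar> \<le> 1 + 4 * norm h"
      using bump_nonneg[of 1 x] bump_le_1[of 1 x] bump_nonneg[of 1 "x + h"] bump_le_1[of 1 "x + h"]
      by linarith
    also have "\<dots> \<le> 11 * norm h" using 1 by linarith
    also have "\<dots> \<le> 11 * (norm h)\<^sup>2" using self_le_power[OF 1, of 2] by simp
    finally show ?thesis .
  next
    case 2
    have "norm x * norm h \<le> norm h" using 2 by (simp add: mult_left_le_one_le)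
    moreover have "(norm h)\<^sup>2 \<le> norm h" using 2 by (simp add: power2_eq_square mult_left_le_one_le)
    ultimately have "\<bar>t - s\<bar> \<le> 3 * norm h" unfolding ts using cs by (smt (verit) zero_le_power2)
    then have "(t - s)\<^sup>2 \<le> 9 * (norm h)\<^sup>2"
      using power_mono[of "\<bar>t - s\<bar>" "3 * norm h" 2] by (simp add: power_mult_distrib)
    moreover have "0 \<le> max 0 s * (norm h)\<^sup>2" "max 0 s * (norm h)\<^sup>2 \<le> (norm h)\<^sup>2"
      by (auto simp: s_def mult_left_le_one_le)
    ultimately show ?thesis unfolding eq using sq_pos_part_quad[of t s] zero_le_power2[of "norm h"] by linarith
  next
    case 3
    then have s: "max 0 s = 0" by (simp add: s_def one_le_power less_imp_le)
    have "t \<le> 2 * norm h"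
    proof (cases "norm (x + h) \<le> 1")
      case True
      have "norm x \<le> norm (x + h) + norm h" using norm_triangle_ineq4[of "x + h" h] by simp
      then have "1 - norm (x + h) \<le> norm h" using 3 by simp
      moreover have "t = (1 - norm (x + h)) * (1 + norm (x + h))" by (simp add: t_def power2_eq_square algebra_simps)
      moreover have "(1 - norm (x + h)) * (1 + norm (x + h)) \<le> norm h * 2"
        using True calculation(1) by (intro mult_mono) auto
      ultimately show ?thesis by simp
    next
      case False
      then have "t \<le> 0" by (simp add: t_def one_le_power)
      then show ?thesis using norm_ge_zero[of h] by linarith
    qed
    then have "(max 0 t)\<^sup>2 \<le> (2 * norm h)\<^sup>2" by (intro power_mono) auto
    moreover have "(2 * norm h)\<^sup>2 \<le> 11 * (norm h)\<^sup>2" by (simp add: power_mult_distrib)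
    ultimately have "(max 0 t)\<^sup>2 \<le> 11 * (norm h)\<^sup>2" by (rule order_trans)
    then show ?thesis unfolding eq s by simp
  qed
qed

lemma quad_approx_bump:
  assumes "r > 0"
  shows "quad_approx (11 / r\<^sup>2) (bump r) (bump' r)"
  unfolding quad_approx_def
proof (intro allI)
  fix x h :: 'a
  have "\<bar>bump 1 (x /\<^sub>R r + h /\<^sub>R r) - bump 1 (x /\<^sub>R r) - bump' 1 (x /\<^sub>R r) \<bullet> (h /\<^sub>R r)\<bar>
      \<le> 11 * (norm (h /\<^sub>R r))\<^sup>2"
    by (rule quad_approxD[OF quad_approx_bump_1])
  then show "\<bar>bump r (x + h) - bump r x - bump' r x \<bullet> h\<bar> \<le> 11 / r\<^sup>2 * (norm h)\<^sup>2"
    using assms unfolding bump_scale[of r] bump'_scale[of r]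
    by (simp add: scaleR_add_right divide_inverse power_mult_distrib mult.commute power_inverse mult.left_commute)
qed

lemma bump_lipschitz:
  assumes "r > 0"
  shows "\<bar>bump r y - bump r x\<bar> \<le> 4 / r * norm (y - x)"
  by (rule GDERIV_bound_imp_lipschitz[of _ "bump' r"])
     (auto intro: quad_approx_loc_GDERIV quad_approx_imp_loc quad_approx_bump norm_bump'_le assms)

lemma bump_minus [simp]: "bump r (- x) = bump r x"
  by (simp add: bump_def)

lemma bump'_minus [simp]: "bump' r (- x) = - bump' r x"
  by (simp add: bump'_def)

lemma lipschitz_grad_imp_quad:
  fixes f :: "'a::euclidean_space \<Rightarrow> real"
  assumes "convex S" "\<And>x. x \<in> S \<Longrightarrow> GDERIV f x :> f' x"
    and K: "\<And>x y. x \<in> S \<Longrightarrow> y \<in> S \<Longrightarrow> norm (f' x - f' y) \<le> K * norm (x - y)"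
    and x: "x \<in> S" "x + h \<in> S" and "K \<ge> 0"
  shows "\<bar>f (x + h) - f x - f' x \<bullet> h\<bar> \<le> K * (norm h)\<^sup>2"
proof -
  define g where "g y = f y - y \<bullet> f' x" for y
  let ?T = "closed_segment x (x + h)"
  have sub: "?T \<subseteq> S" using assms(1) x by (simp add: closed_segment_subset)
  have "norm (g (x + h) - g x) \<le> (K * norm h) * norm (x + h - x)"
  proof (rule differentiable_bound[of ?T])
    show "(g has_derivative (\<lambda>k. k \<bullet> f' y - k \<bullet> f' x)) (at y within ?T)" if "y \<in> ?T" for y
      using assms(2)[of y] that sub unfolding g_def gderiv_def
      by (auto intro!: derivative_eq_intros intro: has_derivative_at_withinI)
    show "onorm (\<lambda>k. k \<bullet> f' y - k \<bullet> f' x) \<le> K * norm h" if y: "y \<in> ?T" for y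
    proof (rule onorm_bound)
      show "0 \<le> K * norm h" using \<open>K \<ge> 0\<close> by simp
      fix k :: 'a
      have "norm (f' y - f' x) \<le> K * norm h"
        using K[of y x] y sub x(1) mult_left_mono[OF _ \<open>K \<ge> 0\<close>, of "norm (y - x)" "norm h"] segment_bound1[OF y]
        by auto
      then have "norm k * norm (f' y - f' x) \<le> norm k * (K * norm h)" by (intro mult_left_mono) auto
      then show "norm (k \<bullet> f' y - k \<bullet> f' x) \<le> K * norm h * norm k"
        using Cauchy_Schwarz_ineq2[of k "f' y - f' x"] by (simp add: inner_diff_right ac_simps)
    qed
  qed auto
  then show ?thesis unfolding g_def
    by (simp add: inner_add_left inner_commute power2_eq_square algebra_simps)
qed

lemma inner_Basis_sum_bound:
  fixes h :: "'a::euclidean_space"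
  assumes "\<And>j. j \<in> Basis \<Longrightarrow> \<bar>c j\<bar> \<le> M"
  shows "\<bar>\<Sum>j\<in>Basis. (h \<bullet> j) * c j\<bar> \<le> real DIM('a) * M * norm h"
proof -
  have "\<bar>\<Sum>j\<in>Basis. (h \<bullet> j) * c j\<bar> \<le> (\<Sum>j\<in>(Basis::'a set). norm h * M)"
  proof (rule order_trans[OF sum_abs], rule sum_mono)
    fix j :: 'a assume j: "j \<in> Basis"
    then show "\<bar>(h \<bullet> j) * c j\<bar> \<le> norm h * M"
      unfolding abs_mult using assms[OF j] by (intro mult_mono) (auto simp: Basis_le_norm)
  qed
  then show ?thesis by (simp add: mult.commute mult.left_commute)
qed

lemma bounded_partials_imp_lipschitz:
  fixes g :: "'a::euclidean_space \<Rightarrow> real"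
  assumes "convex S" "\<And>x. x \<in> S \<Longrightarrow> (g has_derivative (\<lambda>h. \<Sum>j\<in>Basis. (h \<bullet> j) * d j x)) (at x)"
    and M: "\<And>x j. x \<in> S \<Longrightarrow> j \<in> Basis \<Longrightarrow> \<bar>d j x\<bar> \<le> M"
    and "x \<in> S" "y \<in> S" "M \<ge> 0"
  shows "\<bar>g x - g y\<bar> \<le> real DIM('a) * M * norm (x - y)"
proof -
  have "norm (g x - g y) \<le> real DIM('a) * M * norm (x - y)"
  proof (rule differentiable_bound[OF \<open>convex S\<close>])
    show "(g has_derivative (\<lambda>h. \<Sum>j\<in>Basis. (h \<bullet> j) * d j z)) (at z within S)" if "z \<in> S" for z
      using assms(2)[OF that] by (rule has_derivative_at_withinI)
    show "onorm (\<lambda>h. \<Sum>j\<in>Basis. (h \<bullet> j) * d j z) \<le> real DIM('a) * M" if "z \<in> S" for z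
      using inner_Basis_sum_bound[of "\<lambda>j. d j z" M] M[OF that] \<open>M \<ge> 0\<close>
      by (intro onorm_bound) auto
  qed (use assms in auto)
  then show ?thesis by simp
qed

lemma has_derivative_Basis_expand:
  fixes g :: "'a::euclidean_space \<Rightarrow> real"
  assumes "(g has_derivative g') (at x)"
  shows "(g has_derivative (\<lambda>h. \<Sum>j\<in>Basis. (h \<bullet> j) * g' j)) (at x)"
proof -
  have "g' h = (\<Sum>j\<in>Basis. (h \<bullet> j) * g' j)" for h
  proof -
    have "bounded_linear g'" using assms by (rule has_derivative_bounded_linear)
    then have "linear g'" by (rule bounded_linear.linear)
    then have "g' (\<Sum>j\<in>Basis. (h \<bullet> j) *\<^sub>R j) = (\<Sum>j\<in>Basis. (h \<bullet> j) *\<^sub>R g' j)"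
      by (simp add: linear_sum linear_cmul)
    then show ?thesis by (simp add: euclidean_representation)
  qed
  then have "g' = (\<lambda>h. \<Sum>j\<in>Basis. (h \<bullet> j) * g' j)" by (rule ext)
  with assms show ?thesis by metis
qed

lemma GDERIV_sum_Basis:
  fixes g :: "'a::euclidean_space \<Rightarrow> real"
  shows "(g has_derivative (\<lambda>h. \<Sum>j\<in>Basis. (h \<bullet> j) * d j)) (at x) \<longleftrightarrow> GDERIV g x :> (\<Sum>j\<in>Basis. d j *\<^sub>R j)"
  unfolding gderiv_def by (simp add: inner_sum_right mult.commute)

lemma Ck_on_SucI:
  assumes "\<And>x. (f has_derivative f' x) (at x)" "\<And>i. i \<in> Basis \<Longrightarrow> Ck_on k UNIV (\<lambda>x. f' x i)"
  shows "Ck_on (Suc k) UNIV f"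
proof -
  have "frechet_derivative f (at x) = f' x" for x
    using assms(1) by (rule frechet_derivative_at[symmetric])
  then show ?thesis using assms unfolding Ck_on.simps differentiable_def by auto
qed

lemma Ck_on_SucE:
  assumes "Ck_on (Suc k) UNIV f"
  obtains f' where "\<And>x. (f has_derivative f' x) (at x)" "\<And>i. i \<in> Basis \<Longrightarrow> Ck_on k UNIV (\<lambda>x. f' x i)"
proof (rule that)
  show "(f has_derivative (\<lambda>i. frechet_derivative f (at x) i)) (at x)" for x
    using assms by (simp add: frechet_derivative_works[symmetric])
  show "Ck_on k UNIV (\<lambda>x. frechet_derivative f (at x) i)" if "i \<in> Basis" for i
    using assms that by auto
qed

lemma Ck_on_SucD: "Ck_on (Suc k) S f \<Longrightarrow> Ck_on k S f"
proof (induction k arbitrary: f)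
  case 0
  then show ?case by (auto simp: continuous_at_imp_continuous_on differentiable_imp_continuous_within)
next
  case (Suc k)
  then show ?case by (subst Ck_on.simps, subst (asm) (2) Ck_on.simps) blast
qed

lemma Ck_on_const: "Ck_on k UNIV (\<lambda>x. c)"
  by (induction k arbitrary: c) (auto intro!: Ck_on_SucI[where f' = "\<lambda>x h. 0"] simp del: Ck_on.simps(2))

lemma Ck_on_inner: "Ck_on k UNIV (\<lambda>x. x \<bullet> a)"
proof (cases k)
  case (Suc n)
  then show ?thesis
    by (auto intro!: Ck_on_SucI[where f' = "\<lambda>x h. h \<bullet> a"] Ck_on_const derivative_eq_intros simp del: Ck_on.simps(2))
qed (auto intro: continuous_intros)

lemma Ck_on_add: "Ck_on k UNIV f \<Longrightarrow> Ck_on k UNIV g \<Longrightarrow> Ck_on k UNIV (\<lambda>x. f x + g x)"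
proof (induction k arbitrary: f g)
  case (Suc k)
  obtain f' where f: "\<And>x. (f has_derivative f' x) (at x)" "\<And>i. i \<in> Basis \<Longrightarrow> Ck_on k UNIV (\<lambda>x. f' x i)"
    using Suc.prems(1) by (rule Ck_on_SucE) blast
  obtain g' where g: "\<And>x. (g has_derivative g' x) (at x)" "\<And>i. i \<in> Basis \<Longrightarrow> Ck_on k UNIV (\<lambda>x. g' x i)"
    using Suc.prems(2) by (rule Ck_on_SucE) blast
  show ?case
    by (rule Ck_on_SucI[where f' = "\<lambda>x h. f' x h + g' x h"]) (auto intro!: derivative_intros f g Suc.IH)
qed (auto intro: continuous_intros)

lemma Ck_on_mult: "Ck_on k UNIV f \<Longrightarrow> Ck_on k UNIV g \<Longrightarrow> Ck_on k UNIV (\<lambda>x. f x * g x)"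
proof (induction k arbitrary: f g)
  case (Suc k)
  obtain f' where f: "\<And>x. (f has_derivative f' x) (at x)" "\<And>i. i \<in> Basis \<Longrightarrow> Ck_on k UNIV (\<lambda>x. f' x i)"
    using Suc.prems(1) by (rule Ck_on_SucE) blast
  obtain g' where g: "\<And>x. (g has_derivative g' x) (at x)" "\<And>i. i \<in> Basis \<Longrightarrow> Ck_on k UNIV (\<lambda>x. g' x i)"
    using Suc.prems(2) by (rule Ck_on_SucE) blast
  show ?case
    by (rule Ck_on_SucI[where f' = "\<lambda>x h. f x * g' x h + f' x h * g x"])
       (auto intro!: has_derivative_mult f g Suc.IH Ck_on_add Suc.prems[THEN Ck_on_SucD])
qed (auto intro: continuous_intros)

lemma Ck_on_sum: "finite A \<Longrightarrow> (\<And>a. a \<in> A \<Longrightarrow> Ck_on k UNIV (f a)) \<Longrightarrow> Ck_on k UNIV (\<lambda>x. \<Sum>a\<in>A. f a x)"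
  by (induction A rule: finite_induct) (auto intro: Ck_on_add Ck_on_const)

lemma Ck_on_sq_norm: "Ck_on k UNIV (\<lambda>y. (norm (y - a))\<^sup>2)"
proof -
  have "(norm (y - a))\<^sup>2 = (\<Sum>b\<in>Basis. (y \<bullet> b + - (a \<bullet> b)) * (y \<bullet> b + - (a \<bullet> b)))" for y
    unfolding power2_norm_eq_inner by (subst euclidean_inner) (simp add: inner_diff_left)
  then show ?thesis
    by (simp only:) (intro finite_Basis Ck_on_sum Ck_on_mult Ck_on_add Ck_on_inner Ck_on_const)
qed

lemma Ck_on_slice_quad_approx:
  fixes \<phi> :: "real \<times> 'a::euclidean_space \<Rightarrow> real"
  assumes \<phi>: "Ck_on 2 (Q T) \<phi>" and t: "0 < t" "t < T"
  obtains D where "quad_approx_loc (\<lambda>y. \<phi> (t, y)) D"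
proof -
  have tQ: "(t, y) \<in> Q T" for y :: 'a using t by (simp add: Q_def)
  have bas: "(0, i) \<in> (Basis :: (real \<times> 'a) set)" if "i \<in> Basis" for i :: 'a
    using that by (simp add: Basis_prod_def)
  define F where "F i w = frechet_derivative \<phi> (at w) (0, i)" for i :: 'a and w
  define FF where "FF i j w = frechet_derivative (F i) (at w) (0, j)" for i j :: 'a and w
  define D where "D y = (\<Sum>i\<in>Basis. F i (t, y) *\<^sub>R i)" for y
  have \<phi>2: "Ck_on (Suc (Suc 0)) (Q T) \<phi>" using \<phi> by (simp add: numeral_2_eq_2)
  have d1: "\<phi> differentiable (at (t, y))" for y using \<phi>2 tQ by auto
  have c1: "Ck_on (Suc 0) (Q T) (F i)" if "i \<in> Basis" for i
    using \<phi>2 bas[OF that] unfolding F_def by (subst (asm) Ck_on.simps) blast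
  have d2: "F i differentiable (at (t, y))" if "i \<in> Basis" for i y
    using c1[OF that] tQ by auto
  have c2: "continuous_on (Q T) (FF i j)" if "i \<in> Basis" "j \<in> Basis" for i j
    using c1[OF that(1)] bas[OF that(2)] unfolding FF_def by auto
  have slice: "((\<lambda>y. g (t, y)) has_derivative (\<lambda>h. \<Sum>j\<in>Basis. (h \<bullet> j) * frechet_derivative g (at (t, y)) (0, j))) (at y)"
    if "g differentiable (at (t, y))" for g :: "real \<times> 'a \<Rightarrow> real" and y
  proof (rule has_derivative_Basis_expand)
    have "(g has_derivative frechet_derivative g (at (t, y))) (at (t, y))"
      using that by (simp add: frechet_derivative_works)
    moreover have "((\<lambda>y. (t, y)) has_derivative (\<lambda>h. (0, h))) (at y)"
      by (auto intro!: derivative_eq_intros)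
    ultimately show "((\<lambda>y. g (t, y)) has_derivative (\<lambda>h. frechet_derivative g (at (t, y)) (0, h))) (at y)"
      using has_derivative_compose by fastforce
  qed
  have G: "GDERIV (\<lambda>y. \<phi> (t, y)) y :> D y" for y
    using slice[OF d1] unfolding GDERIV_sum_Basis D_def F_def .
  have "\<exists>C\<ge>0. \<forall>x h. norm x \<le> R \<longrightarrow> norm h \<le> 1 \<longrightarrow>
     \<bar>\<phi> (t, x + h) - \<phi> (t, x) - D x \<bullet> h\<bar> \<le> C * (norm h)\<^sup>2" for R
  proof -
    have "\<exists>M. \<forall>y\<in>cball 0 (R + 1). \<bar>FF i j (t, y)\<bar> \<le> M" if "i \<in> Basis" "j \<in> Basis" for i j
    proof -
      have "continuous_on (cball 0 (R + 1)) (\<lambda>y. FF i j (t, y))"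
        by (rule continuous_on_compose2[OF c2[OF that]]) (auto intro!: continuous_intros tQ)
      then have "bounded ((\<lambda>y. FF i j (t, y)) ` cball 0 (R + 1))"
        by (intro compact_imp_bounded compact_continuous_image) auto
      then show ?thesis unfolding bounded_iff by auto
    qed
    then obtain M where M: "\<And>i j y. i \<in> Basis \<Longrightarrow> j \<in> Basis \<Longrightarrow> y \<in> cball 0 (R + 1) \<Longrightarrow> \<bar>FF i j (t, y)\<bar> \<le> M i j"
      by metis
    define N where "N = (\<Sum>i\<in>(Basis::'a set). \<Sum>j\<in>(Basis::'a set). \<bar>M i j\<bar>)"
    have N: "\<bar>FF i j (t, y)\<bar> \<le> N" if "i \<in> Basis" "j \<in> Basis" "y \<in> cball 0 (R + 1)" for i j y
    proof -
      have "\<bar>M i j\<bar> \<le> (\<Sum>j\<in>(Basis::'a set). \<bar>M i j\<bar>)" using that by (intro member_le_sum) auto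
      also have "\<dots> \<le> N" unfolding N_def using that
        by (intro member_le_sum[of i Basis "\<lambda>i. \<Sum>j\<in>(Basis::'a set). \<bar>M i j\<bar>"]) (auto intro: sum_nonneg)
      finally show ?thesis using M[OF that] by linarith
    qed
    have N0: "N \<ge> 0" unfolding N_def by (intro sum_nonneg) auto
    have lip: "norm (D x - D y) \<le> DIM('a) * (DIM('a) * N) * norm (x - y)"
      if "x \<in> cball 0 (R + 1)" "y \<in> cball 0 (R + 1)" for x y
    proof -
      have "norm (D x - D y) \<le> (\<Sum>i\<in>(Basis::'a set). DIM('a) * N * norm (x - y))"
        unfolding D_def sum_subtractf[symmetric] scaleR_diff_left[symmetric]
      proof (rule sum_norm_le)
        fix i :: 'a assume i: "i \<in> Basis"
        have "\<bar>F i (t, x) - F i (t, y)\<bar> \<le> DIM('a) * N * norm (x - y)"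
          using slice[OF d2[OF i]] N[OF i] N0 that bounded_partials_imp_lipschitz[where S = "cball 0 (R + 1)"
              and d = "\<lambda>j y. FF i j (t, y)" and g = "\<lambda>y. F i (t, y)" and M = N and x = x and y = y]
          by (auto simp: FF_def)
        then show "norm ((F i (t, x) - F i (t, y)) *\<^sub>R i) \<le> DIM('a) * N * norm (x - y)"
          using i by simp
      qed
      then show ?thesis by simp
    qed
    show ?thesis
    proof (intro exI[of _ "DIM('a) * (DIM('a) * N)"] conjI allI impI)
      fix x h :: 'a assume xh: "norm x \<le> R" "norm h \<le> 1"
      have "norm (x + h) \<le> R + 1" using norm_triangle_ineq[of x h] xh by linarith
      then show "\<bar>\<phi> (t, x + h) - \<phi> (t, x) - D x \<bullet> h\<bar> \<le> DIM('a) * (DIM('a) * N) * (norm h)\<^sup>2"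
        using xh N0 lip by (intro lipschitz_grad_imp_quad[where f = "\<lambda>y. \<phi> (t, y)" and S = "cball 0 (R + 1)"] G) auto
    qed (use N0 in auto)
  qed
  then have "quad_approx_loc (\<lambda>y. \<phi> (t, y)) D" unfolding quad_approx_loc_def by simp
  then show ?thesis by (rule that)
qed

section \<open>Levy measures\<close>

locale levy =
  fixes \<nu> :: "'a::euclidean_space measure"
  assumes sets_nu [measurable_cong, simp]: "sets \<nu> = sets borel"
    and sigma_finite_nu: "sigma_finite_measure \<nu>"
    and integrable_nu: "integrable \<nu> (\<lambda>z. min ((norm z)\<^sup>2) (norm z))"
    and AE_sphere: "\<And>r. AE z in \<nu>. norm z \<noteq> r"
    and lower_nu: "\<And>r. r > 0 \<Longrightarrow> \<exists>c>0. \<forall>h\<in>borel_measurable borel.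
       ennreal c * (\<integral>\<^sup>+z. h z * indicator (cball 0 r) z \<partial>lborel) \<le> (\<integral>\<^sup>+z. h z \<partial>\<nu>)"

lemma cball_borel [measurable]: "cball a r \<in> sets borel"
  by (simp add: borel_closed)

lemma nn_integral_annuli_finite:
  fixes f :: "'a::euclidean_space \<Rightarrow> real"
  assumes [measurable]: "f \<in> borel_measurable borel"
    and bd: "\<And>z. z \<noteq> 0 \<Longrightarrow> f z \<noteq> 0 \<Longrightarrow> \<exists>k. norm z \<le> \<beta> k \<and> f z \<le> \<alpha> k"
    and "\<And>k. 0 \<le> \<alpha> k" "\<And>k. 0 \<le> \<beta> k" "summable (\<lambda>k. \<alpha> k * \<beta> k ^ DIM('a))"
  shows "(\<integral>\<^sup>+z. ennreal (f z) \<partial>lborel) < \<infinity>"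
proof -
  have AE0: "AE z in (lborel :: 'a measure). z \<noteq> 0"
    by (rule AE_lborel_singleton)
  have "(\<integral>\<^sup>+z. ennreal (f z) \<partial>lborel) \<le> (\<integral>\<^sup>+z. (\<Sum>k. ennreal (\<alpha> k) * indicator (cball 0 (\<beta> k)) (z::'a)) \<partial>lborel)"
  proof (intro nn_integral_mono_AE eventually_mono[OF AE0])
    fix z :: 'a assume elim: "z \<noteq> 0"
    show "ennreal (f z) \<le> (\<Sum>k. ennreal (\<alpha> k) * indicator (cball 0 (\<beta> k)) z)"
    proof (cases "f z = 0")
      case False
      then obtain k where k: "norm z \<le> \<beta> k" "f z \<le> \<alpha> k" using bd elim by blast
      have "ennreal (f z) \<le> ennreal (\<alpha> k) * indicator (cball 0 (\<beta> k)) z"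
        using k by (simp add: ennreal_leI)
      also have "\<dots> \<le> (\<Sum>k. ennreal (\<alpha> k) * indicator (cball 0 (\<beta> k)) z)"
      proof -
        have "(\<Sum>j\<in>{k}. ennreal (\<alpha> j) * indicator (cball 0 (\<beta> j)) z) \<le> (\<Sum>k. ennreal (\<alpha> k) * indicator (cball 0 (\<beta> k)) z)"
          by (rule sum_le_suminf) auto
        then show ?thesis by (simp only: sum.insert[OF finite.emptyI] sum.empty empty_iff not_False_eq_True add_0_right)
      qed
      finally show ?thesis .
    qed simp
  qed
  also have "\<dots> = (\<Sum>k. \<integral>\<^sup>+z. ennreal (\<alpha> k) * indicator (cball 0 (\<beta> k)) (z::'a) \<partial>lborel)"
    by (rule nn_integral_suminf) measurable
  also have "\<dots> = (\<Sum>k. ennreal (unit_ball_vol (DIM('a)) * (\<alpha> k * \<beta> k ^ DIM('a))))"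
    using assms(3,4) by (intro suminf_cong) (simp add: nn_integral_cmult_indicator emeasure_cball
        ennreal_mult'[symmetric] ac_simps del: ennreal_mult')
  also have "\<dots> < \<infinity>"
    using assms(3,4) by (subst suminf_ennreal2) (auto intro!: assms(5) summable_mult)
  finally show ?thesis .
qed

lemma dyadic_real:
  assumes "1 \<le> x"
  obtains k :: nat where "2 powr real k \<le> x" "x < 2 powr (real k + 1)"
proof -
  define k where "k = nat \<lfloor>log 2 x\<rfloor>"
  have "log 2 x \<ge> 0" using assms by simp
  then have "real k \<le> log 2 x" "log 2 x < real k + 1" unfolding k_def by linarith+
  then have "2 powr real k \<le> x" "x < 2 powr (real k + 1)" using assms
    by (auto simp: le_log_iff log_less_iff)
  then show ?thesis by (rule that)
qed

lemma summable_powr_geometric: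
  fixes s :: real
  assumes "s < 0"
  shows "summable (\<lambda>k. c * 2 powr (s * real k))"
proof -
  have "(2 powr s) ^ k = 2 powr (s * real k)" for k
    by (simp add: powr_powr powr_realpow[symmetric])
  moreover have "summable (\<lambda>k. c * (2 powr s) ^ k)"
    using assms by (intro summable_mult summable_geometric) (simp add: powr_less_one)
  ultimately show ?thesis by simp
qed

lemma cond_nu_imp_levy:
  fixes \<nu> :: "'a::euclidean_space measure"
  assumes "cond_nu \<sigma> \<nu>"
  shows "levy \<nu>"
proof -
  let ?d = "real DIM('a)"
  obtain c g where \<sigma>: "1 < \<sigma>" "\<sigma> < 2" and c: "c > 0" and [measurable]: "g \<in> borel_measurable borel"
    and \<nu>: "\<nu> = density lborel (\<lambda>z. ennreal (g z))"
    and lo: "\<And>z. z \<noteq> 0 \<Longrightarrow> 1 / c * norm z powr (- ?d - \<sigma>) \<le> g z"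
    and up: "\<And>z. z \<noteq> 0 \<Longrightarrow> g z \<le> c * norm z powr (- ?d - \<sigma>)"
    using assms unfolding cond_nu_def by blast
  have d1: "2 - ?d - \<sigma> \<le> 0" "1 - ?d - \<sigma> \<le> 0" using DIM_positive[where 'a='a] \<sigma> by linarith+
  have fin1: "(\<integral>\<^sup>+z. ennreal (g z * (norm z)\<^sup>2 * indicator (cball 0 1) z) \<partial>lborel) < \<infinity>"
  proof (rule nn_integral_annuli_finite[where \<beta> = "\<lambda>k. 2 powr (- real k)" and
        \<alpha> = "\<lambda>k. c * (2 powr (- real k - 1)) powr (2 - ?d - \<sigma>)"])
    fix z :: 'a assume z: "z \<noteq> 0" "g z * (norm z)\<^sup>2 * indicator (cball 0 1) z \<noteq> 0"
    then have z1: "norm z \<le> 1" by (auto simp: indicator_def split: if_splits)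
    then obtain k :: nat where k: "2 powr real k \<le> 1 / norm z" "1 / norm z < 2 powr (real k + 1)"
      using z(1) dyadic_real[of "1 / norm z"] by auto
    have k1: "norm z \<le> 2 powr (- real k)"
      using k(1) z(1) by (simp add: powr_minus field_simps)
    have k2: "2 powr (- real k - 1) \<le> norm z"
      using k(2) z(1) by (simp add: powr_minus powr_diff powr_add field_simps)
    have "g z * (norm z)\<^sup>2 \<le> c * norm z powr (- ?d - \<sigma>) * (norm z)\<^sup>2"
      using up[OF z(1)] by (intro mult_right_mono) auto
    also have "\<dots> = c * norm z powr (2 - ?d - \<sigma>)"
      using z(1) powr_add[of "norm z" "- ?d - \<sigma>" 2] by (simp add: powr_numeral algebra_simps)
    also have "\<dots> \<le> c * (2 powr (- real k - 1)) powr (2 - ?d - \<sigma>)"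
      using k2 c d1 by (intro mult_left_mono powr_mono2') simp_all
    finally show "\<exists>k. norm z \<le> 2 powr (- real k) \<and> g z * (norm z)\<^sup>2 * indicator (cball 0 1) z \<le>
       c * (2 powr (- real k - 1)) powr (2 - ?d - \<sigma>)" using k1 z1 by (intro exI[of _ k]) simp
  next
    have "c * (2 powr (- real k - 1)) powr (2 - ?d - \<sigma>) * (2 powr (- real k)) ^ DIM('a)
       = c * 2 powr (?d + \<sigma> - 2) * 2 powr ((\<sigma> - 2) * real k)" for k
    proof -
      have "(2 powr (- real k)) ^ DIM('a) = 2 powr (- real k * ?d)"
        by (simp add: powr_powr powr_realpow[symmetric])
      moreover have "(- real k - 1) * (2 - ?d - \<sigma>) + - real k * ?d = (?d + \<sigma> - 2) + (\<sigma> - 2) * real k"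
        by (simp add: algebra_simps)
      ultimately show ?thesis
        by (simp add: powr_powr powr_add[symmetric] mult.assoc)
    qed
    then show "summable (\<lambda>k. c * (2 powr (- real k - 1)) powr (2 - ?d - \<sigma>) * (2 powr (- real k)) ^ DIM('a))"
      using summable_powr_geometric[of "\<sigma> - 2"] \<sigma> by (simp only:)
  qed (use c in auto)
  have fin2: "(\<integral>\<^sup>+z. ennreal (g z * norm z * indicator (- cball 0 1) z) \<partial>lborel) < \<infinity>"
  proof (rule nn_integral_annuli_finite[where \<beta> = "\<lambda>k. 2 powr (real k + 1)" and
        \<alpha> = "\<lambda>k. c * (2 powr (real k)) powr (1 - ?d - \<sigma>)"])
    fix z :: 'a assume z: "z \<noteq> 0" "g z * norm z * indicator (- cball 0 1) z \<noteq> 0"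
    then have z1: "norm z > 1" by (auto simp: indicator_def split: if_splits)
    then obtain k :: nat where k: "2 powr real k \<le> norm z" "norm z < 2 powr (real k + 1)"
      using dyadic_real[of "norm z"] by auto
    have "g z * norm z \<le> c * norm z powr (- ?d - \<sigma>) * norm z"
      using up[OF z(1)] by (intro mult_right_mono) auto
    also have "\<dots> = c * norm z powr (1 - ?d - \<sigma>)"
      using z(1) powr_add[of "norm z" "- ?d - \<sigma>" 1] by (simp add: algebra_simps)
    also have "\<dots> \<le> c * (2 powr (real k)) powr (1 - ?d - \<sigma>)"
      using k c d1 by (intro mult_left_mono powr_mono2') simp_all
    finally show "\<exists>k. norm z \<le> 2 powr (real k + 1) \<and> g z * norm z * indicator (- cball 0 1) z \<le>
       c * (2 powr (real k)) powr (1 - ?d - \<sigma>)" using k z1 by (intro exI[of _ k]) simp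
  next
    have "c * (2 powr (real k)) powr (1 - ?d - \<sigma>) * (2 powr (real k + 1)) ^ DIM('a)
       = c * 2 powr ?d * 2 powr ((1 - \<sigma>) * real k)" for k
    proof -
      have "(2 powr (real k + 1)) ^ DIM('a) = 2 powr ((real k + 1) * ?d)"
        by (simp add: powr_powr powr_realpow[symmetric])
      moreover have "real k * (1 - ?d - \<sigma>) + (real k + 1) * ?d = ?d + (1 - \<sigma>) * real k"
        by (simp add: algebra_simps)
      ultimately show ?thesis
        by (simp add: powr_powr powr_add[symmetric] mult.assoc)
    qed
    then show "summable (\<lambda>k. c * (2 powr (real k)) powr (1 - ?d - \<sigma>) * (2 powr (real k + 1)) ^ DIM('a))"
      using summable_powr_geometric[of "1 - \<sigma>"] \<sigma> by (simp only:)
  qed (use c in auto)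
  have g0: "z \<noteq> 0 \<Longrightarrow> g z \<ge> 0" for z
    using lo[of z] c by (meson divide_nonneg_nonneg less_imp_le mult_nonneg_nonneg order_trans powr_ge_zero zero_le_one)
  have AE0: "AE z in (lborel :: 'a measure). z \<noteq> 0" by (rule AE_lborel_singleton)
  show ?thesis
  proof (rule levy.intro)
    show "sets \<nu> = sets borel" by (simp add: \<nu>)
    show "sigma_finite_measure \<nu>"
      unfolding \<nu> by (subst sigma_finite_measure.sigma_finite_iff_density_finite[OF sigma_finite_lborel]) auto
    show "integrable \<nu> (\<lambda>z. min ((norm z)\<^sup>2) (norm z))"
    proof (rule integrableI_bounded)
      have "(\<integral>\<^sup>+z. ennreal (norm (min ((norm z)\<^sup>2) (norm z))) \<partial>\<nu>) =
         (\<integral>\<^sup>+z. ennreal (g z) * ennreal (min ((norm z)\<^sup>2) (norm z)) \<partial>lborel)"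
        unfolding \<nu> by (subst nn_integral_density) (auto simp: min_def)
      also have "\<dots> \<le> (\<integral>\<^sup>+z. ennreal (g z * (norm z)\<^sup>2 * indicator (cball 0 1) z) +
          ennreal (g z * norm z * indicator (- cball 0 1) z) \<partial>lborel)"
      proof (intro nn_integral_mono_AE eventually_mono[OF AE0])
        fix z :: 'a assume elim: "z \<noteq> 0"
        have "min ((norm z)\<^sup>2) (norm z) \<le> (if norm z \<le> 1 then (norm z)\<^sup>2 else norm z)" by simp
        then show "ennreal (g z) * ennreal (min ((norm z)\<^sup>2) (norm z)) \<le>
          ennreal (g z * (norm z)\<^sup>2 * indicator (cball 0 1) z) +
          ennreal (g z * norm z * indicator (- cball 0 1) z)" using g0[OF elim]
          by (auto simp: ennreal_mult'[symmetric] mult_left_mono indicator_def intro!: ennreal_leI)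
      qed
      also have "\<dots> < \<infinity>"
        using fin1 fin2 by (subst nn_integral_add) auto
      finally show "(\<integral>\<^sup>+z. ennreal (norm (min ((norm z)\<^sup>2) (norm z))) \<partial>\<nu>) < \<infinity>" .
    qed (simp add: \<nu>)
    show "AE z in \<nu>. norm z \<noteq> r" for r
    proof -
      have "sphere (0::'a) r \<in> null_sets lebesgue"
        using negligible_sphere[of 0 r] by (simp add: negligible_iff_null_sets)
      then have "sphere (0::'a) r \<in> null_sets lborel"
        by (auto simp: null_sets_def)
      then have "AE z in lborel. z \<notin> sphere (0::'a) r" by (rule AE_not_in)
      then have "AE z in lborel. norm (z::'a) \<noteq> r" by (rule AE_mp) simp
      then show ?thesis unfolding \<nu> by (subst AE_density) (auto elim: AE_mp)
    qed
    fix r :: real assume r: "r > 0"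
    define e where "e = 1 / c * r powr (- ?d - \<sigma>)"
    have e: "e > 0" using c r by (simp add: e_def)
    have "ennreal e * (\<integral>\<^sup>+z. h z * indicator (cball 0 r) z \<partial>lborel) \<le> (\<integral>\<^sup>+z. h z \<partial>\<nu>)"
      if [measurable]: "h \<in> borel_measurable borel" for h :: "'a \<Rightarrow> ennreal"
    proof -
      have "ennreal e * (\<integral>\<^sup>+z. h z * indicator (cball 0 r) z \<partial>lborel) =
         (\<integral>\<^sup>+z. ennreal e * (h z * indicator (cball 0 r) z) \<partial>lborel)"
        by (rule nn_integral_cmult[symmetric]) measurable
      also have "\<dots> \<le> (\<integral>\<^sup>+z. ennreal (g z) * h z \<partial>lborel)"
      proof (intro nn_integral_mono_AE eventually_mono[OF AE0])
        fix z :: 'a assume elim: "z \<noteq> 0"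
        show "ennreal e * (h z * indicator (cball 0 r) z) \<le> ennreal (g z) * h z"
        proof (cases "norm z \<le> r")
          case True
          have "e \<le> 1 / c * norm z powr (- ?d - \<sigma>)"
            unfolding e_def using c elim True \<sigma> by (intro mult_left_mono powr_mono2') auto
          then have "ennreal e \<le> ennreal (g z)" using lo[OF elim] by (intro ennreal_leI) linarith
          then show ?thesis using True by (simp add: mult_right_mono)
        qed simp
      qed
      also have "\<dots> = (\<integral>\<^sup>+z. h z \<partial>\<nu>)" unfolding \<nu> by (subst nn_integral_density) auto
      finally show ?thesis .
    qed
    with e show "\<exists>c>0. \<forall>h\<in>borel_measurable borel.
       ennreal c * (\<integral>\<^sup>+z. h z * indicator (cball 0 r) z \<partial>lborel) \<le> (\<integral>\<^sup>+z. h z \<partial>\<nu>)" by blast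
  qed
qed

definition incr :: "('a::euclidean_space \<Rightarrow> real) \<Rightarrow> 'a \<Rightarrow> 'a \<Rightarrow> 'a \<Rightarrow> real" where
  "incr f p x z = f (x + z) - f x - (p \<bullet> z) * indicator {z. norm z \<le> 1} z"

lemma incr_measurable [measurable]:
  assumes [measurable]: "f \<in> borel_measurable borel"
  shows "(\<lambda>z. incr f p x z) \<in> borel_measurable borel"
  unfolding incr_def by measurable

lemma incr_bound:
  assumes "\<And>h. norm h \<le> 1 \<Longrightarrow> \<bar>f (x + h) - f x - p \<bullet> h\<bar> \<le> C * (norm h)\<^sup>2"
    and "\<And>h. norm h > 1 \<Longrightarrow> \<bar>f (x + h) - f x\<bar> \<le> M * norm h"
  shows "\<bar>incr f p x z\<bar> \<le> max C M * min ((norm z)\<^sup>2) (norm z)"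
proof (cases "norm z \<le> 1")
  case True
  then have "min ((norm z)\<^sup>2) (norm z) = (norm z)\<^sup>2"
    by (simp add: min_def power2_eq_square mult_left_le_one_le)
  moreover have "C * (norm z)\<^sup>2 \<le> max C M * (norm z)\<^sup>2" by (intro mult_right_mono) auto
  ultimately show ?thesis using assms(1)[OF True] True by (simp add: incr_def)
next
  case False
  then have "min ((norm z)\<^sup>2) (norm z) = norm z" using self_le_power[of "norm z" 2] by simp
  moreover have "M * norm z \<le> max C M * norm z" by (intro mult_right_mono) auto
  ultimately show ?thesis using assms(2)[of z] False by (simp add: incr_def)
qed

lemma incr_bound_bounded:
  assumes "\<And>h. norm h \<le> 1 \<Longrightarrow> \<bar>f (x + h) - f x - p \<bullet> h\<bar> \<le> C * (norm h)\<^sup>2"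
    and M: "\<And>x. \<bar>f x\<bar> \<le> M"
  shows "\<bar>incr f p x z\<bar> \<le> max C (2 * M) * min ((norm z)\<^sup>2) (norm z)"
proof (rule incr_bound[OF assms(1)])
  fix h :: 'a assume h: "norm h > 1"
  have "M \<ge> 0" using M[of x] abs_ge_zero[of "f x"] by linarith
  have "\<bar>f (x + h) - f x\<bar> \<le> 2 * M * 1" using M[of x] M[of "x + h"] by linarith
  also have "\<dots> \<le> 2 * M * norm h" using h \<open>M \<ge> 0\<close> by (intro mult_left_mono) auto
  finally show "\<bar>f (x + h) - f x\<bar> \<le> 2 * M * norm h" .
qed

lemma nonlocal_eq: "nonlocal \<nu> A x u p = (\<integral>z. indicator A z * incr u p x z \<partial>\<nu>)"
  by (simp add: nonlocal_def incr_def set_lebesgue_integral_def)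

lemma nonlocal_UNIV: "nonlocal \<nu> UNIV x u p = (\<integral>z. incr u p x z \<partial>\<nu>)"
  by (simp add: nonlocal_eq)

context levy
begin

sublocale sigma_finite_measure \<nu> by (rule sigma_finite_nu)

definition mom :: real where "mom = (\<integral>z. min ((norm z)\<^sup>2) (norm z) \<partial>\<nu>)"

definition small_mom :: "real \<Rightarrow> real" where
  "small_mom r = (\<integral>z. indicator {z. norm z \<le> r} z * min ((norm z)\<^sup>2) (norm z) \<partial>\<nu>)"

lemma mom_nonneg: "mom \<ge> 0"
  unfolding mom_def by (intro integral_nonneg_AE) auto

lemma integrable_dominated:
  assumes [measurable]: "h \<in> borel_measurable borel"
    and "\<And>z. \<bar>h z\<bar> \<le> C * min ((norm z)\<^sup>2) (norm z)"
  shows "integrable \<nu> h"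
proof (rule Bochner_Integration.integrable_bound[OF integrable_mult_right[OF integrable_nu, of C]])
  show "AE z in \<nu>. norm (h z) \<le> norm (C * min ((norm z)\<^sup>2) (norm z))"
    using order_trans[OF assms(2) abs_ge_self] by simp
qed measurable

lemma integral_dominated:
  assumes [measurable]: "h \<in> borel_measurable borel"
    and "\<And>z. \<bar>h z\<bar> \<le> C * min ((norm z)\<^sup>2) (norm z)"
  shows "\<bar>\<integral>z. h z \<partial>\<nu>\<bar> \<le> C * mom"
proof -
  have i: "integrable \<nu> h" using assms by (rule integrable_dominated)
  have "\<bar>\<integral>z. h z \<partial>\<nu>\<bar> \<le> (\<integral>z. \<bar>h z\<bar> \<partial>\<nu>)" by (rule integral_abs_bound)
  also have "\<dots> \<le> (\<integral>z. C * min ((norm z)\<^sup>2) (norm z) \<partial>\<nu>)"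
    by (intro integral_mono integrable_mult_right integrable_nu integrable_abs i assms(2))
  finally show ?thesis by (simp add: mom_def)
qed

lemma integrable_small_mom: "integrable \<nu> (\<lambda>z. indicator {z. norm z \<le> r} z * min ((norm z)\<^sup>2) (norm z))"
  by (rule integrable_dominated[where C = 1]) (auto simp: indicator_def)

lemma small_mom_bound:
  assumes [measurable]: "h \<in> borel_measurable borel"
    and "\<And>z. norm z \<le> r \<Longrightarrow> \<bar>h z\<bar> \<le> C * min ((norm z)\<^sup>2) (norm z)"
  shows "\<bar>\<integral>z. indicator {z. norm z \<le> r} z * h z \<partial>\<nu>\<bar> \<le> C * small_mom r"
proof -
  have "\<bar>\<integral>z. indicator {z. norm z \<le> r} z * h z \<partial>\<nu>\<bar> \<le> (\<integral>z. \<bar>indicator {z. norm z \<le> r} z * h z\<bar> \<partial>\<nu>)" by (rule integral_abs_bound)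
  also have "\<dots> \<le> (\<integral>z. C * (indicator {z. norm z \<le> r} z * min ((norm z)\<^sup>2) (norm z)) \<partial>\<nu>)"
  proof (intro integral_mono integrable_mult_right integrable_small_mom integrable_abs)
    show "integrable \<nu> (\<lambda>z. indicator {z. norm z \<le> r} z * h z)"
      by (rule integrable_dominated[where C = "\<bar>C\<bar>"])
         (use assms(2) in \<open>auto simp: indicator_def intro: order_trans[OF _ mult_right_mono[OF abs_ge_self]]\<close>)
  qed (use assms(2) in \<open>auto simp: indicator_def\<close>)
  finally show ?thesis by (simp add: small_mom_def)
qed

lemma small_mom_tendsto_0: "(\<lambda>n. small_mom (1 / real (Suc n))) \<longlonglongrightarrow> 0"
proof -
  have "(\<lambda>n. \<integral>z. indicator {z. norm z \<le> 1 / real (Suc n)} z * min ((norm z)\<^sup>2) (norm z) \<partial>\<nu>)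
      \<longlonglongrightarrow> (\<integral>z. 0 \<partial>\<nu>)"
  proof (rule integral_dominated_convergence[where w = "\<lambda>z. min ((norm z)\<^sup>2) (norm z)"])
    show "AE z in \<nu>. (\<lambda>n. indicator {z. norm z \<le> 1 / real (Suc n)} z * min ((norm z)\<^sup>2) (norm z)) \<longlonglongrightarrow> 0"
    proof (rule AE_I2)
      fix z :: 'a
      show "(\<lambda>n. indicator {z. norm z \<le> 1 / real (Suc n)} z * min ((norm z)\<^sup>2) (norm z)) \<longlonglongrightarrow> 0"
      proof (cases "z = 0")
        case False
        have "eventually (\<lambda>n. 1 / real (Suc n) < norm z) sequentially"
          using LIMSEQ_inverse_real_of_nat False by (intro order_tendstoD(2)) (auto simp: inverse_eq_divide)
        then have "eventually (\<lambda>n. indicator {z. norm z \<le> 1 / real (Suc n)} z * min ((norm z)\<^sup>2) (norm z) = 0) sequentially"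
          by eventually_elim auto
        then show ?thesis by (rule tendsto_eventually)
      qed simp
    qed
  qed (auto simp: indicator_def integrable_nu)
  then show ?thesis by (simp add: small_mom_def)
qed

lemma nonlocal_split:
  assumes "integrable \<nu> (incr u p x)"
  shows "nonlocal \<nu> UNIV x u p = nonlocal_le \<nu> r x u p + nonlocal_gt \<nu> r x u p"
proof -
  have [measurable]: "incr u p x \<in> borel_measurable \<nu>" using assms by simp
  have i: "integrable \<nu> (\<lambda>z. indicator A z * incr u p x z)" if "A \<in> sets borel" for A
    using integrable_mult_indicator[of A \<nu> "incr u p x"] assms that by simp
  have "nonlocal \<nu> UNIV x u p = (\<integral>z. indicator {z. norm z \<le> r} z * incr u p x z + indicator {z. norm z > r} z * incr u p x z \<partial>\<nu>)"
    unfolding nonlocal_UNIV by (intro Bochner_Integration.integral_cong) (auto simp: indicator_def)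
  then show ?thesis
    unfolding nonlocal_eq by (subst (asm) Bochner_Integration.integral_add) (auto intro!: i)
qed

lemma integrable_incr:
  assumes "quad_approx_loc u u'" "bounded (range u)"
  shows "integrable \<nu> (incr u (u' x) x)"
proof -
  obtain M where M: "\<And>x. \<bar>u x\<bar> \<le> M" using assms(2) unfolding bounded_iff by auto
  obtain C where C: "C \<ge> 0" "\<And>y h. norm y \<le> norm x \<Longrightarrow> norm h \<le> 1 \<Longrightarrow>
     \<bar>u (y + h) - u y - u' y \<bullet> h\<bar> \<le> C * (norm h)\<^sup>2" using quad_approx_locE[OF assms(1)] by blast
  have [measurable]: "u \<in> borel_measurable borel"
    by (intro borel_measurable_continuous_onI quad_approx_loc_continuous[OF assms(1)])
  show ?thesis
    by (rule integrable_dominated[OF _ incr_bound_bounded[where f = u and C = C and M = M]]) (use C M in auto)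
qed

lemma nonlocal_continuous:
  assumes "quad_approx_loc u u'" "bounded (range u)"
  shows "continuous_on UNIV (\<lambda>x. nonlocal \<nu> UNIV x u (u' x))"
proof -
  obtain M where M: "\<And>x. \<bar>u x\<bar> \<le> M" using assms(2) unfolding bounded_iff by auto
  have cu: "isCont u x" for x by (rule GDERIV_isCont[OF quad_approx_loc_GDERIV[OF assms(1)]])
  have cu': "isCont u' x" for x
    using quad_approx_loc_grad_continuous[OF assms(1)] by (simp add: continuous_on_eq_continuous_at)
  have [measurable]: "u \<in> borel_measurable borel"
    by (intro borel_measurable_continuous_onI quad_approx_loc_continuous[OF assms(1)])
  have "(\<lambda>x. nonlocal \<nu> UNIV x u (u' x)) \<midarrow>a\<rightarrow> nonlocal \<nu> UNIV a u (u' a)" for a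
    unfolding tendsto_at_iff_sequentially
  proof (intro allI impI)
    fix X :: "nat \<Rightarrow> 'a" assume X: "X \<longlonglongrightarrow> a"
    then have "bounded (range X)" by (rule convergent_imp_bounded)
    then obtain R where R: "\<And>n. norm (X n) \<le> R" unfolding bounded_iff by auto
    obtain C where C: "C \<ge> 0" "\<And>y h. norm y \<le> R \<Longrightarrow> norm h \<le> 1 \<Longrightarrow>
       \<bar>u (y + h) - u y - u' y \<bullet> h\<bar> \<le> C * (norm h)\<^sup>2" using quad_approx_locE[OF assms(1)] by blast
    have "(\<lambda>n. \<integral>z. incr u (u' (X n)) (X n) z \<partial>\<nu>) \<longlonglongrightarrow> (\<integral>z. incr u (u' a) a z \<partial>\<nu>)"
    proof (rule integral_dominated_convergence[where w = "\<lambda>z. max C (2 * M) * min ((norm z)\<^sup>2) (norm z)"])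
      show "AE z in \<nu>. (\<lambda>n. incr u (u' (X n)) (X n) z) \<longlonglongrightarrow> incr u (u' a) a z"
        unfolding incr_def
        by (intro AE_I2 tendsto_intros isCont_tendsto_compose[OF cu] isCont_tendsto_compose[OF cu'] X)
      show "AE z in \<nu>. norm (incr u (u' (X n)) (X n) z) \<le> max C (2 * M) * min ((norm z)\<^sup>2) (norm z)" for n
        using incr_bound_bounded[of u "X n" "u' (X n)" C M] C(2)[OF R[of n]] M by simp
    qed (auto intro: integrable_mult_right integrable_nu)
    then show "((\<lambda>x. nonlocal \<nu> UNIV x u (u' x)) \<circ> X) \<longlonglongrightarrow> nonlocal \<nu> UNIV a u (u' a)"
      by (simp add: nonlocal_UNIV o_def)
  qed
  then show ?thesis by (simp add: continuous_on_eq_continuous_at isCont_def)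
qed

lemma nonlocal_le_bound:
  assumes "r \<le> 1" "\<And>h. norm h \<le> 1 \<Longrightarrow> \<bar>u (x + h) - u x - p \<bullet> h\<bar> \<le> C * (norm h)\<^sup>2"
    and [measurable]: "u \<in> borel_measurable borel"
  shows "\<bar>nonlocal_le \<nu> r x u p\<bar> \<le> C * small_mom r"
  unfolding nonlocal_eq
proof (rule small_mom_bound)
  fix z :: 'a assume "norm z \<le> r"
  then have z: "norm z \<le> 1" using assms(1) by simp
  then have "min ((norm z)\<^sup>2) (norm z) = (norm z)\<^sup>2"
    by (simp add: min_def power2_eq_square mult_left_le_one_le)
  then show "\<bar>incr u p x z\<bar> \<le> C * min ((norm z)\<^sup>2) (norm z)"
    using assms(2)[OF z] z by (simp add: incr_def)
qed measurable

text \<open>Paraboloids touching \<open>u\<close> at \<open>x\<close> are admissible test functions; their contribution on small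
  jumps vanishes with the radius.\<close>

lemma visc_sol_imp_classical:
  assumes vs: "visc_sol \<nu> G u" and q: "quad_approx_loc u u'"
  shows "G x (u' x) = nonlocal \<nu> UNIV x u (u' x)"
proof -
  let ?p = "u' x"
  have bu: "bounded (range u)" using vs by (simp add: visc_sol_def visc_subsol_def)
  obtain C where C: "C \<ge> 0" "\<And>y h. norm y \<le> norm x \<Longrightarrow> norm h \<le> 1 \<Longrightarrow>
     \<bar>u (y + h) - u y - u' y \<bullet> h\<bar> \<le> C * (norm h)\<^sup>2" using quad_approx_locE[OF q] by blast
  have Cx: "norm h \<le> 1 \<Longrightarrow> \<bar>u (x + h) - u x - ?p \<bullet> h\<bar> \<le> C * (norm h)\<^sup>2" for h using C(2)[of x h] by simp
  have [measurable]: "u \<in> borel_measurable borel"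
    by (intro borel_measurable_continuous_onI quad_approx_loc_continuous[OF q])
  define \<phi> where "\<phi> s y = ((u x - ?p \<bullet> x) + y \<bullet> ?p) + s * (norm (y - x))\<^sup>2" for s y
  have Ck: "Ck_on 2 UNIV (\<phi> s)" for s
    unfolding \<phi>_def by (intro Ck_on_add Ck_on_const Ck_on_inner Ck_on_mult Ck_on_sq_norm)
  have \<phi>_exp: "\<phi> s (x + h) - \<phi> s x - ?p \<bullet> h = s * (norm h)\<^sup>2" for s h
    by (simp add: \<phi>_def inner_add_left inner_add_right inner_commute[of _ "u' x"])
  have gr: "grad (\<phi> s) x = ?p" for s
    by (intro grad_eqI quad_approx_imp_GDERIV[of 1 _ _ _ "\<bar>s\<bar>"]) (auto simp: \<phi>_exp abs_mult)
  have [measurable]: "\<phi> s \<in> borel_measurable borel" for s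
    unfolding \<phi>_def by measurable
  have le\<phi>: "\<bar>nonlocal_le \<nu> r x (\<phi> s) ?p\<bar> \<le> \<bar>s\<bar> * small_mom r" if "r \<le> 1" for r s
    using that by (intro nonlocal_le_bound) (auto simp: \<phi>_exp abs_mult)
  have leu: "\<bar>nonlocal_le \<nu> r x u ?p\<bar> \<le> C * small_mom r" if "r \<le> 1" for r
    using that Cx by (intro nonlocal_le_bound) auto
  have sp: "nonlocal \<nu> UNIV x u ?p = nonlocal_le \<nu> r x u ?p + nonlocal_gt \<nu> r x u ?p" for r
    by (intro nonlocal_split integrable_incr q bu)
  have bd: "\<bar>G x ?p - nonlocal \<nu> UNIV x u ?p\<bar> \<le> 2 * C * small_mom r" if r: "0 < r" "r \<le> 1" for r
  proof -
    have h: "\<bar>u y - u x - ?p \<bullet> (y - x)\<bar> \<le> C * (norm (y - x))\<^sup>2" if "y \<in> ball x r" for y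
      using Cx[of "y - x"] that r by (simp add: dist_norm norm_minus_commute)
    have \<phi>y: "\<phi> s y = u x + ?p \<bullet> (y - x) + s * (norm (y - x))\<^sup>2" for s y
      using \<phi>_exp[of s "y - x"] by (simp add: \<phi>_def inner_commute)
    have "max_point (ball x r) (\<lambda>y. u y - \<phi> C y) x"
      unfolding max_point_def
    proof (intro conjI ballI)
      fix y assume "y \<in> ball x r"
      from h[OF this] show "u y - \<phi> C y \<le> u x - \<phi> C x" unfolding \<phi>y by simp
    qed (use r in simp)
    then have 1: "- nonlocal_le \<nu> r x (\<phi> C) ?p - nonlocal_gt \<nu> r x u ?p + G x ?p \<le> 0"
      using vs[unfolded visc_sol_def visc_subsol_def Let_def, THEN conjunct1, THEN conjunct2, THEN conjunct2,
        rule_format, of r "\<phi> C" x] r Ck[of C] unfolding gr by blast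
    have "min_point (ball x r) (\<lambda>y. u y - \<phi> (- C) y) x"
      unfolding min_point_def
    proof (intro conjI ballI)
      fix y assume "y \<in> ball x r"
      from h[OF this] show "u x - \<phi> (- C) x \<le> u y - \<phi> (- C) y" unfolding \<phi>y by simp
    qed (use r in simp)
    then have 2: "- nonlocal_le \<nu> r x (\<phi> (- C)) ?p - nonlocal_gt \<nu> r x u ?p + G x ?p \<ge> 0"
      using vs[unfolded visc_sol_def visc_supersol_def Let_def, THEN conjunct2, THEN conjunct2, THEN conjunct2,
        rule_format, of r "\<phi> (- C)" x] r Ck[of "- C"] unfolding gr by blast
    show ?thesis using 1 2 sp[of r] leu[OF r(2)] le\<phi>[OF r(2), of C] le\<phi>[OF r(2), of "- C"] C(1) by (simp add: abs_le_iff)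
  qed
  have "\<bar>G x ?p - nonlocal \<nu> UNIV x u ?p\<bar> \<le> 0"
  proof (rule LIMSEQ_le_const)
    show "(\<lambda>n. 2 * C * small_mom (1 / real (Suc n))) \<longlonglongrightarrow> 0"
      using tendsto_mult_right_zero[OF small_mom_tendsto_0] .
    show "\<exists>N. \<forall>n\<ge>N. \<bar>G x ?p - nonlocal \<nu> UNIV x u ?p\<bar> \<le> 2 * C * small_mom (1 / real (Suc n))"
      by (intro exI[of _ 0] allI impI bd) auto
  qed
  then show ?thesis by simp
qed

end

lemma touching_point:
  fixes \<phi> :: "real \<times> 'a::euclidean_space \<Rightarrow> real"
  assumes \<phi>: "Ck_on 2 (Q T) \<phi>" and D: "quad_approx_loc (\<lambda>y. \<phi> (t, y)) D" and u: "quad_approx_loc u u'"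
    and r: "0 < r" and t: "0 < t" "t < T"
    and mm: "max_point ({t / 2<..<min (3 / 2 * t) T} \<times> ball x r) (\<lambda>y. u (snd y) - \<phi> y) (t, x) \<or>
         min_point ({t / 2<..<min (3 / 2 * t) T} \<times> ball x r) (\<lambda>y. u (snd y) - \<phi> y) (t, x)"
  shows "D x = u' x" "dt \<phi> t x = 0"
proof -
  have tt: "t \<in> {t / 2<..<min (3 / 2 * t) T}" using t by simp
  define f where "f y = u y - \<phi> (t, y)" for y
  have "GDERIV f x :> u' x - D x"
    unfolding f_def by (intro GDERIV_diff quad_approx_loc_GDERIV D u)
  then have "(\<lambda>h. h \<bullet> (u' x - D x)) = (\<lambda>h. 0)"
    unfolding gderiv_def
    by (rule differential_zero_maxmin[where S = "ball x r", rotated 2])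
       (use mm tt r in \<open>auto simp: max_point_def min_point_def f_def\<close>)
  then have "(u' x - D x) \<bullet> (u' x - D x) = 0" by (rule fun_cong)
  then show "D x = u' x" by simp
  have "(t, x) \<in> Q T" using t by (simp add: Q_def)
  then have "\<phi> differentiable (at (t, x))" using \<phi> by (simp add: numeral_2_eq_2)
  moreover have "((\<lambda>s. (s, x)) has_derivative (\<lambda>h. (h, 0))) (at t)"
    by (auto intro!: derivative_eq_intros)
  ultimately have "(\<lambda>s. \<phi> (s, x)) differentiable (at t)"
    unfolding differentiable_def using has_derivative_compose[of "\<lambda>s. (s, x)" _ t UNIV \<phi>] by blast
  then obtain l where l: "((\<lambda>s. \<phi> (s, x)) has_real_derivative l) (at t)"
    using real_differentiable_def by blast
  define d where "d = min (t / 2) (min (3 / 2 * t) T - t)"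
  have d: "d > 0" using t by (simp add: d_def)
  have in_S: "s \<in> {t / 2<..<min (3 / 2 * t) T}" if "\<bar>t - s\<bar> < d" for s
    using that unfolding d_def by (auto simp: abs_less_iff)
  have "l = 0"
    using mm
  proof
    assume A: "max_point ({t / 2<..<min (3 / 2 * t) T} \<times> ball x r) (\<lambda>y. u (snd y) - \<phi> y) (t, x)"
    then have "\<forall>s. \<bar>t - s\<bar> < d \<longrightarrow> \<phi> (t, x) \<le> \<phi> (s, x)"
    proof (intro allI impI)
      fix s assume "\<bar>t - s\<bar> < d"
      then have "(s, x) \<in> {t / 2<..<min (3 / 2 * t) T} \<times> ball x r" using in_S r by simp
      then have "u (snd (s, x)) - \<phi> (s, x) \<le> u (snd (t, x)) - \<phi> (t, x)"
        using A unfolding max_point_def by blast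
      then show "\<phi> (t, x) \<le> \<phi> (s, x)" by simp
    qed
    then show "l = 0" using DERIV_local_min[OF l d] by blast
  next
    assume A: "min_point ({t / 2<..<min (3 / 2 * t) T} \<times> ball x r) (\<lambda>y. u (snd y) - \<phi> y) (t, x)"
    then have "\<forall>s. \<bar>t - s\<bar> < d \<longrightarrow> \<phi> (s, x) \<le> \<phi> (t, x)"
    proof (intro allI impI)
      fix s assume "\<bar>t - s\<bar> < d"
      then have "(s, x) \<in> {t / 2<..<min (3 / 2 * t) T} \<times> ball x r" using in_S r by simp
      then have "u (snd (s, x)) - \<phi> (s, x) \<ge> u (snd (t, x)) - \<phi> (t, x)"
        using A unfolding min_point_def by blast
      then show "\<phi> (s, x) \<le> \<phi> (t, x)" by simp
    qed
    then show "l = 0" using DERIV_local_max[OF l d] by blast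
  qed
  then show "dt \<phi> t x = 0" using DERIV_imp_deriv[OF l] by (simp add: dt_def)
qed

context levy
begin

lemma nonlocal_le_mono:
  assumes "r \<le> 1" "quad_approx_loc u p" "quad_approx_loc v q" "p x = q x"
    and le: "\<And>y. y \<in> ball x r \<Longrightarrow> u y - u x \<le> v y - v x"
  shows "nonlocal_le \<nu> r x u (p x) \<le> nonlocal_le \<nu> r x v (q x)"
proof -
  have i: "integrable \<nu> (\<lambda>z. indicator {z. norm z \<le> r} z * incr w (s x) x z)" if w: "quad_approx_loc w s" for w s
  proof -
    have [measurable]: "w \<in> borel_measurable borel"
      by (intro borel_measurable_continuous_onI quad_approx_loc_continuous[OF w])
    obtain C where C: "C \<ge> 0" "\<And>y h. norm y \<le> norm x \<Longrightarrow> norm h \<le> 1 \<Longrightarrow>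
      \<bar>w (y + h) - w y - s y \<bullet> h\<bar> \<le> C * (norm h)\<^sup>2" using quad_approx_locE[OF w] by blast
    show ?thesis
    proof (rule integrable_dominated[where C = C])
      fix z :: 'a
      show "\<bar>indicator {z. norm z \<le> r} z * incr w (s x) x z\<bar> \<le> C * min ((norm z)\<^sup>2) (norm z)"
      proof (cases "norm z \<le> r")
        case True
        then have z: "norm z \<le> 1" using assms(1) by simp
        then have "min ((norm z)\<^sup>2) (norm z) = (norm z)\<^sup>2"
          by (simp add: min_def power2_eq_square mult_left_le_one_le)
        then show ?thesis using C(2)[OF order_refl z] z True by (simp add: incr_def)
      qed (use C(1) in simp)
    qed measurable
  qed
  show ?thesis unfolding nonlocal_eq
  proof (rule integral_mono_AE[OF i[OF assms(2)] i[OF assms(3)]])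
    show "AE z in \<nu>. indicator {z. norm z \<le> r} z * incr u (p x) x z \<le> indicator {z. norm z \<le> r} z * incr v (q x) x z"
      using AE_sphere[of r]
    proof eventually_elim
      case (elim z)
      then show ?case using le[of "x + z"] assms(4)
        by (auto simp: indicator_def incr_def dist_norm)
    qed
  qed
qed

lemma stationary_backward_visc_sol:
  assumes bu: "bounded (range u)" and q: "quad_approx_loc u u'"
    and f: "\<And>s x. f (s, x) = B x \<bullet> u' x - nonlocal \<nu> UNIV x u (u' x)"
  shows "backward_visc_sol \<nu> T (\<lambda>s x p. B x \<bullet> p - f (s, x)) (\<lambda>(s, x). u x)"
proof -
  let ?v = "\<lambda>(t, x). (case (T - t, x) of (s, x) \<Rightarrow> u x)"
  have v: "?v = (\<lambda>y. u (snd y))" by auto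
  have cu: "continuous_on (Q T) (\<lambda>y. u (snd y))"
    by (rule continuous_on_compose2[OF quad_approx_loc_continuous[OF q, of UNIV]]) (auto intro: continuous_intros)
  have bv: "bounded ((\<lambda>y. u (snd y)) ` Q T)"
    by (rule bounded_subset[OF bu]) auto
  have sp: "nonlocal \<nu> UNIV x u (u' x) = nonlocal_le \<nu> r x u (u' x) + nonlocal_gt \<nu> r x u (u' x)" for r x
    by (intro nonlocal_split integrable_incr q bu)
  have "evol_visc_subsol \<nu> T (\<lambda>t x p. B x \<bullet> p - f (T - t, x)) (\<lambda>y. u (snd y))"
    unfolding evol_visc_subsol_def
  proof (intro conjI allI impI bv)
    show "usc_on (Q T) (\<lambda>y. u (snd y))"
      using cu unfolding usc_on_def continuous_on_def by (auto intro: order_tendstoD(2))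
    fix r \<phi> t and x :: 'a
    assume A: "0 < r \<and> r \<le> 1 \<and> Ck_on 2 (Q T) \<phi> \<and> (t, x) \<in> Q T \<and>
      max_point ({t / 2<..<min (3 / 2 * t) T} \<times> ball x r) (\<lambda>y. u (snd y) - \<phi> y) (t, x)"
    then have t: "0 < t" "t < T" by (auto simp: Q_def)
    obtain D where D: "quad_approx_loc (\<lambda>y. \<phi> (t, y)) D" using Ck_on_slice_quad_approx[OF _ t, of \<phi>] A by metis
    have e: "D x = u' x" "dt \<phi> t x = 0" using touching_point[OF _ D q, of T r x] A t by auto
    have g: "grad (\<lambda>y. \<phi> (t, y)) x = D x" by (intro grad_eqI quad_approx_loc_GDERIV D)
    have "u y - u x \<le> \<phi> (t, y) - \<phi> (t, x)" if "y \<in> ball x r" for y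
    proof -
      have "(t, y) \<in> {t / 2<..<min (3 / 2 * t) T} \<times> ball x r" using that t by simp
      then have "u (snd (t, y)) - \<phi> (t, y) \<le> u (snd (t, x)) - \<phi> (t, x)"
        using A unfolding max_point_def by blast
      then show ?thesis by simp
    qed
    then have "nonlocal_le \<nu> r x u (u' x) \<le> nonlocal_le \<nu> r x (\<lambda>y. \<phi> (t, y)) (D x)"
      using A e by (intro nonlocal_le_mono q D) auto
    then show "let p = grad (\<lambda>y. \<phi> (t, y)) x in
           dt \<phi> t x - nonlocal_le \<nu> r x (\<lambda>y. \<phi> (t, y)) p
             - nonlocal_gt \<nu> r x (\<lambda>y. u (snd (t, y))) p + (B x \<bullet> p - f (T - t, x)) \<le> 0"
      unfolding Let_def g f using e sp[of x r] by simp
  qed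
  moreover have "evol_visc_supersol \<nu> T (\<lambda>t x p. B x \<bullet> p - f (T - t, x)) (\<lambda>y. u (snd y))"
    unfolding evol_visc_supersol_def
  proof (intro conjI allI impI bv)
    show "lsc_on (Q T) (\<lambda>y. u (snd y))"
      using cu unfolding lsc_on_def continuous_on_def by (auto intro: order_tendstoD(1))
    fix r \<phi> t and x :: 'a
    assume A: "0 < r \<and> r \<le> 1 \<and> Ck_on 2 (Q T) \<phi> \<and> (t, x) \<in> Q T \<and>
      min_point ({t / 2<..<min (3 / 2 * t) T} \<times> ball x r) (\<lambda>y. u (snd y) - \<phi> y) (t, x)"
    then have t: "0 < t" "t < T" by (auto simp: Q_def)
    obtain D where D: "quad_approx_loc (\<lambda>y. \<phi> (t, y)) D" using Ck_on_slice_quad_approx[OF _ t, of \<phi>] A by metis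
    have e: "D x = u' x" "dt \<phi> t x = 0" using touching_point[OF _ D q, of T r x] A t by auto
    have g: "grad (\<lambda>y. \<phi> (t, y)) x = D x" by (intro grad_eqI quad_approx_loc_GDERIV D)
    have "\<phi> (t, y) - \<phi> (t, x) \<le> u y - u x" if "y \<in> ball x r" for y
    proof -
      have "(t, y) \<in> {t / 2<..<min (3 / 2 * t) T} \<times> ball x r" using that t by simp
      then have "u (snd (t, y)) - \<phi> (t, y) \<ge> u (snd (t, x)) - \<phi> (t, x)"
        using A unfolding min_point_def by blast
      then show ?thesis by simp
    qed
    then have "nonlocal_le \<nu> r x (\<lambda>y. \<phi> (t, y)) (D x) \<le> nonlocal_le \<nu> r x u (u' x)"
      using A e by (intro nonlocal_le_mono q D) auto
    then show "let p = grad (\<lambda>y. \<phi> (t, y)) x in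
           dt \<phi> t x - nonlocal_le \<nu> r x (\<lambda>y. \<phi> (t, y)) p
             - nonlocal_gt \<nu> r x (\<lambda>y. u (snd (t, y))) p + (B x \<bullet> p - f (T - t, x)) \<ge> 0"
      unfolding Let_def g f using e sp[of x r] by simp
  qed
  ultimately show ?thesis
    unfolding backward_visc_sol_def evol_visc_sol_def v by simp
qed

text \<open>A function \<open>u\<close> constant in time solves the backward equation with source \<open>c\<close> and terminal
  datum \<open>u\<close>, so that duality reduces to \<open>t * (\<integral>x. c x \<partial>m) = 0\<close>.\<close>

lemma duality_sol_stationary:
  assumes m: "m \<in> Prob" and d: "duality_sol \<nu> B m"
    and bu: "bounded (range u)" and q: "quad_approx_loc u u'"
    and c: "\<And>x. c x = B x \<bullet> u' x - nonlocal \<nu> UNIV x u (u' x)"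
    and cc: "continuous_on UNIV c" and bc: "bounded (range c)"
  shows "(\<integral>x. c x \<partial>m) = 0"
proof -
  have cu: "continuous_on UNIV u" by (rule quad_approx_loc_continuous[OF q])
  have "backward_visc_sol \<nu> 1 (\<lambda>s x p. B x \<bullet> p - (\<lambda>(s, x). c x) (s, x)) (\<lambda>(s, x). u x)"
    using c by (intro stationary_backward_visc_sol[OF bu q]) auto
  moreover have "u \<in> Cb UNIV" using cu bu by (simp add: Cb_def)
  moreover have "(\<lambda>(s, x). c x) \<in> Cb (Q 1)"
    using cc bc unfolding Cb_def case_prod_unfold
    by (auto intro!: continuous_on_compose2[OF cc] continuous_intros elim: bounded_subset)
  moreover have "(\<lambda>(s, x). u x) \<in> Cb (Qbar 1)"
    using cu bu unfolding Cb_def case_prod_unfold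
    by (auto intro!: continuous_on_compose2[OF cu] continuous_intros elim: bounded_subset)
  ultimately have "(LINT x|m. u x) + (LINT s:{0<..<1::real}|lborel. LINT x|m. (\<lambda>(s, x). c x) (s, x))
     = (LINT x|m. (\<lambda>(s, x). u x) (0::real, x))"
    using d[unfolded duality_sol_def, rule_format, of 1 u "\<lambda>(s, x). c x" "\<lambda>(s, x). u x"] by simp
  then show ?thesis by (simp add: set_lebesgue_integral_def)
qed

end

section \<open>The minimum of two functions\<close>

lemma lborel_distr_plus_right: "distr lborel borel (\<lambda>x. x + c) = (lborel :: 'a::euclidean_space measure)"
proof -
  have "(\<lambda>x. x + c) = (+) c" by (simp add: fun_eq_iff add.commute)
  then show ?thesis using lborel_distr_plus[of c] by simp
qed

lemma integral_lborel_translate: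
  fixes f :: "'a::euclidean_space \<Rightarrow> real"
  assumes [measurable]: "f \<in> borel_measurable borel"
  shows "(\<integral>x. f (x + c) \<partial>lborel) = (\<integral>x. f x \<partial>lborel)"
proof -
  have "(\<integral>x. f x \<partial>distr lborel borel (\<lambda>x. x + c)) = (\<integral>x. f (x + c) \<partial>lborel)"
    by (rule integral_distr) auto
  then show ?thesis by (simp add: lborel_distr_plus_right)
qed

lemma integrable_lborel_translate:
  fixes f :: "'a::euclidean_space \<Rightarrow> real"
  assumes "integrable lborel f"
  shows "integrable lborel (\<lambda>x. f (x + c))"
proof -
  have "f \<in> borel_measurable borel" using assms by simp
  then have "integrable (distr lborel borel (\<lambda>x. x + c)) f = integrable lborel (\<lambda>x. f (x + c))"
    by (intro integrable_distr_eq) auto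
  then show ?thesis using assms by (simp add: lborel_distr_plus_right)
qed

lemma nn_integral_lborel_reflect:
  fixes f :: "'a::euclidean_space \<Rightarrow> ennreal"
  assumes [measurable]: "f \<in> borel_measurable borel"
  shows "(\<integral>\<^sup>+x. f (c - x) \<partial>lborel) = (\<integral>\<^sup>+x. f x \<partial>lborel)"
proof -
  have "lborel = distr lborel borel (\<lambda>x::'a. c - x)"
    using lborel_affine[of "-1" c] by (simp add: density_1)
  then have "(\<integral>\<^sup>+x. f x \<partial>lborel) = (\<integral>\<^sup>+x. f x \<partial>distr lborel borel (\<lambda>x::'a. c - x))" by simp
  also have "\<dots> = (\<integral>\<^sup>+x. f (c - x) \<partial>lborel)" by (rule nn_integral_distr) auto
  finally show ?thesis ..
qed

lemma integrable_mult_bounded: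
  fixes f g :: "'a \<Rightarrow> real"
  assumes "integrable M f" and [measurable]: "g \<in> borel_measurable M" and "\<And>x. \<bar>g x\<bar> \<le> K"
  shows "integrable M (\<lambda>x. f x * g x)" "integrable M (\<lambda>x. g x * f x)"
proof -
  have [measurable]: "f \<in> borel_measurable M" using assms(1) by simp
  have K: "0 \<le> K" using assms(3)[of undefined] abs_ge_zero order_trans by blast
  show "integrable M (\<lambda>x. f x * g x)"
  proof (rule Bochner_Integration.integrable_bound[OF integrable_mult_right[OF integrable_abs[OF assms(1)], of K]])
    show "AE x in M. norm (f x * g x) \<le> norm (K * \<bar>f x\<bar>)"
      using mult_left_mono[OF assms(3) abs_ge_zero] K by (auto simp: abs_mult mult.commute)
  qed measurable
  then show "integrable M (\<lambda>x. g x * f x)" by (simp add: mult.commute)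
qed

lemma integrable_pair_dominated:
  fixes f :: "'a \<times> 'b \<Rightarrow> real"
  assumes "sigma_finite_measure M1" "sigma_finite_measure M2"
    and [measurable]: "f \<in> borel_measurable (M1 \<Otimes>\<^sub>M M2)"
    and g: "integrable M1 g" and h: "integrable M2 h"
    and bd: "\<And>x y. \<bar>f (x, y)\<bar> \<le> g x * h y"
  shows "integrable (M1 \<Otimes>\<^sub>M M2) f"
proof -
  interpret pair_sigma_finite M1 M2 using assms(1,2) by (simp add: pair_sigma_finite.intro)
  have [measurable]: "g \<in> borel_measurable M1" "h \<in> borel_measurable M2" using g h by auto
  have i: "integrable M2 (\<lambda>y. f (x, y))" if "x \<in> space M1" for x
    by (rule Bochner_Integration.integrable_bound[OF integrable_mult_right[OF h, of "g x"]])
       (use that bd in \<open>auto intro: order_trans[OF bd abs_ge_self]\<close>)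
  show ?thesis
  proof (rule Fubini_integrable)
    show "integrable M1 (\<lambda>x. \<integral>y. norm (f (x, y)) \<partial>M2)"
    proof (rule Bochner_Integration.integrable_bound[OF integrable_mult_left[OF g, of "\<integral>y. h y \<partial>M2"]])
      have "(\<integral>y. \<bar>f (x, y)\<bar> \<partial>M2) \<le> g x * (\<integral>y. h y \<partial>M2)" if "x \<in> space M1" for x
      proof -
        have "(\<integral>y. \<bar>f (x, y)\<bar> \<partial>M2) \<le> (\<integral>y. g x * h y \<partial>M2)"
          by (intro integral_mono integrable_abs i that integrable_mult_right h bd)
        then show ?thesis by simp
      qed
      then show "AE x in M1. norm (\<integral>y. norm (f (x, y)) \<partial>M2) \<le> norm (g x * (\<integral>y. h y \<partial>M2))"
        by (intro AE_I2) (auto intro: order_trans[OF _ abs_ge_self])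
    qed measurable
  qed (use i in auto)
qed

lemma Fubini_dominated:
  fixes f :: "'a \<Rightarrow> 'b \<Rightarrow> real"
  assumes "sigma_finite_measure M1" "sigma_finite_measure M2"
    and "case_prod f \<in> borel_measurable (M1 \<Otimes>\<^sub>M M2)"
    and "integrable M1 g" and "integrable M2 h"
    and "\<And>x y. \<bar>f x y\<bar> \<le> g x * h y"
  shows "(\<integral>x. (\<integral>y. f x y \<partial>M2) \<partial>M1) = (\<integral>y. (\<integral>x. f x y \<partial>M1) \<partial>M2)"
    and "integrable M1 (\<lambda>x. \<integral>y. f x y \<partial>M2)"
    and "integrable M2 (\<lambda>y. \<integral>x. f x y \<partial>M1)"
proof -
  interpret pair_sigma_finite M1 M2 using assms(1,2) by (simp add: pair_sigma_finite.intro)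
  have i: "integrable (M1 \<Otimes>\<^sub>M M2) (case_prod f)"
    by (rule integrable_pair_dominated[OF assms(1-5)]) (use assms(6) in auto)
  show "(\<integral>x. (\<integral>y. f x y \<partial>M2) \<partial>M1) = (\<integral>y. (\<integral>x. f x y \<partial>M1) \<partial>M2)"
    by (rule Fubini_integral[OF i, symmetric])
  show "integrable M1 (\<lambda>x. \<integral>y. f x y \<partial>M2)" by (rule integrable_fst[OF i])
  show "integrable M2 (\<lambda>y. \<integral>x. f x y \<partial>M1)" by (rule integrable_snd[OF i])
qed

lemma le_of_linear_quadratic:
  fixes A B K :: real
  assumes "\<And>h. h > 0 \<Longrightarrow> h * A \<le> h * B + h\<^sup>2 * K"
  shows "A \<le> B"
proof (rule field_le_epsilon)
  fix e :: real assume e: "e > 0"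
  define h where "h = e / (\<bar>K\<bar> + 1)"
  have h: "h > 0" using e by (simp add: h_def)
  have "h * A \<le> h * (B + h * K)" using assms[OF h] by (simp add: power2_eq_square algebra_simps)
  then have "A \<le> B + h * K" using h by simp
  also have "h * K \<le> h * (\<bar>K\<bar> + 1)" using h by (intro mult_left_mono) auto
  also have "\<dots> = e" by (simp add: h_def)
  finally show "A \<le> B + e" by simp
qed

locale min_pair =
  fixes a b :: "'a::euclidean_space \<Rightarrow> real" and a' b' :: "'a \<Rightarrow> 'a" and C M :: real
  assumes qa: "quad_approx C a a'" and qb: "quad_approx C b b'"
    and a_bd: "\<And>x. 0 \<le> a x" "\<And>x. a x \<le> M" and b_bd: "\<And>x. 0 \<le> b x" "\<And>x. b x \<le> M"
    and a'_bd: "\<And>x. norm (a' x) \<le> M" and b'_bd: "\<And>x. norm (b' x) \<le> M"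
    and a_int: "integrable lborel a" and b_int: "integrable lborel b"
begin

definition e :: "'a \<Rightarrow> real" where "e x = min (a x) (b x)"

definition G :: "'a \<Rightarrow> 'a" where "G x = (if a x \<le> b x then a' x else b' x)"

text \<open>The excess over \<open>e\<close>, at the point \<open>y\<close>, of the function that realises the minimum at \<open>x\<close>.\<close>

definition D :: "'a \<Rightarrow> 'a \<Rightarrow> real" where "D x y = (if a x \<le> b x then a y else b y) - e y"

lemma a_meas [measurable]: "a \<in> borel_measurable borel"
  by (intro borel_measurable_continuous_onI quad_approx_loc_continuous[OF quad_approx_imp_loc[OF qa]])

lemma b_meas [measurable]: "b \<in> borel_measurable borel"
  by (intro borel_measurable_continuous_onI quad_approx_loc_continuous[OF quad_approx_imp_loc[OF qb]])

lemma a'_meas [measurable]: "a' \<in> borel_measurable borel"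
  by (intro borel_measurable_continuous_onI quad_approx_grad_continuous[OF qa])

lemma b'_meas [measurable]: "b' \<in> borel_measurable borel"
  by (intro borel_measurable_continuous_onI quad_approx_grad_continuous[OF qb])

lemma e_meas [measurable]: "e \<in> borel_measurable borel"
  unfolding e_def[abs_def] by measurable

lemma G_meas [measurable]: "G \<in> borel_measurable borel"
  unfolding G_def[abs_def] by measurable

lemma D_meas [measurable]: "case_prod D \<in> borel_measurable (borel \<Otimes>\<^sub>M borel)"
  unfolding D_def[abs_def] case_prod_unfold by measurable

lemma D_nonneg: "0 \<le> D x y" by (simp add: D_def e_def)

lemma D_le: "D x y \<le> M" using a_bd[of y] b_bd[of y] by (auto simp: D_def e_def)

lemma e_bd: "0 \<le> e x" "e x \<le> M"
  using a_bd[of x] b_bd[of x] by (auto simp: e_def)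

lemma e_int: "integrable lborel e"
  by (rule Bochner_Integration.integrable_bound[OF a_int]) (use a_bd b_bd in \<open>auto simp: e_def\<close>)

lemma norm_G_le: "norm (G x) \<le> M" using a'_bd b'_bd by (simp add: G_def)

lemma G_inner_bd: "\<bar>G x \<bullet> v\<bar> \<le> M * norm v"
  using Cauchy_Schwarz_ineq2[of "G x" v] mult_right_mono[OF norm_G_le[of x] norm_ge_zero[of v]] by linarith

lemma e_quotient:
  assumes "h > 0"
  shows "h * (G x \<bullet> v) \<le> e x - e (x - h *\<^sub>R v) + C * h\<^sup>2 * (norm v)\<^sup>2"
proof -
  have n: "(norm (- h *\<^sub>R v))\<^sup>2 = h\<^sup>2 * (norm v)\<^sup>2" by (simp add: power_mult_distrib)
  have "\<bar>a (x + (- h *\<^sub>R v)) - a x - a' x \<bullet> (- h *\<^sub>R v)\<bar> \<le> C * (h\<^sup>2 * (norm v)\<^sup>2)"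
    using quad_approxD[OF qa, of x "- h *\<^sub>R v"] unfolding n .
  moreover have "\<bar>b (x + (- h *\<^sub>R v)) - b x - b' x \<bullet> (- h *\<^sub>R v)\<bar> \<le> C * (h\<^sup>2 * (norm v)\<^sup>2)"
    using quad_approxD[OF qb, of x "- h *\<^sub>R v"] unfolding n .
  ultimately show ?thesis by (auto simp: e_def G_def abs_le_iff mult.assoc)
qed

lemma weighted_quotient:
  assumes w0: "\<And>x. 0 \<le> w x" and wi: "integrable lborel w" and h: "h > 0"
  shows "h * (\<integral>x. w x * (G x \<bullet> v) \<partial>lborel) \<le>
    (\<integral>x. e x * (w x - w (x + h *\<^sub>R v)) \<partial>lborel) + h\<^sup>2 * (C * (norm v)\<^sup>2 * (\<integral>x. w x \<partial>lborel))"
proof -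
  have [measurable]: "w \<in> borel_measurable borel" using wi by simp
  have e_abs: "\<bar>e x\<bar> \<le> M" for x using e_bd[of x] by simp
  have i1: "integrable lborel (\<lambda>x. w x * (G x \<bullet> v))"
    by (rule integrable_mult_bounded(1)[OF wi _ G_inner_bd]) simp
  have i2: "integrable lborel (\<lambda>x. w x * e x)" "integrable lborel (\<lambda>x. w x * e (x - h *\<^sub>R v))"
    by (rule integrable_mult_bounded(1)[OF wi _ e_abs], simp)+
  have i3: "integrable lborel (\<lambda>x. e x * w (x + h *\<^sub>R v))"
    by (rule integrable_mult_bounded(2)[OF integrable_lborel_translate[OF wi] _ e_abs]) simp
  have "h * (\<integral>x. w x * (G x \<bullet> v) \<partial>lborel) = (\<integral>x. h * (w x * (G x \<bullet> v)) \<partial>lborel)" by simp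
  also have "\<dots> \<le> (\<integral>x. (w x * e x - w x * e (x - h *\<^sub>R v)) + w x * (C * h\<^sup>2 * (norm v)\<^sup>2) \<partial>lborel)"
  proof (intro integral_mono Bochner_Integration.integrable_add Bochner_Integration.integrable_diff
      integrable_mult_right integrable_mult_left i1 i2 wi)
    fix x
    show "h * (w x * (G x \<bullet> v)) \<le> (w x * e x - w x * e (x - h *\<^sub>R v)) + w x * (C * h\<^sup>2 * (norm v)\<^sup>2)"
      using mult_left_mono[OF e_quotient[OF h, of x v] w0[of x]] by (simp add: algebra_simps)
  qed
  also have "\<dots> = (\<integral>x. w x * e x \<partial>lborel) - (\<integral>x. w x * e (x - h *\<^sub>R v) \<partial>lborel)
      + (\<integral>x. w x \<partial>lborel) * (C * h\<^sup>2 * (norm v)\<^sup>2)"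
    using i2 wi by simp
  also have "(\<integral>x. w x * e (x - h *\<^sub>R v) \<partial>lborel) = (\<integral>x. w (x + h *\<^sub>R v) * e x \<partial>lborel)"
    using integral_lborel_translate[of "\<lambda>x. w x * e (x - h *\<^sub>R v)" "h *\<^sub>R v"] by simp
  also have "(\<integral>x. w x * e x \<partial>lborel) - (\<integral>x. w (x + h *\<^sub>R v) * e x \<partial>lborel) =
     (\<integral>x. e x * (w x - w (x + h *\<^sub>R v)) \<partial>lborel)"
    using i2(1) i3 by (subst Bochner_Integration.integral_diff[symmetric]) (auto simp: algebra_simps)
  finally show ?thesis by (simp add: ac_simps)
qed

lemma weighted_grad_lipschitz:
  assumes w0: "\<And>x. 0 \<le> w x" and wi: "integrable lborel w"
    and L: "\<And>x y. \<bar>w x - w y\<bar> \<le> L * norm (x - y)"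
  shows "(\<integral>x. w x * (G x \<bullet> v) \<partial>lborel) \<le> L * norm v * (\<integral>x. e x \<partial>lborel)"
proof (rule le_of_linear_quadratic)
  fix h :: real assume h: "h > 0"
  have [measurable]: "w \<in> borel_measurable borel" using wi by simp
  have "(\<integral>x. e x * (w x - w (x + h *\<^sub>R v)) \<partial>lborel) \<le> (\<integral>x. e x * (h * (L * norm v)) \<partial>lborel)"
  proof (rule integral_mono)
    have bd: "\<bar>w x - w (x + h *\<^sub>R v)\<bar> \<le> h * (L * norm v)" for x
      using L[of x "x + h *\<^sub>R v"] h by (simp add: ac_simps)
    show "integrable lborel (\<lambda>x. e x * (w x - w (x + h *\<^sub>R v)))"
      by (rule integrable_mult_bounded(1)[OF e_int _ bd]) simp
    show "e x * (w x - w (x + h *\<^sub>R v)) \<le> e x * (h * (L * norm v))" for x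
      using bd[of x] e_bd(1)[of x] by (intro mult_left_mono) auto
  qed (intro integrable_mult_left e_int)
  then show "h * (\<integral>x. w x * (G x \<bullet> v) \<partial>lborel) \<le> h * (L * norm v * (\<integral>x. e x \<partial>lborel))
      + h\<^sup>2 * (C * (norm v)\<^sup>2 * (\<integral>x. w x \<partial>lborel))"
    using weighted_quotient[OF w0 wi h, of v] by (simp add: ac_simps)
qed

lemma weighted_grad_parts:
  assumes w0: "\<And>x. 0 \<le> w x" and wi: "integrable lborel w" and q: "quad_approx K w w'"
    and w'_bd: "\<And>x. norm (w' x) \<le> N"
  shows "(\<integral>x. w x * (G x \<bullet> v) \<partial>lborel) = - (\<integral>x. e x * (w' x \<bullet> v) \<partial>lborel)"
proof -
  have [measurable]: "w \<in> borel_measurable borel" using wi by simp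
  have [measurable]: "w' \<in> borel_measurable borel"
    by (intro borel_measurable_continuous_onI quad_approx_grad_continuous[OF q])
  have i: "integrable lborel (\<lambda>x. e x * (w' x \<bullet> v))" for v
  proof (rule integrable_mult_bounded(1)[OF e_int])
    show "\<bar>w' x \<bullet> v\<bar> \<le> N * norm v" for x
      using Cauchy_Schwarz_ineq2[of "w' x" v] mult_right_mono[OF w'_bd[of x] norm_ge_zero[of v]] by linarith
  qed simp
  have le: "(\<integral>x. w x * (G x \<bullet> v) \<partial>lborel) \<le> - (\<integral>x. e x * (w' x \<bullet> v) \<partial>lborel)" for v
  proof (rule le_of_linear_quadratic)
    fix h :: real assume h: "h > 0"
    have "(\<integral>x. e x * (w x - w (x + h *\<^sub>R v)) \<partial>lborel)
        \<le> (\<integral>x. - h * (e x * (w' x \<bullet> v)) + e x * (K * h\<^sup>2 * (norm v)\<^sup>2) \<partial>lborel)"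
    proof (rule integral_mono)
      have bd: "\<bar>w (x + h *\<^sub>R v) - w x - h * (w' x \<bullet> v)\<bar> \<le> K * h\<^sup>2 * (norm v)\<^sup>2" for x
        using quad_approxD[OF q, of x "h *\<^sub>R v"] by (simp add: power_mult_distrib)
      show "e x * (w x - w (x + h *\<^sub>R v)) \<le> - h * (e x * (w' x \<bullet> v)) + e x * (K * h\<^sup>2 * (norm v)\<^sup>2)" for x
      proof -
        have "w x - w (x + h *\<^sub>R v) \<le> - h * (w' x \<bullet> v) + K * h\<^sup>2 * (norm v)\<^sup>2" using bd[of x] by linarith
        from mult_left_mono[OF this e_bd(1)[of x]] show ?thesis by (simp add: algebra_simps)
      qed
      have bd': "\<bar>w x - w (x + h *\<^sub>R v)\<bar> \<le> h * (N * norm v) + K * h\<^sup>2 * (norm v)\<^sup>2" for x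
      proof -
        have "\<bar>w' x \<bullet> v\<bar> \<le> N * norm v"
          using Cauchy_Schwarz_ineq2[of "w' x" v] mult_right_mono[OF w'_bd[of x] norm_ge_zero[of v]] by linarith
        then have "h * \<bar>w' x \<bullet> v\<bar> \<le> h * (N * norm v)" using h by (intro mult_left_mono) auto
        then have "\<bar>h * (w' x \<bullet> v)\<bar> \<le> h * (N * norm v)" using h by (simp add: abs_mult)
        then show ?thesis using bd[of x] by linarith
      qed
      show "integrable lborel (\<lambda>x. e x * (w x - w (x + h *\<^sub>R v)))"
        by (rule integrable_mult_bounded(1)[OF e_int _ bd']) simp
    qed (intro Bochner_Integration.integrable_add integrable_mult_right integrable_mult_left e_int i)
    also have "\<dots> = - h * (\<integral>x. e x * (w' x \<bullet> v) \<partial>lborel) + (\<integral>x. e x \<partial>lborel) * (K * h\<^sup>2 * (norm v)\<^sup>2)"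
      by (subst Bochner_Integration.integral_add) (auto intro!: integrable_mult_right integrable_mult_left e_int i)
    finally show "h * (\<integral>x. w x * (G x \<bullet> v) \<partial>lborel) \<le> h * - (\<integral>x. e x * (w' x \<bullet> v) \<partial>lborel)
        + h\<^sup>2 * ((\<integral>x. e x \<partial>lborel) * (K * (norm v)\<^sup>2) + C * (norm v)\<^sup>2 * (\<integral>x. w x \<partial>lborel))"
      using weighted_quotient[OF w0 wi h, of v] by (simp add: algebra_simps)
  qed
  show ?thesis using le[of v] le[of "- v"] by (simp add: inner_minus_right)
qed

end

locale min_pair_levy = levy \<nu> + min_pair a b a' b' C M
  for \<nu> :: "'a::euclidean_space measure" and a b :: "'a \<Rightarrow> real" and a' b' C M
begin

definition act :: "'a \<Rightarrow> 'a \<Rightarrow> real" where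
  "act x z = (if a x \<le> b x then incr a (a' x) x (- z) else incr b (b' x) x (- z))"

lemma act_meas [measurable]: "case_prod act \<in> borel_measurable (borel \<Otimes>\<^sub>M borel)"
  unfolding act_def[abs_def] case_prod_unfold incr_def by measurable

lemma act_bound: "\<bar>act x z\<bar> \<le> max C (2 * M) * min ((norm z)\<^sup>2) (norm z)"
proof -
  have "\<bar>a x\<bar> \<le> M" "\<bar>b x\<bar> \<le> M" for x using a_bd[of x] b_bd[of x] by auto
  then show ?thesis
    using incr_bound_bounded[of a x "a' x" C M "- z"] incr_bound_bounded[of b x "b' x" C M "- z"]
      quad_approxD[OF qa] quad_approxD[OF qb] by (simp add: act_def)
qed

lemma act_eq: "act x z = (e (x - z) - e x) + D x (x - z) + (G x \<bullet> z) * indicator {z. norm z \<le> 1} z"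
  by (auto simp: act_def e_def D_def G_def incr_def indicator_def)

definition defect :: "('a \<Rightarrow> real) \<Rightarrow> 'a \<Rightarrow> real" where
  "defect w z = (\<integral>x. w x * D x (x - z) \<partial>lborel)"

lemma defect_nonneg: "(\<And>x. 0 \<le> w x) \<Longrightarrow> 0 \<le> defect w z"
  unfolding defect_def by (intro integral_nonneg_AE) (auto simp: D_nonneg)

lemma weak_form:
  assumes w0: "\<And>x. 0 \<le> w x" and wi: "integrable lborel w" and q: "quad_approx K w w'"
    and w'_bd: "\<And>x. norm (w' x) \<le> N"
  shows "(\<integral>x. w x * act x z \<partial>lborel) = (\<integral>x. e x * incr w (w' x) x z \<partial>lborel) + defect w z"
proof -
  have [measurable]: "w \<in> borel_measurable borel" using wi by simp
  have [measurable]: "w' \<in> borel_measurable borel"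
    by (intro borel_measurable_continuous_onI quad_approx_grad_continuous[OF q])
  have e_abs: "\<bar>e x\<bar> \<le> M" for x using e_bd[of x] by simp
  let ?i = "indicator {z. norm z \<le> 1} z :: real"
  have i1: "integrable lborel (\<lambda>x. w x * e (x - z))" "integrable lborel (\<lambda>x. w x * e x)"
    by (rule integrable_mult_bounded(1)[OF wi _ e_abs], simp)+
  have i2: "integrable lborel (\<lambda>x. w x * D x (x - z))"
    by (rule integrable_mult_bounded(1)[OF wi, where K = M]) (use D_nonneg D_le in auto)
  have i3: "integrable lborel (\<lambda>x. w x * (G x \<bullet> z))"
    by (rule integrable_mult_bounded(1)[OF wi _ G_inner_bd]) simp
  have i4: "integrable lborel (\<lambda>x. e x * w (x + z))"
    by (rule integrable_mult_bounded(2)[OF integrable_lborel_translate[OF wi] _ e_abs]) simp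
  have i5: "integrable lborel (\<lambda>x. e x * (w' x \<bullet> z))"
  proof (rule integrable_mult_bounded(1)[OF e_int])
    show "\<bar>w' x \<bullet> z\<bar> \<le> N * norm z" for x
      using Cauchy_Schwarz_ineq2[of "w' x" z] mult_right_mono[OF w'_bd[of x] norm_ge_zero[of z]] by linarith
  qed simp
  have "(\<integral>x. w x * act x z \<partial>lborel) =
     (\<integral>x. (w x * e (x - z) - w x * e x) + w x * D x (x - z) + (w x * (G x \<bullet> z)) * ?i \<partial>lborel)"
    unfolding act_eq by (intro Bochner_Integration.integral_cong) (auto simp: algebra_simps)
  also have "\<dots> = ((\<integral>x. w x * e (x - z) \<partial>lborel) - (\<integral>x. w x * e x \<partial>lborel)) + defect w z
      + (\<integral>x. w x * (G x \<bullet> z) \<partial>lborel) * ?i"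
    unfolding defect_def using i1 i2 i3 by simp
  also have "(\<integral>x. w x * e (x - z) \<partial>lborel) = (\<integral>x. e x * w (x + z) \<partial>lborel)"
    using integral_lborel_translate[of "\<lambda>x. w x * e (x - z)" z] by (simp add: mult.commute)
  also have "(\<integral>x. w x * (G x \<bullet> z) \<partial>lborel) = - (\<integral>x. e x * (w' x \<bullet> z) \<partial>lborel)"
    by (rule weighted_grad_parts[OF w0 wi q w'_bd])
  finally have "(\<integral>x. w x * act x z \<partial>lborel) = ((\<integral>x. e x * w (x + z) \<partial>lborel) - (\<integral>x. w x * e x \<partial>lborel)
      - (\<integral>x. e x * (w' x \<bullet> z) \<partial>lborel) * ?i) + defect w z" by simp
  also have "(\<integral>x. e x * w (x + z) \<partial>lborel) - (\<integral>x. w x * e x \<partial>lborel) - (\<integral>x. e x * (w' x \<bullet> z) \<partial>lborel) * ?i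
      = (\<integral>x. e x * w (x + z) - w x * e x - (e x * (w' x \<bullet> z)) * ?i \<partial>lborel)"
    using i1 i4 i5 by simp
  also have "\<dots> = (\<integral>x. e x * incr w (w' x) x z \<partial>lborel)"
    unfolding incr_def by (intro Bochner_Integration.integral_cong) (auto simp: algebra_simps)
  finally show ?thesis .
qed

lemma weak_form_integrated:
  assumes w0: "\<And>x. 0 \<le> w x" and wi: "integrable lborel w" and q: "quad_approx K w w'"
    and w'_bd: "\<And>x. norm (w' x) \<le> N"
    and ib: "\<And>x z. \<bar>incr w (w' x) x z\<bar> \<le> \<kappa> * min ((norm z)\<^sup>2) (norm z)"
  shows "integrable \<nu> (defect w)"
    and "\<bar>(\<integral>x. w x * (\<integral>z. act x z \<partial>\<nu>) \<partial>lborel) - (\<integral>z. defect w z \<partial>\<nu>)\<bar> \<le> \<kappa> * mom * (\<integral>x. e x \<partial>lborel)"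
    and "integrable lborel (\<lambda>x. w x * (\<integral>z. act x z \<partial>\<nu>))"
proof -
  have [measurable]: "w \<in> borel_measurable borel" using wi by simp
  have [measurable]: "w' \<in> borel_measurable borel"
    by (intro borel_measurable_continuous_onI quad_approx_grad_continuous[OF q])
  have F: "(\<integral>x. (\<integral>z. w x * act x z \<partial>\<nu>) \<partial>lborel) = (\<integral>z. (\<integral>x. w x * act x z \<partial>lborel) \<partial>\<nu>)"
    "integrable lborel (\<lambda>x. \<integral>z. w x * act x z \<partial>\<nu>)"
    "integrable \<nu> (\<lambda>z. \<integral>x. w x * act x z \<partial>lborel)"
  proof -
    have bd: "\<bar>w x * act x z\<bar> \<le> w x * (max C (2 * M) * min ((norm z)\<^sup>2) (norm z))" for x z
      unfolding abs_mult using act_bound[of x z] w0[of x] by (simp add: mult_left_mono)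
    have mm: "(\<lambda>(x, z). w x * act x z) \<in> borel_measurable (lborel \<Otimes>\<^sub>M \<nu>)" by measurable
    note F = Fubini_dominated[OF sigma_finite_lborel sigma_finite_nu mm wi integrable_mult_right[OF integrable_nu] bd]
    show "(\<integral>x. (\<integral>z. w x * act x z \<partial>\<nu>) \<partial>lborel) = (\<integral>z. (\<integral>x. w x * act x z \<partial>lborel) \<partial>\<nu>)"
      "integrable lborel (\<lambda>x. \<integral>z. w x * act x z \<partial>\<nu>)"
      "integrable \<nu> (\<lambda>z. \<integral>x. w x * act x z \<partial>lborel)" by (rule F)+
  qed
  let ?I = "\<lambda>z. \<integral>x. e x * incr w (w' x) x z \<partial>lborel"
  have \<kappa>0: "0 \<le> \<kappa> * min ((norm z)\<^sup>2) (norm z)" for z :: 'a using ib[of 0 z] by linarith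
  have [measurable]: "(\<lambda>(z, x). e x * incr w (w' x) x z) \<in> borel_measurable (borel \<Otimes>\<^sub>M lborel)"
    unfolding incr_def by measurable
  have Im[measurable]: "?I \<in> borel_measurable borel" by measurable
  have Ib: "\<bar>?I z\<bar> \<le> (\<kappa> * (\<integral>x. e x \<partial>lborel)) * min ((norm z)\<^sup>2) (norm z)" for z
  proof -
    have "\<bar>?I z\<bar> \<le> (\<integral>x. \<bar>e x * incr w (w' x) x z\<bar> \<partial>lborel)" by (rule integral_abs_bound)
    also have "\<dots> \<le> (\<integral>x. e x * (\<kappa> * min ((norm z)\<^sup>2) (norm z)) \<partial>lborel)"
    proof (rule integral_mono)
      show "integrable lborel (\<lambda>x. \<bar>e x * incr w (w' x) x z\<bar>)"
        by (intro integrable_abs integrable_mult_bounded(1)[OF e_int _ ib]) (simp add: incr_def)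
      show "\<bar>e x * incr w (w' x) x z\<bar> \<le> e x * (\<kappa> * min ((norm z)\<^sup>2) (norm z))" for x
        using e_bd(1)[of x] ib[of x z] by (simp add: abs_mult mult_left_mono)
    qed (intro integrable_mult_left e_int)
    finally show ?thesis by (simp add: ac_simps)
  qed
  have ii: "integrable \<nu> ?I" by (rule integrable_dominated[OF Im Ib])
  have wf: "defect w = (\<lambda>z. (\<integral>x. w x * act x z \<partial>lborel) - ?I z)"
    using weak_form[OF w0 wi q w'_bd] by (intro ext) simp
  show "integrable \<nu> (defect w)" unfolding wf using F(3) ii by simp
  have "(\<integral>z. defect w z \<partial>\<nu>) = (\<integral>z. (\<integral>x. w x * act x z \<partial>lborel) \<partial>\<nu>) - (\<integral>z. ?I z \<partial>\<nu>)"
    unfolding wf using F(3) ii by simp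
  then have "(\<integral>x. w x * (\<integral>z. act x z \<partial>\<nu>) \<partial>lborel) - (\<integral>z. defect w z \<partial>\<nu>) = (\<integral>z. ?I z \<partial>\<nu>)"
    using F(1) by simp
  then show "\<bar>(\<integral>x. w x * (\<integral>z. act x z \<partial>\<nu>) \<partial>lborel) - (\<integral>z. defect w z \<partial>\<nu>)\<bar> \<le> \<kappa> * mom * (\<integral>x. e x \<partial>lborel)"
    using integral_dominated[OF Im Ib] by (simp add: ac_simps)
  show "integrable lborel (\<lambda>x. w x * (\<integral>z. act x z \<partial>\<nu>))" using F(2) by simp
qed

end

section \<open>Mollified measures\<close>

lemma nn_integral_add_measures:
  fixes M1 M2 N1 N2 :: "'a measure"
  assumes s [simp]: "sets M2 = sets M1" "sets N1 = sets M1" "sets N2 = sets M1"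
    and eq: "\<And>A. A \<in> sets M1 \<Longrightarrow> emeasure M1 A + emeasure N2 A = emeasure M2 A + emeasure N1 A"
    and f: "f \<in> borel_measurable M1"
  shows "(\<integral>\<^sup>+x. f x \<partial>M1) + (\<integral>\<^sup>+x. f x \<partial>N2) = (\<integral>\<^sup>+x. f x \<partial>M2) + (\<integral>\<^sup>+x. f x \<partial>N1)"
  using f
proof (induction rule: borel_measurable_induct)
  have sp: "space M2 = space M1" "space N1 = space M1" "space N2 = space M1"
    using s by (metis sets_eq_imp_space_eq)+
  have [simp]: "borel_measurable M2 = borel_measurable M1" "borel_measurable N1 = borel_measurable M1"
    "borel_measurable N2 = borel_measurable M1" by (auto intro!: measurable_cong_sets)
  {
    case (cong f g)
    have "(\<integral>\<^sup>+x. f x \<partial>M) = (\<integral>\<^sup>+x. g x \<partial>M)" if "space M = space M1" for M :: "'a measure"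
      using cong(3) that by (intro nn_integral_cong) simp
    then show ?case using cong(4) sp by simp
  next
    case (set A)
    then show ?case using eq[OF set] by simp
  next
    case (mult u c)
    then show ?case by (simp only: nn_integral_cmult distrib_left[symmetric] measurable_cong_sets[OF s(1) refl]
          measurable_cong_sets[OF s(2) refl] measurable_cong_sets[OF s(3) refl])
  next
    case (add u v)
    have "(\<integral>\<^sup>+x. v x + u x \<partial>M1) + (\<integral>\<^sup>+x. v x + u x \<partial>N2) =
        ((\<integral>\<^sup>+x. v x \<partial>M1) + (\<integral>\<^sup>+x. v x \<partial>N2)) + ((\<integral>\<^sup>+x. u x \<partial>M1) + (\<integral>\<^sup>+x. u x \<partial>N2))"
      using add.hyps by (simp add: nn_integral_add add.assoc add.left_commute)
    also have "\<dots> = ((\<integral>\<^sup>+x. v x \<partial>M2) + (\<integral>\<^sup>+x. v x \<partial>N1)) + ((\<integral>\<^sup>+x. u x \<partial>M2) + (\<integral>\<^sup>+x. u x \<partial>N1))"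
      by (simp only: add.IH)
    also have "\<dots> = (\<integral>\<^sup>+x. v x + u x \<partial>M2) + (\<integral>\<^sup>+x. v x + u x \<partial>N1)"
      using add.hyps by (simp add: nn_integral_add add.assoc add.left_commute)
    finally show ?case .
  next
    case (seq U)
    have mono: "incseq (\<lambda>i. \<integral>\<^sup>+x. U i x \<partial>M)" for M
      using \<open>incseq U\<close> by (intro incseq_SucI nn_integral_mono) (simp add: incseq_Suc_iff le_fun_def)
    have conv: "(\<integral>\<^sup>+x. (SUP i. U i) x \<partial>M) = (SUP i. \<integral>\<^sup>+x. U i x \<partial>M)" if "sets M = sets M1" for M :: "'a measure"
    proof -
      have [measurable]: "U i \<in> borel_measurable M" for i
        using seq.hyps(1)[of i] measurable_cong_sets[OF that refl] by auto
      have "(\<integral>\<^sup>+x. (SUP i. U i x) \<partial>M) = (SUP i. \<integral>\<^sup>+x. U i x \<partial>M)"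
        by (rule nn_integral_monotone_convergence_SUP[OF \<open>incseq U\<close>]) measurable
      then show ?thesis by (simp add: SUP_apply image_comp)
    qed
    have "(\<integral>\<^sup>+x. (SUP i. U i) x \<partial>M1) + (\<integral>\<^sup>+x. (SUP i. U i) x \<partial>N2) =
        (SUP i. (\<integral>\<^sup>+x. U i x \<partial>M1) + (\<integral>\<^sup>+x. U i x \<partial>N2))"
      unfolding conv[OF refl] conv[OF s(3)] by (rule ennreal_SUP_add[OF mono mono, symmetric])
    also have "\<dots> = (SUP i. (\<integral>\<^sup>+x. U i x \<partial>M2) + (\<integral>\<^sup>+x. U i x \<partial>N1))"
      unfolding seq.IH ..
    also have "\<dots> = (\<integral>\<^sup>+x. (SUP i. U i) x \<partial>M2) + (\<integral>\<^sup>+x. (SUP i. U i) x \<partial>N1)"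
      unfolding conv[OF s(1)] conv[OF s(2)] by (rule ennreal_SUP_add[OF mono mono])
    finally show ?case .
  }
qed

lemma integral_add_measures:
  fixes f :: "'a \<Rightarrow> real"
  assumes fin: "finite_measure M1" "finite_measure M2" "finite_measure N1" "finite_measure N2"
    and s [simp]: "sets M2 = sets M1" "sets N1 = sets M1" "sets N2 = sets M1"
    and eq: "\<And>A. A \<in> sets M1 \<Longrightarrow> emeasure M1 A + emeasure N2 A = emeasure M2 A + emeasure N1 A"
    and f: "f \<in> borel_measurable M1" and bd: "\<And>x. \<bar>f x\<bar> \<le> K"
  shows "(\<integral>x. f x \<partial>M1) - (\<integral>x. f x \<partial>M2) = (\<integral>x. f x \<partial>N1) - (\<integral>x. f x \<partial>N2)"
proof -
  have [simp]: "borel_measurable M2 = borel_measurable M1" "borel_measurable N1 = borel_measurable M1"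
    "borel_measurable N2 = borel_measurable M1" by (auto intro!: measurable_cong_sets)
  have nonneg: "(\<integral>x. g x \<partial>M1) + (\<integral>x. g x \<partial>N2) = (\<integral>x. g x \<partial>M2) + (\<integral>x. g x \<partial>N1)"
    if g: "g \<in> borel_measurable M1" "\<And>x. 0 \<le> g x" "\<And>x. g x \<le> K'" for g :: "'a \<Rightarrow> real" and K'
  proof -
    have i: "ennreal (\<integral>x. g x \<partial>M) = (\<integral>\<^sup>+x. ennreal (g x) \<partial>M)"
      if M: "finite_measure M" "sets M = sets M1" for M
    proof -
      have "g \<in> borel_measurable M" using g(1) measurable_cong_sets[OF M(2) refl] by auto
      then show ?thesis
        using M(1) g by (intro nn_integral_eq_integral[symmetric] finite_measure.integrable_const_bound[of M g K']) auto
    qed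
    have p: "0 \<le> (\<integral>x. g x \<partial>M)" for M by (intro integral_nonneg_AE) (auto simp: g)
    have "ennreal ((\<integral>x. g x \<partial>M1) + (\<integral>x. g x \<partial>N2)) = ennreal ((\<integral>x. g x \<partial>M2) + (\<integral>x. g x \<partial>N1))"
      using nn_integral_add_measures[OF s eq, of "\<lambda>x. ennreal (g x)"] g(1)
      by (simp only: ennreal_plus p i fin s measurable_compose[OF _ measurable_ennreal])
    then show ?thesis by (subst (asm) ennreal_inj) (intro add_nonneg_nonneg p)+
  qed
  have ii: "integrable M f" if M: "finite_measure M" "sets M = sets M1" for M
  proof -
    have "f \<in> borel_measurable M" using f(1) measurable_cong_sets[OF M(2) refl] by auto
    then show ?thesis using M(1) bd by (intro finite_measure.integrable_const_bound[of M f K]) auto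
  qed
  have jj: "integrable M (\<lambda>x. K)" if "finite_measure M" for M :: "'a measure"
    using finite_measure.integrable_const[OF that, of K] .
  have bb: "0 \<le> f x + K" "f x + K \<le> 2 * K" "0 \<le> K" for x using bd[of x] by (auto simp: abs_le_iff)
  have "(\<integral>x. f x + K \<partial>M1) + (\<integral>x. f x + K \<partial>N2) = (\<integral>x. f x + K \<partial>M2) + (\<integral>x. f x + K \<partial>N1)"
    using f bb by (intro nonneg[of "\<lambda>x. f x + K" "2 * K"]) auto
  moreover have "(\<integral>x. K \<partial>M1) + (\<integral>x. K \<partial>N2) = (\<integral>x. K \<partial>M2) + (\<integral>x. K \<partial>N1)"
    using bb by (intro nonneg[of "\<lambda>x. K" K]) auto
  ultimately show ?thesis
    using fin by (simp add: Bochner_Integration.integral_add ii jj del: lebesgue_integral_const)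
qed

lemma jordan_decomposition:
  fixes m1 m2 :: "'a measure"
  assumes fin: "finite_measure m1" "finite_measure m2" and s: "sets m2 = sets m1"
  obtains n1 n2 A where "finite_measure n1" "finite_measure n2" "sets n1 = sets m1" "sets n2 = sets m1"
    "A \<in> sets m1" "emeasure n1 (space m1 - A) = 0" "emeasure n2 A = 0"
    "\<forall>X\<in>sets m1. emeasure n1 X \<le> emeasure m1 X"
    "\<forall>(f :: 'a \<Rightarrow> real) K. f \<in> borel_measurable m1 \<longrightarrow> (\<forall>x. \<bar>f x\<bar> \<le> K) \<longrightarrow>
       (\<integral>x. f x \<partial>m1) - (\<integral>x. f x \<partial>m2) = (\<integral>x. f x \<partial>n1) - (\<integral>x. f x \<partial>n2)"
proof -
  from finite_unsigned_Hahn_decomposition[OF fin s] obtain Y where Y1: "Y \<in> sets m1"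
    and Y2: "\<forall>X\<in>sets m1. X \<subseteq> Y \<longrightarrow> emeasure m2 X \<le> emeasure m1 X"
    and Y3: "\<forall>X\<in>sets m1. X \<inter> Y = {} \<longrightarrow> emeasure m1 X \<le> emeasure m2 X"
    by (elim bexE conjE)
  note Y = Y1 Y2[rule_format] Y3[rule_format]
  define r where "r m Z = density m (indicator Z)" for m :: "'a measure" and Z
  have r: "emeasure (r m Z) X = emeasure m (X \<inter> Z)" if "Z \<in> sets m" "X \<in> sets m" for m Z X
  proof -
    have "emeasure (r m Z) X = (\<integral>\<^sup>+x. indicator Z x * indicator X x \<partial>m)"
      unfolding r_def using that by (intro emeasure_density) auto
    also have "\<dots> = (\<integral>\<^sup>+x. indicator (X \<inter> Z) x \<partial>m)"
      by (intro nn_integral_cong) (auto simp: indicator_def)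
    finally show ?thesis using that by simp
  qed
  have rs [simp]: "sets (r m Z) = sets m" "space (r m Z) = space m" for m Z by (simp_all add: r_def)
  let ?Y' = "space m1 - Y"
  have sp: "space m2 = space m1" using s by (rule sets_eq_imp_space_eq)
  have Y's: "?Y' \<in> sets m1" using Y(1) by auto
  have fr: "finite_measure (r m Z)" if "finite_measure m" "Z \<in> sets m" for m Z
  proof (rule finite_measureI)
    have "emeasure (r m Z) (space m) = emeasure m (space m \<inter> Z)" using that by (intro r) auto
    then show "emeasure (r m Z) (space (r m Z)) \<noteq> \<infinity>"
      using finite_measure.emeasure_finite[OF that(1)] by simp
  qed
  define n1 where "n1 = diff_measure (r m1 Y) (r m2 Y)"
  define n2 where "n2 = diff_measure (r m2 ?Y') (r m1 ?Y')"
  have n1: "emeasure n1 X = emeasure m1 (X \<inter> Y) - emeasure m2 (X \<inter> Y)" if "X \<in> sets m1" for X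
  proof -
    have "emeasure n1 X = emeasure (r m1 Y) X - emeasure (r m2 Y) X"
      unfolding n1_def
    proof (rule emeasure_diff_measure)
      fix Z assume "Z \<in> sets (r m1 Y)"
      then show "emeasure (r m2 Y) Z \<le> emeasure (r m1 Y) Z"
        using Y(1) Y(2)[of "Z \<inter> Y"] s by (simp add: r)
    qed (use that fin Y(1) s fr in simp_all)
    then show ?thesis using that Y(1) s by (simp add: r)
  qed
  have n2: "emeasure n2 X = emeasure m2 (X \<inter> ?Y') - emeasure m1 (X \<inter> ?Y')" if "X \<in> sets m1" for X
  proof -
    have "emeasure n2 X = emeasure (r m2 ?Y') X - emeasure (r m1 ?Y') X"
      unfolding n2_def
    proof (rule emeasure_diff_measure)
      fix Z assume Z: "Z \<in> sets (r m2 ?Y')"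
      have "(Z \<inter> ?Y') \<inter> Y = {}" by auto
      then show "emeasure (r m1 ?Y') Z \<le> emeasure (r m2 ?Y') Z"
        using Y's Z Y(3)[of "Z \<inter> ?Y'"] s by (simp add: r)
    qed (use that fin Y's s fr in simp_all)
    then show ?thesis using that Y's s by (simp add: r)
  qed
  have sn [simp]: "sets n1 = sets m1" "sets n2 = sets m1" "space n1 = space m1" "space n2 = space m1"
    by (auto simp: n1_def n2_def s sp)
  have le1: "emeasure n1 X \<le> emeasure m1 X" if "X \<in> sets m1" for X
  proof -
    have "emeasure n1 X \<le> emeasure m1 (X \<inter> Y)" unfolding n1[OF that] by (rule diff_le_self_ennreal)
    also have "\<dots> \<le> emeasure m1 X" using that by (intro emeasure_mono) auto
    finally show ?thesis .
  qed
  have le2: "emeasure n2 X \<le> emeasure m2 X" if "X \<in> sets m1" for X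
  proof -
    have "emeasure n2 X \<le> emeasure m2 (X \<inter> ?Y')" unfolding n2[OF that] by (rule diff_le_self_ennreal)
    also have "\<dots> \<le> emeasure m2 X" using that s by (intro emeasure_mono) auto
    finally show ?thesis .
  qed
  have f1: "finite_measure n1"
  proof (rule finite_measureI)
    have "emeasure m1 (space m1) \<noteq> top"
      using finite_measure.emeasure_finite[OF fin(1)] by simp
    then have "emeasure n1 (space m1) \<noteq> top"
      using le1[OF sets.top] by (auto simp: top_unique)
    then show "emeasure n1 (space n1) \<noteq> \<infinity>" by simp
  qed
  have f2: "finite_measure n2"
  proof (rule finite_measureI)
    have "emeasure m2 (space m1) \<noteq> top"
      using finite_measure.emeasure_finite[OF fin(2)] by simp
    then have "emeasure n2 (space m1) \<noteq> top"
      using le2[OF sets.top] by (auto simp: top_unique)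
    then show "emeasure n2 (space n2) \<noteq> \<infinity>" by simp
  qed
  have eq: "emeasure m1 X + emeasure n2 X = emeasure m2 X + emeasure n1 X" if X: "X \<in> sets m1" for X
  proof -
    have e: "emeasure m X = emeasure m (X \<inter> Y) + emeasure m (X \<inter> ?Y')" if "sets m = sets m1" for m
    proof -
      have "emeasure m (X \<inter> Y) + emeasure m (X \<inter> ?Y') = emeasure m (X \<inter> Y \<union> X \<inter> ?Y')"
        using X Y(1) Y's that by (intro plus_emeasure) auto
      also have "X \<inter> Y \<union> X \<inter> ?Y' = X" using sets.sets_into_space[OF X] by auto
      finally show ?thesis by simp
    qed
    have "emeasure m2 (X \<inter> Y) + (emeasure m1 (X \<inter> Y) - emeasure m2 (X \<inter> Y)) = emeasure m1 (X \<inter> Y)"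
      using X Y by (intro add_diff_inverse_ennreal Y(2)) auto
    moreover have "emeasure m1 (X \<inter> ?Y') + (emeasure m2 (X \<inter> ?Y') - emeasure m1 (X \<inter> ?Y')) = emeasure m2 (X \<inter> ?Y')"
      using X Y's by (intro add_diff_inverse_ennreal Y(3)) auto
    moreover have "(p + q) + t = (u + v) + w" if "u + w = p" "q + t = v" for p q t u v w :: ennreal
      using that by (auto simp: ac_simps)
    ultimately show ?thesis unfolding n1[OF X] n2[OF X] e[OF refl] e[OF s] by blast
  qed
  show ?thesis
  proof (rule that[OF f1 f2 sn(1,2) Y(1)])
    have "(space m1 - Y) \<inter> Y = {}" by auto
    then show "emeasure n1 (space m1 - Y) = 0" using n1[OF Y's] by simp
    have "Y \<inter> (space m1 - Y) = {}" by auto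
    then show "emeasure n2 Y = 0" using n2[OF Y(1)] by simp
    show "\<forall>X\<in>sets m1. emeasure n1 X \<le> emeasure m1 X" by (rule ballI) (rule le1)
    show "\<forall>(f :: 'a \<Rightarrow> real) K. f \<in> borel_measurable m1 \<longrightarrow> (\<forall>x. \<bar>f x\<bar> \<le> K) \<longrightarrow>
       (\<integral>x. f x \<partial>m1) - (\<integral>x. f x \<partial>m2) = (\<integral>x. f x \<partial>n1) - (\<integral>x. f x \<partial>n2)"
    proof (intro allI impI)
      fix f :: "'a \<Rightarrow> real" and K
      assume f: "f \<in> borel_measurable m1" "\<forall>x. \<bar>f x\<bar> \<le> K"
      show "(\<integral>x. f x \<partial>m1) - (\<integral>x. f x \<partial>m2) = (\<integral>x. f x \<partial>n1) - (\<integral>x. f x \<partial>n2)"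
        by (rule integral_add_measures[OF fin f1 f2 s sn(1,2) eq f(1) f(2)[rule_format]])
    qed
  qed
qed

definition mol_mass :: "real \<Rightarrow> 'a::euclidean_space itself \<Rightarrow> real" where
  "mol_mass \<epsilon> _ = (\<integral>x. bump \<epsilon> (x::'a) \<partial>lborel)"

definition mol :: "real \<Rightarrow> 'a::euclidean_space \<Rightarrow> real" where
  "mol \<epsilon> x = 1 / mol_mass \<epsilon> TYPE('a) * bump \<epsilon> x"

definition mol' :: "real \<Rightarrow> 'a::euclidean_space \<Rightarrow> 'a" where
  "mol' \<epsilon> x = (1 / mol_mass \<epsilon> TYPE('a)) *\<^sub>R bump' \<epsilon> x"

lemma bump_measurable [measurable]: "bump \<epsilon> \<in> borel_measurable borel"
  unfolding bump_def[abs_def] by measurable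

lemma bump'_measurable [measurable]: "bump' \<epsilon> \<in> borel_measurable borel"
  unfolding bump'_def[abs_def] by measurable

lemma mol_measurable [measurable]: "mol \<epsilon> \<in> borel_measurable borel"
  unfolding mol_def[abs_def] by measurable

lemma mol'_measurable [measurable]: "mol' \<epsilon> \<in> borel_measurable borel"
  unfolding mol'_def[abs_def] by measurable

lemma cball_integrable: "integrable lborel (indicator (cball c r) :: 'a::euclidean_space \<Rightarrow> real)"
  using emeasure_bounded_finite[OF bounded_cball, of c r] by (intro integrable_real_indicator) auto

lemma bump_integrable: "\<epsilon> > 0 \<Longrightarrow> integrable lborel (bump \<epsilon> :: 'a::euclidean_space \<Rightarrow> real)"
  by (rule Bochner_Integration.integrable_bound[OF cball_integrable[of 0 \<epsilon>]])
     (auto simp: indicator_def bump_nonneg bump_le_1 bump_eq_0)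

lemma mol_mass_lower:
  assumes "\<epsilon> > 0"
  shows "measure lborel (cball (0::'a::euclidean_space) (\<epsilon> / 2)) / 2 \<le> mol_mass \<epsilon> TYPE('a)"
proof -
  have "(\<integral>x. indicator (cball (0::'a) (\<epsilon> / 2)) x * (1 / 2) \<partial>lborel) \<le> mol_mass \<epsilon> TYPE('a)"
    unfolding mol_mass_def
  proof (intro integral_mono integrable_mult_left cball_integrable bump_integrable assms)
    fix x :: 'a
    show "indicator (cball (0::'a) (\<epsilon> / 2)) x * (1 / 2) \<le> bump \<epsilon> x"
      using bump_ge_half[OF assms, of x] bump_nonneg[of \<epsilon> x] by (auto simp: indicator_def)
  qed
  then show ?thesis by simp
qed

lemma mol_mass_pos: "\<epsilon> > 0 \<Longrightarrow> mol_mass \<epsilon> TYPE('a::euclidean_space) > 0"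
  using mol_mass_lower[of \<epsilon>, where 'a = 'a] content_cball_pos[of "\<epsilon> / 2" "0::'a"] by linarith

lemma cball_mass_ratio:
  assumes "\<epsilon> > 0"
  shows "measure lborel (cball (0::'a::euclidean_space) \<epsilon>) \<le> 2 * 2 ^ DIM('a) * mol_mass \<epsilon> TYPE('a)"
proof -
  have "measure lborel (cball (0::'a) \<epsilon>) = 2 ^ DIM('a) * measure lborel (cball (0::'a) (\<epsilon> / 2))"
    using assms by (simp add: content_cball power_divide)
  also have "\<dots> \<le> 2 ^ DIM('a) * (2 * mol_mass \<epsilon> TYPE('a))"
    using mol_mass_lower[OF assms, where 'a='a] by (intro mult_left_mono) auto
  finally show ?thesis by simp
qed

lemma mol_nonneg: "\<epsilon> > 0 \<Longrightarrow> 0 \<le> mol \<epsilon> (x::'a::euclidean_space)"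
  using mol_mass_pos[of \<epsilon>, where 'a='a] by (simp add: mol_def bump_nonneg)

lemma mol_le: "\<epsilon> > 0 \<Longrightarrow> mol \<epsilon> (x::'a::euclidean_space) \<le> 1 / mol_mass \<epsilon> TYPE('a)"
  using mol_mass_pos[of \<epsilon>, where 'a='a] bump_le_1[of \<epsilon> x] by (simp add: mol_def divide_right_mono)

lemma mol_eq_0: "\<epsilon> > 0 \<Longrightarrow> norm x \<ge> \<epsilon> \<Longrightarrow> mol \<epsilon> x = 0"
  by (simp add: mol_def bump_eq_0)

lemma mol'_eq_0: "\<epsilon> > 0 \<Longrightarrow> norm x \<ge> \<epsilon> \<Longrightarrow> mol' \<epsilon> x = 0"
  by (simp add: mol'_def bump'_eq_0)

lemma mol_integrable: "\<epsilon> > 0 \<Longrightarrow> integrable lborel (mol \<epsilon>)"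
  unfolding mol_def[abs_def] by (intro integrable_mult_right bump_integrable)

lemma mol_integral: "\<epsilon> > 0 \<Longrightarrow> (\<integral>x. mol \<epsilon> (x::'a::euclidean_space) \<partial>lborel) = 1"
  using mol_mass_pos[of \<epsilon>, where 'a='a] by (simp add: mol_def mol_mass_def)

lemma mol_quad: "\<epsilon> > 0 \<Longrightarrow> quad_approx (1 / mol_mass \<epsilon> TYPE('a) * (11 / \<epsilon>\<^sup>2)) (mol \<epsilon>) (mol' \<epsilon> :: 'a::euclidean_space \<Rightarrow> 'a)"
  using quad_approx_scale[OF quad_approx_bump, of \<epsilon> "1 / mol_mass \<epsilon> TYPE('a)"] mol_mass_pos[of \<epsilon>, where 'a='a]
  by (simp add: mol_def[abs_def] mol'_def[abs_def])

lemma mol'_le: "\<epsilon> > 0 \<Longrightarrow> norm (mol' \<epsilon> (x::'a::euclidean_space)) \<le> 1 / mol_mass \<epsilon> TYPE('a) * (4 / \<epsilon>)"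
  unfolding mol'_def norm_scaleR using mol_mass_pos[of \<epsilon>, where 'a='a] norm_bump'_le[of \<epsilon> x]
  by (simp only: real_norm_def abs_of_pos zero_less_divide_1_iff) (intro mult_left_mono, simp_all)

text \<open>With \<open>s = 1 - \<bar>x/\<epsilon>\<bar>\<^sup>2\<close> the left hand side is at most \<open>4 s\<close> and \<open>mol\<close> is \<open>s\<^sup>2\<close>, up to the same constant;
  conclude by AM-GM.\<close>

lemma mol'_commutator:
  assumes "\<epsilon> > 0" "\<eta> > 0"
  shows "norm x * norm (mol' \<epsilon> (x::'a::euclidean_space)) \<le>
    2 / \<eta> * mol \<epsilon> x + 2 * \<eta> * (indicator (cball 0 \<epsilon>) x / mol_mass \<epsilon> TYPE('a))"
proof (cases "norm x \<le> \<epsilon>")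
  case True
  define s where "s = max 0 (1 - (norm x / \<epsilon>)\<^sup>2)"
  let ?Z = "mol_mass \<epsilon> TYPE('a)"
  have Z: "?Z > 0" using mol_mass_pos assms(1) by blast
  have s0: "s \<ge> 0" by (simp add: s_def)
  have q: "(norm x / \<epsilon>)\<^sup>2 \<le> 1" using True assms(1) by (simp add: power_le_one)
  have "norm x * norm (bump' \<epsilon> x) = 4 * s * (norm x / \<epsilon>)\<^sup>2"
    unfolding bump'_def s_def[symmetric] using s0 assms(1) by (simp add: abs_mult power2_eq_square)
  also have "\<dots> \<le> 4 * s * 1" using q s0 by (intro mult_left_mono) auto
  also have "4 * s \<le> 2 / \<eta> * s\<^sup>2 + 2 * \<eta>"
  proof -
    have "0 \<le> 2 / \<eta> * (s - \<eta>)\<^sup>2" using assms(2) by simp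
    also have "\<dots> = 2 / \<eta> * s\<^sup>2 + 2 * \<eta> - 4 * s" using assms(2)
      by (simp add: power2_eq_square field_simps)
    finally show ?thesis by simp
  qed
  finally have "norm x * norm (bump' \<epsilon> x) \<le> 2 / \<eta> * bump \<epsilon> x + 2 * \<eta>" by (simp add: bump_def s_def)
  then have "1 / ?Z * (norm x * norm (bump' \<epsilon> x)) \<le> 1 / ?Z * (2 / \<eta> * bump \<epsilon> x + 2 * \<eta>)"
    using Z by (intro mult_left_mono) auto
  then show ?thesis using True Z by (simp add: mol'_def mol_def distrib_left ac_simps)
next
  case False
  then show ?thesis using assms mol_nonneg[of \<epsilon> x] mol'_eq_0[of \<epsilon> x] by simp
qed

lemma mol_quad': "\<epsilon> > 0 \<Longrightarrow> quad_approx (1 / mol_mass \<epsilon> TYPE('a) * (11 / \<epsilon>\<^sup>2)) (\<lambda>x. mol \<epsilon> (x - y)) (\<lambda>x. mol' \<epsilon> (x - y :: 'a::euclidean_space))"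
  by (rule quad_approx_translate[OF mol_quad])

definition conv :: "'a measure \<Rightarrow> ('a::euclidean_space \<Rightarrow> 'b::{banach, second_countable_topology}) \<Rightarrow> 'a \<Rightarrow> 'b" where
  "conv n k x = (\<integral>y. k (x - y) \<partial>n)"

locale finite_borel = finite_measure n for n :: "'a::euclidean_space measure" +
  assumes sets_n [measurable_cong, simp]: "sets n = sets borel"
begin

lemma space_n [simp]: "space n = UNIV"
  using sets_n by (metis sets_eq_imp_space_eq space_borel)

lemma borel_measurable_n [simp]: "borel_measurable n = borel_measurable borel"
  by (rule measurable_cong_sets) auto

definition mass :: real where "mass = measure n UNIV"

lemma integral_const_n: "(\<integral>y. c \<partial>n) = (c::real) * mass"
  by (simp add: mass_def)

lemma integrable_bounded:
  fixes k :: "'a \<Rightarrow> 'b::{banach, second_countable_topology}"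
  assumes "k \<in> borel_measurable borel" "\<And>x. norm (k x) \<le> K"
  shows "integrable n k"
  using assms by (intro integrable_const_bound[where B = K]) auto

lemma integral_bounded:
  fixes k :: "'a \<Rightarrow> real"
  assumes "k \<in> borel_measurable borel" "\<And>x. \<bar>k x\<bar> \<le> K"
  shows "\<bar>\<integral>y. k y \<partial>n\<bar> \<le> K * mass"
proof -
  have "\<bar>\<integral>y. k y \<partial>n\<bar> \<le> (\<integral>y. \<bar>k y\<bar> \<partial>n)" by (rule integral_abs_bound)
  also have "\<dots> \<le> (\<integral>y. K \<partial>n)"
    by (intro integral_mono integrable_abs integrable_bounded[of k K] integrable_const) (use assms in auto)
  finally show ?thesis by (simp only: integral_const_n)
qed

lemma conv_quad:
  assumes q: "quad_approx C k k'" and [measurable]: "k \<in> borel_measurable borel" "k' \<in> borel_measurable borel"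
    and bd: "\<And>x. \<bar>k x\<bar> \<le> K" "\<And>x. norm (k' x) \<le> K'"
  shows "quad_approx (C * mass) (conv n k) (conv n k')"
  unfolding quad_approx_def
proof (intro allI)
  fix x h
  have i: "integrable n (\<lambda>y. k (z - y))" "integrable n (\<lambda>y. k' (z - y))" for z
    by (rule integrable_bounded[where K = K], simp, simp add: bd) (rule integrable_bounded[where K = K'], simp, simp add: bd)
  have "conv n k (x + h) - conv n k x - conv n k' x \<bullet> h = (\<integral>y. k ((x - y) + h) - k (x - y) - k' (x - y) \<bullet> h \<partial>n)"
    unfolding conv_def using i(1)[of x] i(1)[of "x + h"] i(2)[of x]
    by (simp add: algebra_simps)
  moreover have "\<bar>\<integral>y. k ((x - y) + h) - k (x - y) - k' (x - y) \<bullet> h \<partial>n\<bar> \<le> (C * (norm h)\<^sup>2) * mass"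
    by (rule integral_bounded) (auto simp: quad_approxD[OF q])
  ultimately show "\<bar>conv n k (x + h) - conv n k x - conv n k' x \<bullet> h\<bar> \<le> C * mass * (norm h)\<^sup>2"
    by (simp add: ac_simps)
qed

lemma conv_nonneg: "(\<And>x. 0 \<le> k x) \<Longrightarrow> 0 \<le> (conv n k x :: real)"
  unfolding conv_def by (intro integral_nonneg_AE) auto

lemma conv_norm_le:
  fixes k :: "'a \<Rightarrow> 'b::{banach, second_countable_topology}"
  assumes [measurable]: "k \<in> borel_measurable borel" and bd: "\<And>x. norm (k x) \<le> K"
  shows "norm (conv n k x) \<le> K * mass"
proof -
  have "norm (conv n k x) \<le> (\<integral>y. norm (k (x - y)) \<partial>n)" unfolding conv_def by (rule integral_norm_bound)
  also have "\<dots> \<le> K * mass"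
    using integral_bounded[of "\<lambda>y. norm (k (x - y))" K] bd by (simp add: abs_le_iff)
  finally show ?thesis .
qed

lemma conv_weighted:
  fixes k h :: "'a \<Rightarrow> real"
  assumes k: "integrable lborel k" and [measurable]: "h \<in> borel_measurable borel" and bd: "\<And>x. \<bar>h x\<bar> \<le> K"
  shows "integrable lborel (\<lambda>x. \<integral>y. k (x - y) * h y \<partial>n)"
    and "(\<integral>x. (\<integral>y. k (x - y) * h y \<partial>n) \<partial>lborel) = (\<integral>x. k x \<partial>lborel) * (\<integral>y. h y \<partial>n)"
proof -
  have [measurable]: "k \<in> borel_measurable borel" using k by simp
  interpret pair_sigma_finite n lborel
    by (rule pair_sigma_finite.intro[OF _ sigma_finite_lborel]) unfold_locales
  have it: "integrable lborel (\<lambda>x. k (x - y))" for y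
    using integrable_lborel_translate[OF k, of "- y"] by simp
  have tr: "(\<integral>x. g (k (x - y)) \<partial>lborel) = (\<integral>x. g (k x) \<partial>lborel)" if [measurable]: "g \<in> borel_measurable borel" for y and g :: "real \<Rightarrow> real"
    using integral_lborel_translate[of "\<lambda>x. g (k x)" "- y"] by simp
  have i: "integrable (n \<Otimes>\<^sub>M lborel) (\<lambda>(y, x). k (x - y) * h y)"
  proof (rule Fubini_integrable)
    show "(\<lambda>(y, x). k (x - y) * h y) \<in> borel_measurable (n \<Otimes>\<^sub>M lborel)" by measurable
    have "(\<integral>x. norm (case (y, x) of (y, x) \<Rightarrow> k (x - y) * h y) \<partial>lborel) = (\<integral>x. \<bar>k x\<bar> \<partial>lborel) * \<bar>h y\<bar>" for y
      using tr[of abs y] by (simp add: abs_mult)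
    then show "integrable n (\<lambda>y. \<integral>x. norm (case (y, x) of (y, x) \<Rightarrow> k (x - y) * h y) \<partial>lborel)"
      using bd by (simp add: integrable_bounded[where K = K])
  qed (use it in simp)
  show "integrable lborel (\<lambda>x. \<integral>y. k (x - y) * h y \<partial>n)" using integrable_snd[OF i] .
  have "(\<integral>x. (\<integral>y. k (x - y) * h y \<partial>n) \<partial>lborel) = (\<integral>y. (\<integral>x. k (x - y) * h y \<partial>lborel) \<partial>n)"
    using Fubini_integral[OF i] .
  also have "\<dots> = (\<integral>y. (\<integral>x. k x \<partial>lborel) * h y \<partial>n)"
    using tr[of "\<lambda>x. x"] by simp
  finally show "(\<integral>x. (\<integral>y. k (x - y) * h y \<partial>n) \<partial>lborel) = (\<integral>x. k x \<partial>lborel) * (\<integral>y. h y \<partial>n)" by simp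
qed

lemma conv_integral:
  fixes k :: "'a \<Rightarrow> real"
  assumes "integrable lborel k"
  shows "integrable lborel (conv n k)" "(\<integral>x. conv n k x \<partial>lborel) = (\<integral>x. k x \<partial>lborel) * mass"
  using conv_weighted[OF assms, of "\<lambda>y. 1" 1] integral_const_n[of 1] unfolding conv_def[abs_def] by auto

end

lemma min_conv_mol_small:
  fixes n1 n2 :: "'a::euclidean_space measure"
  assumes "finite_borel n1" "finite_borel n2" and A: "A \<in> sets borel"
    and sing: "emeasure n1 (- A) = 0" "emeasure n2 A = 0" and "\<delta> > 0"
  obtains \<epsilon>0 where "\<epsilon>0 > 0" "\<And>\<epsilon>. 0 < \<epsilon> \<Longrightarrow> \<epsilon> < \<epsilon>0 \<Longrightarrow>
     (\<integral>x. min (conv n1 (mol \<epsilon>) x) (conv n2 (mol \<epsilon>) x) \<partial>lborel) \<le> \<delta>"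
proof -
  interpret n1: finite_borel n1 by fact
  interpret n2: finite_borel n2 by fact
  have inner: "\<exists>K. K \<subseteq> X \<and> compact K \<and> measure n (X - K) < \<delta> / 2"
    if "finite_borel n" "X \<in> sets borel" for n :: "'a measure" and X
  proof -
    interpret n: finite_borel n by fact
    have "\<exists>K. K \<subseteq> X \<and> compact K \<and> measure n X - \<delta> / 2 < measure n K"
    proof (cases "measure n X = 0")
      case True
      then show ?thesis using \<open>\<delta> > 0\<close> by (intro exI[of _ "{}"]) simp
    next
      case False
      then have "measure n X > 0" using measure_nonneg[of n X] by linarith
      then have "ennreal (measure n X - \<delta> / 2) < ennreal (measure n X)"
        using \<open>\<delta> > 0\<close> by (intro ennreal_lessI) auto
      also have "\<dots> = (SUP K \<in> {K. K \<subseteq> X \<and> compact K}. emeasure n K)"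
        unfolding n.emeasure_eq_measure[symmetric]
        using that(2) by (intro inner_regular) (auto simp: n.emeasure_eq_measure)
      finally obtain K where K: "K \<subseteq> X" "compact K" "ennreal (measure n X - \<delta> / 2) < ennreal (measure n K)"
        unfolding less_SUP_iff by (auto simp: n.emeasure_eq_measure)
      then have "measure n X - \<delta> / 2 < measure n K"
        by (cases "0 \<le> measure n X - \<delta> / 2")
           (simp add: ennreal_less_iff, use measure_nonneg[of n K] in linarith)
      with K show ?thesis by blast
    qed
    then obtain K where K: "K \<subseteq> X" "compact K" "measure n X < measure n K + \<delta> / 2" by (auto simp: algebra_simps)
    have Kb: "K \<in> sets borel" using K(2) by (simp add: borel_compact)
    note K(3)
    moreover have "measure n (X - K) = measure n X - measure n K"
      using K Kb that by (intro n.finite_measure_Diff) auto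
    ultimately have "measure n (X - K) < \<delta> / 2" by linarith
    with K show ?thesis by blast
  qed
  obtain K1 where K1: "K1 \<subseteq> A" "compact K1" "measure n1 (A - K1) < \<delta> / 2" using inner[OF assms(1) A] by blast
  obtain K2 where K2: "K2 \<subseteq> - A" "compact K2" "measure n2 (- A - K2) < \<delta> / 2" using inner[OF assms(2), of "- A"] A by auto
  have "K1 \<inter> K2 = {}" using K1 K2 by auto
  then obtain d where d: "d > 0" "\<And>x y. x \<in> K1 \<Longrightarrow> y \<in> K2 \<Longrightarrow> d \<le> dist x y"
    using separate_compact_closed[OF K1(2) compact_imp_closed[OF K2(2)]] by blast
  have Kb [measurable]: "K1 \<in> sets borel" "K2 \<in> sets borel" using K1 K2 by (auto simp: borel_compact)
  note A[measurable]
  have c1: "measure n1 (- K1) < \<delta> / 2"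
  proof -
    have "emeasure n1 (- K1) \<le> emeasure n1 (- A) + emeasure n1 (A - K1)"
      using A by (intro order_trans[OF emeasure_mono[of "- K1" "- A \<union> (A - K1)" n1] emeasure_subadditive]) auto
    from this[unfolded sing add_0_left, unfolded n1.emeasure_eq_measure] have "measure n1 (- K1) \<le> measure n1 (A - K1)" by simp
    then show ?thesis using K1 by linarith
  qed
  have c2: "measure n2 (- K2) < \<delta> / 2"
  proof -
    have "emeasure n2 (- K2) \<le> emeasure n2 A + emeasure n2 (- A - K2)"
      using A by (intro order_trans[OF emeasure_mono[of "- K2" "A \<union> (- A - K2)" n2] emeasure_subadditive]) auto
    from this[unfolded sing add_0_left, unfolded n2.emeasure_eq_measure] have "measure n2 (- K2) \<le> measure n2 (- A - K2)" by simp
    then show ?thesis using K2 by linarith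
  qed
  show ?thesis
  proof (rule that[of "d / 2"])
    fix \<epsilon> assume \<epsilon>: "0 < \<epsilon>" "\<epsilon> < d / 2"
    let ?h1 = "indicator (- K1) :: 'a \<Rightarrow> real" and ?h2 = "indicator (- K2) :: 'a \<Rightarrow> real"
    let ?a = "\<lambda>x. \<integral>y. mol \<epsilon> (x - y) * ?h1 y \<partial>n1" and ?b = "\<lambda>x. \<integral>y. mol \<epsilon> (x - y) * ?h2 y \<partial>n2"
    have ab0: "0 \<le> ?a x" "0 \<le> ?b x" for x
      by (intro integral_nonneg_AE AE_I2 mult_nonneg_nonneg; simp add: mol_nonneg \<epsilon>)+
    have h: "?h1 \<in> borel_measurable borel" "?h2 \<in> borel_measurable borel" "\<bar>?h1 y\<bar> \<le> 1" "\<bar>?h2 y\<bar> \<le> 1" for y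
      by (auto simp: indicator_def)
    note i = mol_integrable[OF \<epsilon>(1)]
    have ai: "integrable lborel ?a" by (rule n1.conv_weighted(1)[OF i h(1,3)])
    have bi: "integrable lborel ?b" by (rule n2.conv_weighted(1)[OF i h(2,4)])
    have av: "(\<integral>x. ?a x \<partial>lborel) = measure n1 (- K1)"
      using n1.conv_weighted(2)[OF i h(1,3)] by (simp only: mol_integral[OF \<epsilon>(1)]) simp
    have bv: "(\<integral>x. ?b x \<partial>lborel) = measure n2 (- K2)"
      using n2.conv_weighted(2)[OF i h(2,4)] by (simp only: mol_integral[OF \<epsilon>(1)]) simp
    have m1: "integrable lborel (conv n1 (mol \<epsilon>))" and m2: "integrable lborel (conv n2 (mol \<epsilon>))"
      by (intro n1.conv_integral n2.conv_integral mol_integrable \<epsilon>)+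
    have "(\<integral>x. min (conv n1 (mol \<epsilon>) x) (conv n2 (mol \<epsilon>) x) \<partial>lborel) \<le> (\<integral>x. ?a x + ?b x \<partial>lborel)"
    proof (intro integral_mono integrable_min m1 m2 Bochner_Integration.integrable_add ai bi)
      fix x
      show "min (conv n1 (mol \<epsilon>) x) (conv n2 (mol \<epsilon>) x) \<le> ?a x + ?b x"
      proof (cases "\<exists>y\<in>K1. dist x y < \<epsilon>")
        case True
        then obtain y where y: "y \<in> K1" "dist x y < \<epsilon>" by blast
        have "mol \<epsilon> (x - w) = mol \<epsilon> (x - w) * ?h2 w" for w
        proof (cases "w \<in> K2")
          case w: True
          have "d \<le> dist x y + dist x w" using d(2)[OF y(1) w] dist_triangle3[of y w x] by (simp add: dist_commute)
          then have "dist x w \<ge> \<epsilon>" using y(2) \<epsilon> by linarith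
          then show ?thesis using mol_eq_0[OF \<epsilon>(1), of "x - w"] by (simp add: dist_norm)
        qed simp
        then have "conv n2 (mol \<epsilon>) x = ?b x" unfolding conv_def by (intro Bochner_Integration.integral_cong) auto
        then show ?thesis using ab0[of x] by linarith
      next
        case False
        have "mol \<epsilon> (x - w) = mol \<epsilon> (x - w) * ?h1 w" for w
          using False mol_eq_0[OF \<epsilon>(1), of "x - w"] by (cases "w \<in> K1") (auto simp: dist_norm not_less)
        then have "conv n1 (mol \<epsilon>) x = ?a x" unfolding conv_def by (intro Bochner_Integration.integral_cong) auto
        then show ?thesis using ab0[of x] by linarith
      qed
    qed
    also have "\<dots> = measure n1 (- K1) + measure n2 (- K2)" using ai bi av bv by simp
    finally show "(\<integral>x. min (conv n1 (mol \<epsilon>) x) (conv n2 (mol \<epsilon>) x) \<partial>lborel) \<le> \<delta>" using c1 c2 by linarith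
  qed (use d in simp)
qed

lemma (in min_pair) transport_lipschitz:
  assumes \<psi>: "\<And>x. 0 \<le> \<psi> x" "\<And>x. \<psi> x \<le> 1" "\<And>x. norm x \<ge> R \<Longrightarrow> \<psi> x = 0"
      "\<And>x y. \<bar>\<psi> x - \<psi> y\<bar> \<le> Lc * norm (x - y)" "integrable lborel \<psi>"
    and B: "\<And>x y. norm x \<le> R \<Longrightarrow> norm y \<le> R \<Longrightarrow> norm (B x - B y) \<le> L * norm (x - y)"
      "\<And>x. norm x \<le> R \<Longrightarrow> norm (B x) \<le> N" "B \<in> borel_measurable borel"
    and nn: "L \<ge> 0" "N \<ge> 0" "Lc \<ge> 0"
  shows "integrable lborel (\<lambda>x. \<psi> x * (B x \<bullet> G x))"
    and "- (\<integral>x. \<psi> x * (B x \<bullet> G x) \<partial>lborel) \<le> real DIM('a) * (3 * N * Lc + L) * (\<integral>x. e x \<partial>lborel)"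
proof -
  have [measurable]: "\<psi> \<in> borel_measurable borel" using \<psi>(5) by simp
  note B(3)[measurable]
  have Bi: "\<bar>B x \<bullet> i\<bar> \<le> N" if "i \<in> Basis" "norm x \<le> R" for x i
    using Basis_le_norm[OF that(1), of "B x"] B(2)[OF that(2)] by linarith
  define w where "w i x = \<psi> x * (B x \<bullet> i + N)" for i x
  have w_bd: "0 \<le> w i x" "w i x \<le> \<psi> x * (2 * N)" if "i \<in> Basis" for i x
  proof -
    have "0 \<le> w i x \<and> w i x \<le> \<psi> x * (2 * N)"
    proof (cases "norm x \<le> R")
      case True
      then have "0 \<le> B x \<bullet> i + N" "B x \<bullet> i + N \<le> 2 * N" using Bi[OF that, of x] by linarith+
      then show ?thesis unfolding w_def using \<psi>(1)[of x] by (simp add: mult_left_mono)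
    next
      case False
      then show ?thesis using \<psi>(3)[of x] by (simp add: w_def)
    qed
    then show "0 \<le> w i x" "w i x \<le> \<psi> x * (2 * N)" by auto
  qed
  have wi: "integrable lborel (w i)" if "i \<in> Basis" for i
  proof (rule Bochner_Integration.integrable_bound[OF integrable_mult_left[OF \<psi>(5), of "2 * N"]])
    show "AE x in lborel. norm (w i x) \<le> norm (\<psi> x * (2 * N))"
      using w_bd[OF that] by (intro AE_I2) (simp add: order_trans[OF _ abs_ge_self])
  qed (simp add: w_def[abs_def])
  have wL: "\<bar>w i x - w i y\<bar> \<le> (2 * N * Lc + L) * norm (x - y)" if i: "i \<in> Basis" for i x y
  proof -
    have one: "\<bar>w i x - w i y\<bar> \<le> (2 * N * Lc + L) * norm (x - y)" if "\<psi> y = 0" for x y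
    proof -
      have "\<bar>w i x - w i y\<bar> \<le> \<psi> x * (2 * N)" using that w_bd[OF i, of x] by (simp add: w_def)
      also have "\<dots> \<le> (Lc * norm (x - y)) * (2 * N)"
        using \<psi>(4)[of x y] that nn by (intro mult_right_mono) auto
      also have "\<dots> \<le> (2 * N * Lc + L) * norm (x - y)" using nn by (simp add: algebra_simps)
      finally show ?thesis .
    qed
    show ?thesis
    proof (cases "\<psi> x = 0 \<or> \<psi> y = 0")
      case True
      then show ?thesis using one[of x y] one[of y x] by (auto simp: norm_minus_commute abs_minus_commute)
    next
      case False
      then have xy: "norm x \<le> R" "norm y \<le> R" using \<psi>(3)[of x] \<psi>(3)[of y] linorder_le_cases[of "norm x" R] linorder_le_cases[of "norm y" R] by blast+
      have "w i x - w i y = (\<psi> x - \<psi> y) * (B x \<bullet> i + N) + \<psi> y * ((B x - B y) \<bullet> i)"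
        by (simp add: w_def algebra_simps)
      also have "\<bar>\<dots>\<bar> \<le> \<bar>\<psi> x - \<psi> y\<bar> * \<bar>B x \<bullet> i + N\<bar> + \<psi> y * \<bar>(B x - B y) \<bullet> i\<bar>"
        using \<psi>(1)[of y] by (intro order_trans[OF abs_triangle_ineq]) (simp add: abs_mult)
      also have "\<dots> \<le> (Lc * norm (x - y)) * (2 * N) + 1 * (L * norm (x - y))"
      proof (intro add_mono mult_mono)
        show "\<bar>B x \<bullet> i + N\<bar> \<le> 2 * N" using Bi[OF i xy(1)] by (auto simp: abs_le_iff)
        show "\<bar>(B x - B y) \<bullet> i\<bar> \<le> L * norm (x - y)"
          using Basis_le_norm[OF i, of "B x - B y"] B(1)[OF xy] by linarith
      qed (use \<psi> nn in auto)
      also have "\<dots> = (2 * N * Lc + L) * norm (x - y)" by (simp add: algebra_simps)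
      finally show ?thesis .
    qed
  qed
  have Gi: "\<bar>G x \<bullet> i\<bar> \<le> M" if "i \<in> Basis" for x i using G_inner_bd[of x i] that by simp
  have i1: "integrable lborel (\<lambda>x. w i x * (G x \<bullet> i))" "integrable lborel (\<lambda>x. \<psi> x * (G x \<bullet> i))" if "i \<in> Basis" for i
    by (rule integrable_mult_bounded(1)[OF wi[OF that] _ Gi[OF that]], simp) (rule integrable_mult_bounded(1)[OF \<psi>(5) _ Gi[OF that]], simp)
  have eq: "\<psi> x * (B x \<bullet> G x) = (\<Sum>i\<in>Basis. w i x * (G x \<bullet> i) - N * (\<psi> x * (G x \<bullet> i)))" for x
    by (subst euclidean_inner[of "B x"]) (simp add: sum_distrib_left w_def algebra_simps)
  show "integrable lborel (\<lambda>x. \<psi> x * (B x \<bullet> G x))"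
    by (subst eq) (intro Bochner_Integration.integrable_sum Bochner_Integration.integrable_diff integrable_mult_right i1)
  have "(\<integral>x. \<psi> x * (B x \<bullet> G x) \<partial>lborel) =
     (\<Sum>i\<in>Basis. (\<integral>x. w i x * (G x \<bullet> i) \<partial>lborel) - N * (\<integral>x. \<psi> x * (G x \<bullet> i) \<partial>lborel))"
  proof (subst eq, subst Bochner_Integration.integral_sum)
    fix i :: 'a assume i: "i \<in> Basis"
    show "integrable lborel (\<lambda>x. w i x * (G x \<bullet> i) - N * (\<psi> x * (G x \<bullet> i)))"
      by (intro Bochner_Integration.integrable_diff integrable_mult_right i1 i)
  next
    show "(\<Sum>i\<in>Basis. \<integral>x. w i x * (G x \<bullet> i) - N * (\<psi> x * (G x \<bullet> i)) \<partial>lborel) =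
       (\<Sum>i\<in>Basis. (\<integral>x. w i x * (G x \<bullet> i) \<partial>lborel) - N * (\<integral>x. \<psi> x * (G x \<bullet> i) \<partial>lborel))"
      by (intro sum.cong refl) (simp add: i1)
  qed
  then have "- (\<integral>x. \<psi> x * (B x \<bullet> G x) \<partial>lborel) =
     (\<Sum>i\<in>Basis. N * (\<integral>x. \<psi> x * (G x \<bullet> i) \<partial>lborel) - (\<integral>x. w i x * (G x \<bullet> i) \<partial>lborel))"
    by (simp only: sum_negf[symmetric] minus_diff_eq)
  also have "\<dots> \<le> (\<Sum>i\<in>(Basis::'a set). (3 * N * Lc + L) * (\<integral>x. e x \<partial>lborel))"
  proof (rule sum_mono)
    fix i :: 'a assume i: "i \<in> Basis"
    have "(\<integral>x. \<psi> x * (G x \<bullet> i) \<partial>lborel) \<le> Lc * norm i * (\<integral>x. e x \<partial>lborel)"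
      by (rule weighted_grad_lipschitz) (use \<psi> in auto)
    from mult_left_mono[OF this nn(2)] have "N * (\<integral>x. \<psi> x * (G x \<bullet> i) \<partial>lborel) \<le> (N * Lc) * (\<integral>x. e x \<partial>lborel)"
      using i by (simp add: ac_simps)
    moreover have "(\<integral>x. w i x * (G x \<bullet> - i) \<partial>lborel) \<le> (2 * N * Lc + L) * norm (- i) * (\<integral>x. e x \<partial>lborel)"
      by (rule weighted_grad_lipschitz) (use w_bd wi wL i in auto)
    ultimately show "N * (\<integral>x. \<psi> x * (G x \<bullet> i) \<partial>lborel) - (\<integral>x. w i x * (G x \<bullet> i) \<partial>lborel)
       \<le> (3 * N * Lc + L) * (\<integral>x. e x \<partial>lborel)"
      using i by (simp add: algebra_simps)
  qed
  finally show "- (\<integral>x. \<psi> x * (B x \<bullet> G x) \<partial>lborel) \<le> real DIM('a) * (3 * N * Lc + L) * (\<integral>x. e x \<partial>lborel)"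
    by simp
qed

section \<open>Uniqueness of the invariant measure\<close>

text \<open>Jumps of length at most \<open>2 r\<close> connect the part of the ball where \<open>a\<close> exceeds the minimum with
  the part where \<open>b\<close> does; every such jump contributes to the defect.\<close>

lemma (in min_pair_levy) defect_lower:
  assumes r: "0 < r" "2 * r \<le> R" and c: "c > 0"
    and hc: "\<And>h. h \<in> borel_measurable borel \<Longrightarrow> ennreal c * (\<integral>\<^sup>+z. h z * indicator (cball 0 (2 * r)) z \<partial>lborel) \<le> (\<integral>\<^sup>+z. h z \<partial>\<nu>)"
    and di: "integrable \<nu> (defect (bump R))"
  shows "c / 2 * measure lborel (cball (0::'a) r) *
     min (\<integral>x. indicator (cball 0 r) x * (a x - e x) \<partial>lborel) (\<integral>x. indicator (cball 0 r) x * (b x - e x) \<partial>lborel)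
     \<le> (\<integral>z. defect (bump R) z \<partial>\<nu>)"
proof -
  have R: "R > 0" using r by linarith
  let ?I1 = "\<integral>x. indicator (cball 0 r) x * (a x - e x) \<partial>lborel"
  let ?I2 = "\<integral>x. indicator (cball 0 r) x * (b x - e x) \<partial>lborel"
  let ?V = "measure lborel (cball (0::'a) r)"
  have e_le: "e x \<le> a x" "e x \<le> b x" for x by (auto simp: e_def)
  have mn0: "0 \<le> min ?I1 ?I2"
    using e_le by (auto intro!: integral_nonneg_AE)
  have Di: "integrable lborel (\<lambda>y. indicator (cball 0 r) y * D x y)" for x
    by (rule integrable_mult_bounded(1)[OF cball_integrable, where K = M]) (use D_nonneg D_le in auto)
  have DI: "min ?I1 ?I2 \<le> (\<integral>y. indicator (cball 0 r) y * D x y \<partial>lborel)" for x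
    by (cases "a x \<le> b x") (simp_all add: D_def)
  have d0: "0 \<le> defect (bump R) z" for z by (rule defect_nonneg) (rule bump_nonneg)
  have dm: "defect (bump R) \<in> borel_measurable borel" using di by simp
  have dn: "ennreal (defect (bump R) z) = (\<integral>\<^sup>+x. ennreal (bump R x * D x (x - z)) \<partial>lborel)" for z
    unfolding defect_def
  proof (rule nn_integral_eq_integral[symmetric])
    show "integrable lborel (\<lambda>x. bump R x * D x (x - z))"
      by (rule integrable_mult_bounded(1)[OF bump_integrable[OF R], where K = M]) (use D_nonneg D_le in auto)
  qed (auto intro!: mult_nonneg_nonneg bump_nonneg D_nonneg)
  have "ennreal (c / 2 * ?V * min ?I1 ?I2) = ennreal c * (\<integral>\<^sup>+x. ennreal (1 / 2 * min ?I1 ?I2) * indicator (cball (0::'a) r) x \<partial>lborel)"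
  proof -
    have "(\<integral>\<^sup>+x. ennreal (1 / 2 * min ?I1 ?I2) * indicator (cball (0::'a) r) x \<partial>lborel) = ennreal (1 / 2 * min ?I1 ?I2) * ennreal ?V"
      using emeasure_bounded_finite[OF bounded_cball, of "0::'a" r]
      by (subst nn_integral_cmult_indicator) (auto simp: emeasure_eq_ennreal_measure)
    then show ?thesis using c mn0
      by (simp add: ennreal_mult'[symmetric] ac_simps measure_nonneg del: min_def)
  qed
  also have "\<dots> \<le> ennreal c * (\<integral>\<^sup>+x. (\<integral>\<^sup>+z. ennreal (bump R x * D x (x - z)) * indicator (cball 0 (2 * r)) z \<partial>lborel) \<partial>lborel)"
  proof (intro mult_left_mono nn_integral_mono)
    fix x :: 'a
    show "ennreal (1 / 2 * min ?I1 ?I2) * indicator (cball (0::'a) r) x \<le>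
       (\<integral>\<^sup>+z. ennreal (bump R x * D x (x - z)) * indicator (cball 0 (2 * r)) z \<partial>lborel)"
    proof (cases "norm x \<le> r")
      case True
      have "ennreal (1 / 2 * min ?I1 ?I2) \<le> ennreal (1 / 2 * (\<integral>y. indicator (cball 0 r) y * D x y \<partial>lborel))"
        using DI[of x] by (intro ennreal_leI) simp
      also have "\<dots> = (\<integral>\<^sup>+y. ennreal (1 / 2 * (indicator (cball 0 r) y * D x y)) \<partial>lborel)"
        using Di[of x] D_nonneg[of x]
        by (subst nn_integral_eq_integral) (auto intro!: integrable_mult_right)
      also have "\<dots> \<le> (\<integral>\<^sup>+y. ennreal (bump R x * D x y) * indicator (cball 0 (2 * r)) (x - y) \<partial>lborel)"
      proof (rule nn_integral_mono)
        fix y :: 'a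
        have "1 / 2 * D x y \<le> bump R x * D x y"
          using True r by (intro mult_right_mono bump_ge_half D_nonneg) auto
        moreover have "norm (x - y) \<le> 2 * r" if "norm y \<le> r"
          using norm_triangle_ineq4[of x y] that True by linarith
        ultimately show "ennreal (1 / 2 * (indicator (cball 0 r) y * D x y)) \<le> ennreal (bump R x * D x y) * indicator (cball 0 (2 * r)) (x - y)"
          by (auto simp: indicator_def intro!: ennreal_leI)
      qed
      also have "\<dots> = (\<integral>\<^sup>+z. ennreal (bump R x * D x (x - z)) * indicator (cball 0 (2 * r)) z \<partial>lborel)"
        using nn_integral_lborel_reflect[of "\<lambda>y. ennreal (bump R x * D x y) * indicator (cball 0 (2 * r)) (x - y)" x]
        by simp
      finally show ?thesis using True by simp
    qed simp
  qed simp
  also have "(\<integral>\<^sup>+x. (\<integral>\<^sup>+z. ennreal (bump R x * D x (x - z)) * indicator (cball 0 (2 * r)) z \<partial>lborel) \<partial>lborel) =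
     (\<integral>\<^sup>+z. (\<integral>\<^sup>+x. ennreal (bump R x * D x (x - z)) * indicator (cball 0 (2 * r)) z \<partial>lborel) \<partial>lborel)"
    by (rule lborel_pair.Fubini'[symmetric]) measurable
  also have "\<dots> = (\<integral>\<^sup>+z. ennreal (defect (bump R) z) * indicator (cball 0 (2 * r)) z \<partial>lborel)"
    unfolding dn by (intro nn_integral_cong nn_integral_multc) measurable
  also have "ennreal c * \<dots> \<le> (\<integral>\<^sup>+z. ennreal (defect (bump R) z) \<partial>\<nu>)"
    using dm by (intro hc) simp
  also have "\<dots> = ennreal (\<integral>z. defect (bump R) z \<partial>\<nu>)"
    using di d0 by (intro nn_integral_eq_integral) auto
  finally show ?thesis
    by (subst (asm) ennreal_le_iff) (auto intro!: integral_nonneg_AE d0)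
qed

lemma mol_min_pair:
  fixes y :: "'a::euclidean_space"
  assumes "\<epsilon> > 0"
  shows "min_pair (\<lambda>x. mol \<epsilon> (x - y)) (\<lambda>x. mol \<epsilon> (x - y)) (\<lambda>x. mol' \<epsilon> (x - y)) (\<lambda>x. mol' \<epsilon> (x - y))
     (1 / mol_mass \<epsilon> TYPE('a) * (11 / \<epsilon>\<^sup>2)) (max (1 / mol_mass \<epsilon> TYPE('a)) (1 / mol_mass \<epsilon> TYPE('a) * (4 / \<epsilon>)))"
proof
  show "mol \<epsilon> (x - y) \<le> max (1 / mol_mass \<epsilon> TYPE('a)) (1 / mol_mass \<epsilon> TYPE('a) * (4 / \<epsilon>))" for x
    using mol_le[OF assms, of "x - y"] by linarith
  show "norm (mol' \<epsilon> (x - y)) \<le> max (1 / mol_mass \<epsilon> TYPE('a)) (1 / mol_mass \<epsilon> TYPE('a) * (4 / \<epsilon>))" for x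
    using mol'_le[OF assms, of "x - y"] by linarith
  show "integrable lborel (\<lambda>x. mol \<epsilon> (x - y))"
    using integrable_lborel_translate[OF mol_integrable[OF assms], of "- y"] by simp
qed (use assms in \<open>simp_all only: mol_quad' mol_nonneg\<close>)

definition transport :: "('a::euclidean_space \<Rightarrow> 'a) \<Rightarrow> 'a measure \<Rightarrow> real \<Rightarrow> 'a \<Rightarrow> real" where
  "transport B n \<epsilon> x = (\<integral>y. B y \<bullet> mol' \<epsilon> (x - y) \<partial>n)"

locale drift =
  fixes B :: "'a::euclidean_space \<Rightarrow> 'a" and R L N :: real
  assumes B_cont: "continuous_on UNIV B"
    and B_lip: "\<And>x y. norm x \<le> R + 1 \<Longrightarrow> norm y \<le> R + 1 \<Longrightarrow> norm (B x - B y) \<le> L * norm (x - y)"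
    and B_bd: "\<And>x. norm x \<le> R + 1 \<Longrightarrow> norm (B x) \<le> N"
    and R1: "R \<ge> 1" and L0: "L \<ge> 0"
begin

lemma B_meas [measurable]: "B \<in> borel_measurable borel"
  by (intro borel_measurable_continuous_onI B_cont)

lemma N0: "N \<ge> 0" using B_bd[of 0] R1 norm_ge_zero[of "B 0"] by (simp del: norm_ge_zero)

lemma near:
  assumes "norm x \<le> R" "0 < \<epsilon>" "\<epsilon> \<le> 1" "\<not> norm y \<le> R + 1"
  shows "mol' \<epsilon> (x - y) = 0"
proof (rule mol'_eq_0[OF assms(2)])
  have "norm y \<le> norm x + norm (x - y)" using norm_triangle_sub[of y x] by (simp add: norm_minus_commute)
  then show "\<epsilon> \<le> norm (x - y)" using assms by linarith
qed

lemma transport_integrand: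
  assumes "norm x \<le> R" "0 < \<epsilon>" "\<epsilon> \<le> 1"
  shows "\<bar>B y \<bullet> mol' \<epsilon> (x - y)\<bar> \<le> N * (1 / mol_mass \<epsilon> TYPE('a) * (4 / \<epsilon>))"
proof (cases "norm y \<le> R + 1")
  case True
  have "\<bar>B y \<bullet> mol' \<epsilon> (x - y)\<bar> \<le> norm (B y) * norm (mol' \<epsilon> (x - y))" by (rule Cauchy_Schwarz_ineq2)
  also have "\<dots> \<le> N * (1 / mol_mass \<epsilon> TYPE('a) * (4 / \<epsilon>))"
    using mol'_le[OF assms(2), of "x - y"] B_bd[OF True] N0 by (intro mult_mono) auto
  finally show ?thesis .
next
  case False
  then show ?thesis using near[OF assms False] N0 assms mol_mass_pos[OF assms(2), where 'a='a] by simp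
qed

lemma commutator_bound:
  assumes n: "finite_borel n" and x: "norm x \<le> R" and \<epsilon>: "0 < \<epsilon>" "\<epsilon> \<le> 1" and \<eta>: "\<eta> > 0"
  shows "B x \<bullet> conv n (mol' \<epsilon>) x - transport B n \<epsilon> x \<le>
     L * (2 / \<eta> * conv n (mol \<epsilon>) x + 2 * \<eta> * conv n (\<lambda>w. indicator (cball 0 \<epsilon>) w / mol_mass \<epsilon> TYPE('a)) x)"
proof -
  interpret n: finite_borel n by fact
  let ?Z = "mol_mass \<epsilon> TYPE('a)"
  have Z: "?Z > 0" using mol_mass_pos[OF \<epsilon>(1)] .
  have i1: "integrable n (\<lambda>y. mol' \<epsilon> (x - y))"
    by (rule n.integrable_bounded[where K = "1 / ?Z * (4 / \<epsilon>)"]) (simp, rule mol'_le[OF \<epsilon>(1)])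
  have i2: "integrable n (\<lambda>y. B y \<bullet> mol' \<epsilon> (x - y))"
    by (rule n.integrable_bounded[where K = "N * (1 / ?Z * (4 / \<epsilon>))"]) (simp, use transport_integrand[OF x \<epsilon>] in simp)
  have i3: "integrable n (\<lambda>y. mol \<epsilon> (x - y))"
    by (rule n.integrable_bounded[where K = "1 / ?Z"]) (simp, simp only: real_norm_def abs_of_nonneg[OF mol_nonneg[OF \<epsilon>(1)]] mol_le[OF \<epsilon>(1)])
  have i4: "integrable n (\<lambda>y. indicator (cball 0 \<epsilon>) (x - y) / ?Z)"
    by (rule n.integrable_bounded[where K = "1 / ?Z"]) (use Z in \<open>auto simp: indicator_def\<close>)
  have "B x \<bullet> conv n (mol' \<epsilon>) x - transport B n \<epsilon> x = (\<integral>y. B x \<bullet> mol' \<epsilon> (x - y) - B y \<bullet> mol' \<epsilon> (x - y) \<partial>n)"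
    unfolding conv_def transport_def using i1 i2 by simp
  also have "\<dots> \<le> (\<integral>y. L * (2 / \<eta> * mol \<epsilon> (x - y) + 2 * \<eta> * (indicator (cball 0 \<epsilon>) (x - y) / ?Z)) \<partial>n)"
  proof (intro integral_mono integrable_mult_right Bochner_Integration.integrable_add Bochner_Integration.integrable_diff i2 i3 i4)
    show "integrable n (\<lambda>y. B x \<bullet> mol' \<epsilon> (x - y))" using i1 by simp
    fix y
    let ?RHS = "2 / \<eta> * mol \<epsilon> (x - y) + 2 * \<eta> * (indicator (cball 0 \<epsilon>) (x - y) / ?Z)"
    show "B x \<bullet> mol' \<epsilon> (x - y) - B y \<bullet> mol' \<epsilon> (x - y) \<le> L * ?RHS"
    proof (cases "norm y \<le> R + 1")
      case True
      have "B x \<bullet> mol' \<epsilon> (x - y) - B y \<bullet> mol' \<epsilon> (x - y) \<le> norm (B x - B y) * norm (mol' \<epsilon> (x - y))"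
        unfolding inner_diff_left[symmetric] by (rule norm_cauchy_schwarz)
      also have "\<dots> \<le> (L * norm (x - y)) * norm (mol' \<epsilon> (x - y))"
        using B_lip[of x y] True x by (intro mult_right_mono) auto
      also have "\<dots> \<le> L * ?RHS"
        unfolding mult.assoc using L0 mol'_commutator[OF \<epsilon>(1) \<eta>, of "x - y"] by (intro mult_left_mono) auto
      finally show ?thesis .
    next
      case False
      have "0 \<le> L * ?RHS"
        using L0 \<eta> Z mol_nonneg[OF \<epsilon>(1)] by (intro mult_nonneg_nonneg add_nonneg_nonneg) auto
      then show ?thesis using near[OF x \<epsilon> False] by simp
    qed
  qed
  also have "\<dots> = L * (2 / \<eta> * conv n (mol \<epsilon>) x + 2 * \<eta> * conv n (\<lambda>w. indicator (cball 0 \<epsilon>) w / ?Z) x)"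
    unfolding conv_def by (simp only: integral_mult_right_zero
        Bochner_Integration.integral_add[OF integrable_mult_right[OF i3] integrable_mult_right[OF i4]])
  finally show ?thesis .
qed

lemma transport_integrated:
  assumes n: "finite_borel n" and \<epsilon>: "0 < \<epsilon>" "\<epsilon> \<le> 1"
  shows "integrable lborel (\<lambda>x. bump R x * transport B n \<epsilon> x)"
    and "(\<integral>x. bump R x * transport B n \<epsilon> x \<partial>lborel) \<le>
      - (\<integral>y. B y \<bullet> bump' R y \<partial>n) + N * (66 / R\<^sup>2) * \<epsilon> * measure n UNIV"
proof -
  interpret n: finite_borel n by fact
  let ?Z = "mol_mass \<epsilon> TYPE('a)"
  let ?K = "N * (1 / ?Z * (4 / \<epsilon>))"
  have R: "R > 0" using R1 by simp
  have bd: "\<bar>bump R x * (B y \<bullet> mol' \<epsilon> (x - y))\<bar> \<le> bump R x * ?K" for x y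
  proof (cases "norm x \<le> R")
    case True
    then show ?thesis unfolding abs_mult abs_of_nonneg[OF bump_nonneg]
      by (intro mult_left_mono transport_integrand \<epsilon> bump_nonneg)
  next
    case False
    then show ?thesis using bump_eq_0[OF R, of x] by simp
  qed
  have mm: "(\<lambda>(x, y). bump R x * (B y \<bullet> mol' \<epsilon> (x - y))) \<in> borel_measurable (lborel \<Otimes>\<^sub>M n)" by measurable
  note F = Fubini_dominated[OF sigma_finite_lborel n.sigma_finite_measure_axioms mm bump_integrable[OF R] n.integrable_const bd]
  have T: "(\<integral>y. bump R x * (B y \<bullet> mol' \<epsilon> (x - y)) \<partial>n) = bump R x * transport B n \<epsilon> x" for x
    unfolding transport_def by simp
  show "integrable lborel (\<lambda>x. bump R x * transport B n \<epsilon> x)" using F(2) unfolding T .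
  have inner: "(\<integral>x. bump R x * (B y \<bullet> mol' \<epsilon> (x - y)) \<partial>lborel) \<le> - (B y \<bullet> bump' R y) + N * (66 / R\<^sup>2) * \<epsilon>" for y
  proof -
    interpret p: min_pair "\<lambda>x. mol \<epsilon> (x - y)" "\<lambda>x. mol \<epsilon> (x - y)" "\<lambda>x. mol' \<epsilon> (x - y)" "\<lambda>x. mol' \<epsilon> (x - y)"
       "1 / ?Z * (11 / \<epsilon>\<^sup>2)" "max (1 / ?Z) (1 / ?Z * (4 / \<epsilon>))" by (rule mol_min_pair[OF \<epsilon>(1)])
    have G: "p.G x = mol' \<epsilon> (x - y)" and e: "p.e x = mol \<epsilon> (x - y)" for x by (simp_all add: p.G_def p.e_def)
    have mi: "integrable lborel (\<lambda>x. mol \<epsilon> (x - y))" by (rule p.a_int)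
    have mI: "(\<integral>x. mol \<epsilon> (x - y) \<partial>lborel) = 1"
      using integral_lborel_translate[of "mol \<epsilon>" "- y"] mol_integral[OF \<epsilon>(1), where 'a='a] by simp
    have "(\<integral>x. bump R x * (B y \<bullet> mol' \<epsilon> (x - y)) \<partial>lborel) = - (\<integral>x. mol \<epsilon> (x - y) * (bump' R x \<bullet> B y) \<partial>lborel)"
      using p.weighted_grad_parts[OF bump_nonneg bump_integrable[OF R] quad_approx_bump[OF R] norm_bump'_le[OF R], of "B y"]
      unfolding G e by (simp add: inner_commute)
    also have "\<dots> = (\<integral>x. mol \<epsilon> (x - y) * (- (bump' R x \<bullet> B y)) \<partial>lborel)" by simp
    also have "\<dots> \<le> (\<integral>x. mol \<epsilon> (x - y) * (- (B y \<bullet> bump' R y) + N * (66 / R\<^sup>2) * \<epsilon>) \<partial>lborel)"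
    proof (rule integral_mono)
      show "integrable lborel (\<lambda>x. mol \<epsilon> (x - y) * (- (bump' R x \<bullet> B y)))"
      proof (rule integrable_mult_bounded(1)[OF mi])
        show "\<bar>- (bump' R x \<bullet> B y)\<bar> \<le> 4 / R * norm (B y)" for x
          using Cauchy_Schwarz_ineq2[of "bump' R x" "B y"] mult_right_mono[OF norm_bump'_le[OF R, of x] norm_ge_zero[of "B y"]] by simp
      qed simp
      show "integrable lborel (\<lambda>x. mol \<epsilon> (x - y) * (- (B y \<bullet> bump' R y) + N * (66 / R\<^sup>2) * \<epsilon>))"
        by (intro integrable_mult_left mi)
      fix x
      show "mol \<epsilon> (x - y) * (- (bump' R x \<bullet> B y)) \<le> mol \<epsilon> (x - y) * (- (B y \<bullet> bump' R y) + N * (66 / R\<^sup>2) * \<epsilon>)"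
      proof (cases "norm (x - y) \<le> \<epsilon>")
        case near: True
        have "(bump' R y - bump' R x) \<bullet> B y \<le> N * (66 / R\<^sup>2) * \<epsilon>"
        proof (cases "norm y \<le> R + 1")
          case True
          have "(bump' R y - bump' R x) \<bullet> B y \<le> norm (bump' R y - bump' R x) * norm (B y)" by (rule norm_cauchy_schwarz)
          also have "\<dots> \<le> (6 * (11 / R\<^sup>2) * \<epsilon>) * N"
          proof (intro mult_mono B_bd True)
            have "norm (bump' R y - bump' R x) \<le> 6 * (11 / R\<^sup>2) * norm (y - x)"
              by (rule quad_approx_grad_lipschitz[OF quad_approx_bump[OF R]])
            also have "\<dots> \<le> 6 * (11 / R\<^sup>2) * \<epsilon>" using near by (intro mult_left_mono) (auto simp: norm_minus_commute)
            finally show "norm (bump' R y - bump' R x) \<le> 6 * (11 / R\<^sup>2) * \<epsilon>" .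
          qed (use \<epsilon> in auto)
          finally show ?thesis by (simp add: ac_simps)
        next
          case False
          have "norm y \<le> norm x + norm (x - y)" using norm_triangle_sub[of y x] by (simp add: norm_minus_commute)
          then have "R \<le> norm x" "R \<le> norm y" using False near \<epsilon> by linarith+
          then show ?thesis using bump'_eq_0[OF R, of x] bump'_eq_0[OF R, of y] N0 \<epsilon> by simp
        qed
        then have "- (bump' R x \<bullet> B y) \<le> - (B y \<bullet> bump' R y) + N * (66 / R\<^sup>2) * \<epsilon>"
          by (simp add: inner_diff_right inner_commute[of _ "B y"])
        then show ?thesis by (intro mult_left_mono mol_nonneg \<epsilon>)
      next
        case False
        then show ?thesis using mol_eq_0[OF \<epsilon>(1), of "x - y"] by simp
      qed
    qed
    also have "\<dots> = - (B y \<bullet> bump' R y) + N * (66 / R\<^sup>2) * \<epsilon>" using mI by simp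
    finally show ?thesis .
  qed
  have i: "integrable n (\<lambda>y. B y \<bullet> bump' R y)"
  proof (rule n.integrable_bounded[where K = "N * (4 / R)"])
    show "norm (B y \<bullet> bump' R y) \<le> N * (4 / R)" for y
    proof (cases "norm y \<le> R + 1")
      case True
      show ?thesis using Cauchy_Schwarz_ineq2[of "B y" "bump' R y"] mult_mono[OF B_bd[OF True] norm_bump'_le[OF R, of y] N0] by simp
    qed (use bump'_eq_0[OF R, of y] N0 R in simp)
  qed simp
  have "(\<integral>x. bump R x * transport B n \<epsilon> x \<partial>lborel) = (\<integral>y. (\<integral>x. bump R x * (B y \<bullet> mol' \<epsilon> (x - y)) \<partial>lborel) \<partial>n)"
    using F(1) unfolding T .
  also have "\<dots> \<le> (\<integral>y. - (B y \<bullet> bump' R y) + N * (66 / R\<^sup>2) * \<epsilon> \<partial>n)"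
    by (intro integral_mono F(3) inner Bochner_Integration.integrable_add n.integrable_const Bochner_Integration.integrable_minus i)
  also have "\<dots> = - (\<integral>y. B y \<bullet> bump' R y \<partial>n) + N * (66 / R\<^sup>2) * \<epsilon> * measure n UNIV"
    using i n.integral_const_n[of "N * (66 / R\<^sup>2) * \<epsilon>"] n.integrable_const[of "N * (66 / R\<^sup>2) * \<epsilon>"]
    by (subst Bochner_Integration.integral_add) (auto simp: n.mass_def)
  finally show "(\<integral>x. bump R x * transport B n \<epsilon> x \<partial>lborel) \<le>
      - (\<integral>y. B y \<bullet> bump' R y \<partial>n) + N * (66 / R\<^sup>2) * \<epsilon> * measure n UNIV" .
qed

end

definition generator :: "'a::euclidean_space measure \<Rightarrow> ('a \<Rightarrow> 'a) \<Rightarrow> real \<Rightarrow> 'a \<Rightarrow> 'a \<Rightarrow> real" where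
  "generator \<nu> B \<epsilon> x y = B y \<bullet> bump' \<epsilon> (y - x) - nonlocal \<nu> UNIV y (\<lambda>w. bump \<epsilon> (w - x)) (bump' \<epsilon> (y - x))"

context levy
begin

lemma incr_mol_bound:
  assumes "\<epsilon> > 0"
  shows "\<bar>incr (mol \<epsilon>) (mol' \<epsilon> (x::'a)) x z\<bar> \<le> max (1 / mol_mass \<epsilon> TYPE('a) * (11 / \<epsilon>\<^sup>2)) (2 * (1 / mol_mass \<epsilon> TYPE('a))) * min ((norm z)\<^sup>2) (norm z)"
proof (rule incr_bound_bounded)
  show "\<bar>mol \<epsilon> (x + h) - mol \<epsilon> x - mol' \<epsilon> x \<bullet> h\<bar> \<le> 1 / mol_mass \<epsilon> TYPE('a) * (11 / \<epsilon>\<^sup>2) * (norm h)\<^sup>2" for h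
    by (rule quad_approxD[OF mol_quad[OF assms]])
  show "\<bar>mol \<epsilon> x\<bar> \<le> 1 / mol_mass \<epsilon> TYPE('a)" for x :: 'a
    using mol_nonneg[OF assms, of x] mol_le[OF assms, of x] by simp
qed

lemma nonlocal_bump:
  assumes "\<epsilon> > 0"
  shows "nonlocal \<nu> UNIV y (\<lambda>w. bump \<epsilon> (w - x)) (bump' \<epsilon> (y - x)) =
    mol_mass \<epsilon> TYPE('a) * (\<integral>z. incr (mol \<epsilon>) (mol' \<epsilon> (x - y)) (x - y) (- z) \<partial>\<nu>)"
proof -
  have Z: "mol_mass \<epsilon> TYPE('a) > 0" using mol_mass_pos[OF assms] .
  have r: "bump \<epsilon> (u - v) = bump \<epsilon> (v - u)" "bump' \<epsilon> (u - v) = - bump' \<epsilon> (v - u)" for u v :: 'a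
    using bump_minus[of \<epsilon> "v - u"] bump'_minus[of \<epsilon> "v - u"] by simp_all
  have "incr (\<lambda>w. bump \<epsilon> (w - x)) (bump' \<epsilon> (y - x)) y z = mol_mass \<epsilon> TYPE('a) * incr (mol \<epsilon>) (mol' \<epsilon> (x - y)) (x - y) (- z)" for z
    using Z r(1)[of "y + z" x] r(1)[of y x] r(2)[of y x]
    by (simp add: incr_def mol_def mol'_def field_simps indicator_def)
  then show ?thesis unfolding nonlocal_UNIV
    by (subst integral_mult_right_zero[symmetric]) (intro Bochner_Integration.integral_cong refl)
qed

lemma conv_incr:
  assumes n: "finite_borel n" and \<epsilon>: "\<epsilon> > 0"
  shows "(\<integral>z. incr (conv n (mol \<epsilon>)) (conv n (mol' \<epsilon>) x) x (- z) \<partial>\<nu>) =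
     (\<integral>y. (\<integral>z. incr (mol \<epsilon>) (mol' \<epsilon> (x - y)) (x - y) (- z) \<partial>\<nu>) \<partial>n)"
    and "integrable n (\<lambda>y. \<integral>z. incr (mol \<epsilon>) (mol' \<epsilon> (x - y)) (x - y) (- z) \<partial>\<nu>)"
proof -
  interpret n: finite_borel n by fact
  let ?Z = "mol_mass \<epsilon> TYPE('a)"
  let ?K = "max (1 / ?Z * (11 / \<epsilon>\<^sup>2)) (2 * (1 / ?Z))"
  let ?f = "\<lambda>y z. incr (mol \<epsilon>) (mol' \<epsilon> (x - y)) (x - y) (- z)"
  have bd: "\<bar>?f y z\<bar> \<le> ?K * min ((norm z)\<^sup>2) (norm z)" for y z
    using incr_mol_bound[OF \<epsilon>, of "x - y" "- z"] by simp
  have bd': "\<bar>?f y z\<bar> \<le> 1 * (?K * min ((norm z)\<^sup>2) (norm z))" for y z using bd by simp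
  have mm: "case_prod ?f \<in> borel_measurable (n \<Otimes>\<^sub>M \<nu>)" unfolding incr_def by measurable
  note F = Fubini_dominated[OF n.sigma_finite_measure_axioms sigma_finite_nu mm n.integrable_const integrable_mult_right[OF integrable_nu] bd']
  have i1: "integrable n (\<lambda>y. mol' \<epsilon> (z - y))" for z
    by (rule n.integrable_bounded[where K = "1 / ?Z * (4 / \<epsilon>)"]) (simp, rule mol'_le[OF \<epsilon>(1)])
  have i3: "integrable n (\<lambda>y. mol \<epsilon> (z - y))" for z
    by (rule n.integrable_bounded[where K = "1 / ?Z"]) (simp, simp only: real_norm_def abs_of_nonneg[OF mol_nonneg[OF \<epsilon>(1)]] mol_le[OF \<epsilon>(1)])
  have "incr (conv n (mol \<epsilon>)) (conv n (mol' \<epsilon>) x) x (- z) = (\<integral>y. ?f y z \<partial>n)" for z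
  proof -
    have "(\<integral>y. ?f y z \<partial>n) = (\<integral>y. mol \<epsilon> ((x - z) - y) - mol \<epsilon> (x - y) - (mol' \<epsilon> (x - y) \<bullet> (- z)) * indicator {z. norm z \<le> 1} (- z) \<partial>n)"
      by (intro Bochner_Integration.integral_cong) (simp_all add: incr_def algebra_simps)
    also have "\<dots> = incr (conv n (mol \<epsilon>)) (conv n (mol' \<epsilon>) x) x (- z)"
      unfolding incr_def conv_def using i1[of x] i3[of x] i3[of "x - z"] by simp
    finally show ?thesis by simp
  qed
  then show "(\<integral>z. incr (conv n (mol \<epsilon>)) (conv n (mol' \<epsilon>) x) x (- z) \<partial>\<nu>) = (\<integral>y. (\<integral>z. ?f y z \<partial>\<nu>) \<partial>n)"
    using F(1) by simp
  show "integrable n (\<lambda>y. \<integral>z. ?f y z \<partial>\<nu>)" by (rule F(2))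
qed

lemma generator_bump_regular:
  assumes B: "continuous_on UNIV B" and \<epsilon>: "\<epsilon> > 0"
  shows "continuous_on UNIV (generator \<nu> B \<epsilon> x)" and "bounded (range (generator \<nu> B \<epsilon> x))"
proof -
  have q: "quad_approx_loc (\<lambda>w. bump \<epsilon> (w - x)) (\<lambda>w. bump' \<epsilon> (w - x))"
    by (rule quad_approx_imp_loc[OF quad_approx_translate[OF quad_approx_bump[OF \<epsilon>]]])
  have bb: "bounded (range (\<lambda>w. bump \<epsilon> (w - x)))"
    unfolding bounded_iff by (intro exI[of _ 1]) (auto simp: bump_nonneg bump_le_1)
  have cb: "continuous_on S (\<lambda>y. B y \<bullet> bump' \<epsilon> (y - x))" for S
    using continuous_on_subset[OF quad_approx_loc_grad_continuous[OF q]] continuous_on_subset[OF B]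
    by (intro continuous_on_inner) auto
  then show "continuous_on UNIV (generator \<nu> B \<epsilon> x)"
    unfolding generator_def[abs_def] by (intro continuous_on_diff nonlocal_continuous[OF q bb])
  have "bounded ((\<lambda>y. B y \<bullet> bump' \<epsilon> (y - x)) ` cball x \<epsilon>)"
    by (intro compact_imp_bounded compact_continuous_image cb) auto
  then obtain K where K: "\<And>y. y \<in> cball x \<epsilon> \<Longrightarrow> \<bar>B y \<bullet> bump' \<epsilon> (y - x)\<bar> \<le> K" unfolding bounded_iff by force
  have K': "\<bar>B y \<bullet> bump' \<epsilon> (y - x)\<bar> \<le> \<bar>K\<bar>" for y
  proof (cases "y \<in> cball x \<epsilon>")
    case False
    then have "bump' \<epsilon> (y - x) = 0" by (intro bump'_eq_0 \<epsilon>) (simp add: dist_norm norm_minus_commute)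
    then show ?thesis by simp
  qed (use K in force)
  let ?K2 = "max (1 / mol_mass \<epsilon> TYPE('a) * (11 / \<epsilon>\<^sup>2)) (2 * (1 / mol_mass \<epsilon> TYPE('a)))"
  have "\<bar>\<integral>z. incr (mol \<epsilon>) (mol' \<epsilon> (x - y)) (x - y) (- z) \<partial>\<nu>\<bar> \<le> ?K2 * mom" for y
    by (rule integral_dominated) (use incr_mol_bound[OF \<epsilon>, of "x - y" "- z" for z] in auto)
  from mult_left_mono[OF this, of "mol_mass \<epsilon> TYPE('a)"]
  have "\<bar>nonlocal \<nu> UNIV y (\<lambda>w. bump \<epsilon> (w - x)) (bump' \<epsilon> (y - x))\<bar> \<le> mol_mass \<epsilon> TYPE('a) * (?K2 * mom)" for y
    unfolding nonlocal_bump[OF \<epsilon>] abs_mult using mol_mass_pos[OF \<epsilon>, where 'a='a] by simp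
  note nl = this
  have "\<bar>generator \<nu> B \<epsilon> x y\<bar> \<le> \<bar>K\<bar> + mol_mass \<epsilon> TYPE('a) * (?K2 * mom)" for y
    unfolding generator_def by (rule order_trans[OF abs_triangle_ineq4 add_mono[OF K' nl]])
  then show "bounded (range (generator \<nu> B \<epsilon> x))" unfolding bounded_iff by auto
qed

lemma generator_integral:
  assumes n: "finite_borel n" and \<epsilon>: "\<epsilon> > 0" and B: "continuous_on UNIV B"
  shows "(\<integral>y. generator \<nu> B \<epsilon> x y \<partial>n) = - mol_mass \<epsilon> TYPE('a) *
    (transport B n \<epsilon> x + (\<integral>z. incr (conv n (mol \<epsilon>)) (conv n (mol' \<epsilon>) x) x (- z) \<partial>\<nu>))"
proof -
  interpret n: finite_borel n by fact
  let ?Z = "mol_mass \<epsilon> TYPE('a)"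
  let ?g = "\<lambda>y. \<integral>z. incr (mol \<epsilon>) (mol' \<epsilon> (x - y)) (x - y) (- z) \<partial>\<nu>"
  have Z: "?Z > 0" using mol_mass_pos[OF \<epsilon>] .
  have r: "bump' \<epsilon> (y - x) = - (?Z *\<^sub>R mol' \<epsilon> (x - y))" for y :: 'a
    using bump'_minus[of \<epsilon> "x - y"] Z by (simp add: mol'_def)
  have g: "generator \<nu> B \<epsilon> x y = - ?Z * (B y \<bullet> mol' \<epsilon> (x - y)) - ?Z * ?g y" for y
    unfolding generator_def nonlocal_bump[OF \<epsilon>] unfolding r by simp
  have gi: "integrable n (generator \<nu> B \<epsilon> x)"
  proof -
    obtain K where K: "\<And>y. \<bar>generator \<nu> B \<epsilon> x y\<bar> \<le> K"
      using generator_bump_regular(2)[OF B \<epsilon>, of x] unfolding bounded_iff by auto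
    then show ?thesis using generator_bump_regular(1)[OF B \<epsilon>, of x]
      by (intro n.integrable_bounded[where K = K]) (auto intro: borel_measurable_continuous_onI)
  qed
  have ig: "integrable n (\<lambda>y. ?Z * ?g y)" by (intro integrable_mult_right conv_incr(2)[OF n \<epsilon>])
  have "integrable n (\<lambda>y. (- 1 / ?Z) * (generator \<nu> B \<epsilon> x y + ?Z * ?g y))"
    by (intro integrable_mult_right Bochner_Integration.integrable_add gi ig)
  then have iB: "integrable n (\<lambda>y. B y \<bullet> mol' \<epsilon> (x - y))" unfolding g using Z by simp
  show ?thesis
    unfolding g transport_def conv_incr(1)[OF n \<epsilon>] using iB ig by (simp add: algebra_simps)
qed

lemma incr_bump_bound:
  assumes "R \<ge> 1"
  shows "\<bar>incr (bump R) (bump' R x) x z\<bar> \<le> 11 / R * min ((norm z)\<^sup>2) (norm z)"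
proof -
  have R: "R > 0" using assms by simp
  have "11 / R\<^sup>2 \<le> 11 / R" using assms self_le_power[of R 2] by (intro divide_left_mono) auto
  moreover have "4 / R \<le> 11 / R" using R by (intro divide_right_mono) auto
  ultimately have m: "max (11 / R\<^sup>2) (4 / R) \<le> 11 / R" by simp
  have "\<bar>incr (bump R) (bump' R x) x z\<bar> \<le> max (11 / R\<^sup>2) (4 / R) * min ((norm z)\<^sup>2) (norm z)"
  proof (rule incr_bound)
    show "\<bar>bump R (x + h) - bump R x - bump' R x \<bullet> h\<bar> \<le> 11 / R\<^sup>2 * (norm h)\<^sup>2" for h
      by (rule quad_approxD[OF quad_approx_bump[OF R]])
    show "\<bar>bump R (x + h) - bump R x\<bar> \<le> 4 / R * norm h" for h
      using bump_lipschitz[OF R, of "x + h" x] by simp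
  qed
  also have "\<dots> \<le> 11 / R * min ((norm z)\<^sup>2) (norm z)" using m by (intro mult_right_mono) auto
  finally show ?thesis .
qed

end

lemma quad_approx_mono:
  assumes "quad_approx C f f'" "C \<le> C'"
  shows "quad_approx C' f f'"
  unfolding quad_approx_def
proof (intro allI)
  fix x h
  show "\<bar>f (x + h) - f x - f' x \<bullet> h\<bar> \<le> C' * (norm h)\<^sup>2"
    using quad_approxD[OF assms(1), of x h] mult_right_mono[OF assms(2) zero_le_power2[of "norm h"]] by linarith
qed

lemma conv_mol_min_pair:
  fixes n1 n2 :: "'a::euclidean_space measure"
  assumes n1: "finite_borel n1" and n2: "finite_borel n2" and \<epsilon>: "\<epsilon> > 0"
  obtains C M where "min_pair (conv n1 (mol \<epsilon>)) (conv n2 (mol \<epsilon>)) (conv n1 (mol' \<epsilon>)) (conv n2 (mol' \<epsilon>)) C M"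
    "min_pair (conv n1 (mol \<epsilon>)) (conv n1 (mol \<epsilon>)) (conv n1 (mol' \<epsilon>)) (conv n1 (mol' \<epsilon>)) C M"
proof -
  let ?Z = "mol_mass \<epsilon> TYPE('a)"
  let ?K = "1 / ?Z" let ?K' = "1 / ?Z * (4 / \<epsilon>)" let ?C = "1 / ?Z * (11 / \<epsilon>\<^sup>2)"
  define C where "C = ?C * measure n1 UNIV + ?C * measure n2 UNIV"
  define M where "M = (?K + ?K') * measure n1 UNIV + (?K + ?K') * measure n2 UNIV"
  have Z: "?Z > 0" using mol_mass_pos[OF \<epsilon>] .
  have one: "quad_approx C (conv n (mol \<epsilon>)) (conv n (mol' \<epsilon>)) \<and> (\<forall>x. 0 \<le> conv n (mol \<epsilon>) x \<and> conv n (mol \<epsilon>) x \<le> M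
     \<and> norm (conv n (mol' \<epsilon>) x) \<le> M) \<and> integrable lborel (conv n (mol \<epsilon>))" if n: "n = n1 \<or> n = n2" for n
  proof -
    have fb: "finite_borel n" using n n1 n2 by auto
    interpret n: finite_borel n by (rule fb)
    have mono: "c * n.mass \<le> c * measure n1 UNIV + c * measure n2 UNIV" if c: "c \<ge> 0" for c
    proof -
      have "0 \<le> c * measure n1 UNIV" "0 \<le> c * measure n2 UNIV" using c by simp_all
      with n show ?thesis unfolding n.mass_def by (elim disjE) simp_all
    qed
    have mb: "\<bar>mol \<epsilon> (x::'a)\<bar> \<le> ?K" for x using mol_le[OF \<epsilon>, of x] mol_nonneg[OF \<epsilon>, of x] by simp
    have K: "0 \<le> ?K" "0 \<le> ?K'" using Z \<epsilon> by simp_all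
    have mb': "norm (mol \<epsilon> (x::'a)) \<le> ?K + ?K'" for x using mb[of x] K unfolding real_norm_def by linarith
    have mb'': "norm (mol' \<epsilon> (x::'a)) \<le> ?K + ?K'" for x using mol'_le[OF \<epsilon>, of x] K by linarith
    have q: "quad_approx C (conv n (mol \<epsilon>)) (conv n (mol' \<epsilon>))"
    proof (rule quad_approx_mono)
      show "quad_approx (?C * n.mass) (conv n (mol \<epsilon>)) (conv n (mol' \<epsilon>))"
        by (rule n.conv_quad[OF mol_quad[OF \<epsilon>] _ _ mb mol'_le[OF \<epsilon>]]) auto
      show "?C * n.mass \<le> C" unfolding C_def using Z by (intro mono) auto
    qed
    have M: "(?K + ?K') * n.mass \<le> M" unfolding M_def using Z \<epsilon> by (intro mono) auto
    have "norm (conv n (mol \<epsilon>) x) \<le> (?K + ?K') * n.mass" "norm (conv n (mol' \<epsilon>) x) \<le> (?K + ?K') * n.mass" for x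
      by (rule n.conv_norm_le[OF _ mb'] n.conv_norm_le[OF _ mb''], simp)+
    note nb = order_trans[OF this(1) M] order_trans[OF this(2) M]
    have "conv n (mol \<epsilon>) x \<le> M" for x using nb(1)[of x] by simp
    moreover have "0 \<le> conv n (mol \<epsilon>) x" for x by (rule n.conv_nonneg[OF mol_nonneg[OF \<epsilon>]])
    ultimately show ?thesis using q nb(2) n.conv_integral(1)[OF mol_integrable[OF \<epsilon>]] by simp
  qed
  show ?thesis
    using one[of n1] one[of n2] by (intro that[of C M] min_pair.intro) simp_all
qed

lemma ball_mass_le_conv:
  fixes n :: "'a::euclidean_space measure"
  assumes n: "finite_borel n" and \<epsilon>: "0 < \<epsilon>" "\<epsilon> \<le> 1"
  shows "measure n (cball 0 (r - 1)) \<le> (\<integral>x. indicator (cball 0 r) x * conv n (mol \<epsilon>) x \<partial>lborel)"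
proof -
  interpret n: finite_borel n by fact
  let ?h = "indicator (cball 0 (r - 1)) :: 'a \<Rightarrow> real"
  have h: "?h \<in> borel_measurable borel" "\<bar>?h y\<bar> \<le> 1" for y by (auto simp: indicator_def)
  note i = mol_integrable[OF \<epsilon>(1)]
  have mb: "norm (mol \<epsilon> (x::'a)) \<le> 1 / mol_mass \<epsilon> TYPE('a)" for x
    using mol_le[OF \<epsilon>(1), of x] mol_nonneg[OF \<epsilon>(1), of x] by simp
  have i1: "integrable n (\<lambda>y. mol \<epsilon> (x - y))" for x
    by (rule n.integrable_bounded[OF _ mb]) simp
  have "measure n (cball 0 (r - 1)) = (\<integral>x. (\<integral>y. mol \<epsilon> (x - y) * ?h y \<partial>n) \<partial>lborel)"
    using n.conv_weighted(2)[OF i h] by (simp only: mol_integral[OF \<epsilon>(1)]) simp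
  also have "\<dots> \<le> (\<integral>x. indicator (cball 0 r) x * conv n (mol \<epsilon>) x \<partial>lborel)"
  proof (rule integral_mono[OF n.conv_weighted(1)[OF i h]])
    show "integrable lborel (\<lambda>x. indicator (cball 0 r) x * conv n (mol \<epsilon>) x)"
      by (rule integrable_mult_bounded(2)[OF n.conv_integral(1)[OF i], where K = 1]) (auto simp: indicator_def)
    fix x
    show "(\<integral>y. mol \<epsilon> (x - y) * ?h y \<partial>n) \<le> indicator (cball 0 r) x * conv n (mol \<epsilon>) x"
    proof (cases "norm x \<le> r")
      case True
      have "(\<integral>y. mol \<epsilon> (x - y) * ?h y \<partial>n) \<le> (\<integral>y. mol \<epsilon> (x - y) \<partial>n)"
        by (intro integral_mono i1 integrable_mult_bounded(1)[OF i1 _ h(2)])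
           (auto simp: indicator_def mol_nonneg \<epsilon>)
      then show ?thesis using True by (simp add: conv_def)
    next
      case False
      have z: "mol \<epsilon> (x - y) * ?h y = 0" for y
      proof (cases "norm y \<le> r - 1")
        case True
        have "norm x \<le> norm y + norm (x - y)" using norm_triangle_sub[of x y] by simp
        then have "norm (x - y) \<ge> \<epsilon>" using True False \<epsilon> by linarith
        then show ?thesis by (simp add: mol_eq_0[OF \<epsilon>(1)])
      qed simp
      show ?thesis unfolding z using False by simp
    qed
  qed
  finally show ?thesis .
qed

lemma (in levy) defect_estimate:
  fixes n1 n2 :: "'a measure"
  assumes n1: "finite_borel n1" and n2: "finite_borel n2" and B: "drift B R L N"
    and \<epsilon>: "0 < \<epsilon>" "\<epsilon> \<le> 1" and \<eta>: "\<eta> > 0" and r: "0 < r" "2 * r \<le> R" and c: "c > 0"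
    and hc: "\<And>h. h \<in> borel_measurable borel \<Longrightarrow> ennreal c * (\<integral>\<^sup>+z. h z * indicator (cball 0 (2 * r)) z \<partial>lborel) \<le> (\<integral>\<^sup>+z. h z \<partial>\<nu>)"
    and eqn: "\<And>x. (\<integral>y. generator \<nu> B \<epsilon> x y \<partial>n1) = (\<integral>y. generator \<nu> B \<epsilon> x y \<partial>n2)"
    and E: "E = (\<integral>x. min (conv n1 (mol \<epsilon>) x) (conv n2 (mol \<epsilon>) x) \<partial>lborel)"
  shows "c / 2 * measure lborel (cball (0::'a) r) * (min (measure n1 (cball 0 (r - 1))) (measure n2 (cball 0 (r - 1))) - E)
    \<le> 22 / R * mom * measure n1 UNIV + (- (\<integral>y. B y \<bullet> bump' R y \<partial>n1) + N * (66 / R\<^sup>2) * \<epsilon> * measure n1 UNIV)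
      + real DIM('a) * (3 * N * (4 / R) + L) * E
      + L * (2 / \<eta> * E + 2 * \<eta> * (2 * 2 ^ DIM('a) * (measure n1 UNIV + measure n2 UNIV)))"
proof -
  interpret n1: finite_borel n1 by fact
  interpret n2: finite_borel n2 by fact
  interpret B: drift B R L N by fact
  let ?Z = "mol_mass \<epsilon> TYPE('a)"
  let ?a = "conv n1 (mol \<epsilon>)" and ?b = "conv n2 (mol \<epsilon>)"
  let ?a' = "conv n1 (mol' \<epsilon>)" and ?b' = "conv n2 (mol' \<epsilon>)"
  let ?w = "bump R :: 'a \<Rightarrow> real"
  have Z: "?Z > 0" using mol_mass_pos[OF \<epsilon>(1)] .
  have R: "R > 0" using B.R1 by simp
  obtain C M where CM: "min_pair ?a ?b ?a' ?b' C M" "min_pair ?a ?a ?a' ?a' C M"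
    by (rule conv_mol_min_pair[OF n1 n2 \<epsilon>(1)])
  interpret p: min_pair_levy \<nu> ?a ?b ?a' ?b' C M
    using CM(1) levy_axioms by (simp add: min_pair_levy_def)
  interpret q: min_pair_levy \<nu> ?a ?a ?a' ?a' C M
    using CM(2) levy_axioms by (simp add: min_pair_levy_def)
  let ?\<Lambda>a = "\<lambda>x. \<integral>z. incr ?a (?a' x) x (- z) \<partial>\<nu>"
  let ?\<Lambda>b = "\<lambda>x. \<integral>z. incr ?b (?b' x) x (- z) \<partial>\<nu>"
  let ?T1 = "transport B n1 \<epsilon>" and ?T2 = "transport B n2 \<epsilon>"
  define \<beta> where "\<beta> n = conv n (\<lambda>w. indicator (cball 0 \<epsilon>) w / ?Z)" for n :: "'a measure"
  have LT: "?T1 x + ?\<Lambda>a x = ?T2 x + ?\<Lambda>b x" for x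
    using eqn[of x] Z unfolding generator_integral[OF n1 \<epsilon>(1) B.B_cont] generator_integral[OF n2 \<epsilon>(1) B.B_cont] by simp
  have pe: "p.e x = min (?a x) (?b x)" for x by (rule p.e_def)
  have E': "E = (\<integral>x. p.e x \<partial>lborel)" unfolding E pe ..
  have ta: "(\<integral>x. ?a x \<partial>lborel) = measure n1 UNIV"
    using n1.conv_integral(2)[OF mol_integrable[OF \<epsilon>(1)]] mol_integral[OF \<epsilon>(1), where 'a='a] by (simp add: n1.mass_def)
  have E0: "0 \<le> E" unfolding E' by (intro integral_nonneg_AE) (auto simp: p.e_bd)
  have Ea: "E \<le> measure n1 UNIV"
    unfolding E' ta[symmetric] by (intro integral_mono p.e_int p.a_int) (simp add: pe)
  note bs = bump_nonneg bump_integrable[OF R] quad_approx_bump[OF R] norm_bump'_le[OF R] incr_bump_bound[OF B.R1]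
  note pw = p.weak_form_integrated[OF bs]
  note qw = q.weak_form_integrated[OF bs]
  have qe: "q.e x = ?a x" and qa: "q.act x z = incr ?a (?a' x) x (- z)" for x z
    by (simp_all add: q.e_def q.act_def)
  have qd: "q.defect ?w z = 0" for z
    by (simp add: q.defect_def q.D_def qe)
  have \<Lambda>: "(\<integral>x. ?w x * ?\<Lambda>a x \<partial>lborel) \<le> 11 / R * mom * measure n1 UNIV"
    using qw(2) unfolding qa qd qe ta by simp
  have \<Lambda>i: "integrable lborel (\<lambda>x. ?w x * ?\<Lambda>a x)" using qw(3) unfolding qa .
  note Ti = B.transport_integrated[OF n1 \<epsilon>]
  have BL: "norm (B x - B y) \<le> L * norm (x - y)" if "norm x \<le> R" "norm y \<le> R" for x y
    using that by (intro B.B_lip) auto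
  have BB: "norm (B x) \<le> N" if "norm x \<le> R" for x using that by (intro B.B_bd) auto
  have "0 \<le> 4 / R" using R by simp
  note tl = p.transport_lipschitz[where R = R, OF bump_nonneg bump_le_1 bump_eq_0[OF R] bump_lipschitz[OF R] bump_integrable[OF R]
      BL BB B.B_meas B.L0 B.N0 this, folded E']
  have \<beta>k: "integrable lborel (\<lambda>w::'a. indicator (cball 0 \<epsilon>) w / ?Z)"
    by (intro integrable_divide cball_integrable)
  have \<beta>I: "integrable lborel (\<beta> n1)" "integrable lborel (\<beta> n2)"
    unfolding \<beta>_def by (intro n1.conv_integral(1) n2.conv_integral(1) \<beta>k)+
  have \<beta>V: "(\<integral>w. indicator (cball (0::'a) \<epsilon>) w / ?Z \<partial>lborel) \<le> 2 * 2 ^ DIM('a)"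
    using cball_mass_ratio[OF \<epsilon>(1), where 'a='a] Z by (simp add: divide_le_eq)
  have \<beta>v: "(\<integral>x. \<beta> n1 x + \<beta> n2 x \<partial>lborel) \<le> 2 * 2 ^ DIM('a) * (measure n1 UNIV + measure n2 UNIV)"
  proof -
    have "(\<integral>x. \<beta> n1 x + \<beta> n2 x \<partial>lborel) = (\<integral>w. indicator (cball (0::'a) \<epsilon>) w / ?Z \<partial>lborel) * (measure n1 UNIV + measure n2 UNIV)"
      using \<beta>I n1.conv_integral(2)[OF \<beta>k] n2.conv_integral(2)[OF \<beta>k] unfolding \<beta>_def
      by (simp add: n1.mass_def n2.mass_def distrib_left add_divide_distrib)
    also have "\<dots> \<le> 2 * 2 ^ DIM('a) * (measure n1 UNIV + measure n2 UNIV)"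
      by (intro mult_right_mono \<beta>V) auto
    finally show ?thesis .
  qed
  have \<beta>0: "0 \<le> \<beta> n x" for n x
    unfolding \<beta>_def conv_def using Z by (intro integral_nonneg_AE) auto
  let ?r = "\<lambda>x. L * (2 / \<eta> * p.e x + 2 * \<eta> * (\<beta> n1 x + \<beta> n2 x))"
  have r0: "0 \<le> ?r x" for x
    using B.L0 \<eta> p.e_bd(1)[of x] \<beta>0 by (intro mult_nonneg_nonneg add_nonneg_nonneg) auto
  have pt: "?w x * (\<integral>z. p.act x z \<partial>\<nu>) \<le> ?w x * ?\<Lambda>a x + ?w x * ?T1 x - ?w x * (B x \<bullet> p.G x) + ?r x" for x
  proof (cases "norm x \<le> R")
    case True
    have 1: "B x \<bullet> ?a' x - ?T1 x \<le> ?r x" if "?a x \<le> ?b x"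
    proof -
      have "B x \<bullet> ?a' x - ?T1 x \<le> L * (2 / \<eta> * ?a x + 2 * \<eta> * \<beta> n1 x)"
        unfolding \<beta>_def by (rule B.commutator_bound[OF n1 True \<epsilon> \<eta>])
      also have "\<dots> \<le> ?r x" using that \<eta> \<beta>0[of n2 x] B.L0 by (intro mult_left_mono add_mono) (auto simp: pe)
      finally show ?thesis .
    qed
    have 2: "B x \<bullet> ?b' x - ?T2 x \<le> ?r x" if "\<not> ?a x \<le> ?b x"
    proof -
      have "B x \<bullet> ?b' x - ?T2 x \<le> L * (2 / \<eta> * ?b x + 2 * \<eta> * \<beta> n2 x)"
        unfolding \<beta>_def by (rule B.commutator_bound[OF n2 True \<epsilon> \<eta>])
      also have "\<dots> \<le> ?r x" using that \<eta> \<beta>0[of n1 x] B.L0 by (intro mult_left_mono add_mono) (auto simp: pe)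
      finally show ?thesis .
    qed
    have "(\<integral>z. p.act x z \<partial>\<nu>) \<le> ?\<Lambda>a x + ?T1 x - B x \<bullet> p.G x + ?r x"
    proof (cases "?a x \<le> ?b x")
      case True
      then show ?thesis using 1 by (simp add: p.act_def p.G_def)
    next
      case False
      then show ?thesis using 2 LT[of x] by (simp add: p.act_def p.G_def)
    qed
    then have "?w x * (\<integral>z. p.act x z \<partial>\<nu>) \<le> ?w x * (?\<Lambda>a x + ?T1 x - B x \<bullet> p.G x + ?r x)"
      by (intro mult_left_mono bump_nonneg)
    also have "\<dots> = ?w x * ?\<Lambda>a x + ?w x * ?T1 x - ?w x * (B x \<bullet> p.G x) + ?w x * ?r x" by (simp only: distrib_left right_diff_distrib)
    also have "?w x * ?r x \<le> 1 * ?r x" by (intro mult_right_mono r0 bump_le_1)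
    finally show ?thesis by simp
  next
    case False
    then have "?w x = 0" using bump_eq_0[OF R, of x] by simp
    then show ?thesis using r0[of x] by simp
  qed
  have ri: "integrable lborel ?r"
    by (intro integrable_mult_right Bochner_Integration.integrable_add p.e_int \<beta>I)
  have "(\<integral>x. ?w x * (\<integral>z. p.act x z \<partial>\<nu>) \<partial>lborel) \<le>
     (\<integral>x. ?w x * ?\<Lambda>a x + ?w x * ?T1 x - ?w x * (B x \<bullet> p.G x) + ?r x \<partial>lborel)"
    by (intro integral_mono pw(3) Bochner_Integration.integrable_add Bochner_Integration.integrable_diff \<Lambda>i Ti(1) tl(1) ri pt)
  also have "\<dots> = (\<integral>x. ?w x * ?\<Lambda>a x \<partial>lborel) + (\<integral>x. ?w x * ?T1 x \<partial>lborel) - (\<integral>x. ?w x * (B x \<bullet> p.G x) \<partial>lborel) + (\<integral>x. ?r x \<partial>lborel)"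
    by (simp only: Bochner_Integration.integral_add Bochner_Integration.integral_diff Bochner_Integration.integrable_add
        Bochner_Integration.integrable_diff \<Lambda>i Ti(1) tl(1) ri)
  also have "(\<integral>x. ?r x \<partial>lborel) = L * (2 / \<eta> * E + 2 * \<eta> * (\<integral>x. \<beta> n1 x + \<beta> n2 x \<partial>lborel))"
    unfolding E' by (simp only: integral_mult_right_zero Bochner_Integration.integral_add[OF integrable_mult_right[OF p.e_int]
          integrable_mult_right[OF Bochner_Integration.integrable_add[OF \<beta>I]]])
  also have "\<dots> \<le> L * (2 / \<eta> * E + 2 * \<eta> * (2 * 2 ^ DIM('a) * (measure n1 UNIV + measure n2 UNIV)))"
    using \<beta>v B.L0 \<eta> by (intro mult_left_mono add_left_mono) auto
  finally have act: "(\<integral>x. ?w x * (\<integral>z. p.act x z \<partial>\<nu>) \<partial>lborel) \<le>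
     (\<integral>x. ?w x * ?\<Lambda>a x \<partial>lborel) + (\<integral>x. ?w x * ?T1 x \<partial>lborel) - (\<integral>x. ?w x * (B x \<bullet> p.G x) \<partial>lborel)
       + L * (2 / \<eta> * E + 2 * \<eta> * (2 * 2 ^ DIM('a) * (measure n1 UNIV + measure n2 UNIV)))" by simp
  have "11 / R * mom * E \<le> 11 / R * mom * measure n1 UNIV"
    using Ea R mom_nonneg by (intro mult_left_mono) auto
  then have df: "(\<integral>z. p.defect ?w z \<partial>\<nu>) \<le> (\<integral>x. ?w x * (\<integral>z. p.act x z \<partial>\<nu>) \<partial>lborel) + 11 / R * mom * measure n1 UNIV"
    using pw(2) unfolding E'[symmetric] by linarith
  have low: "measure n (cball 0 (r - 1)) - E \<le> (\<integral>x. indicator (cball 0 r) x * (conv n (mol \<epsilon>) x - p.e x) \<partial>lborel)"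
    if n: "finite_borel n" for n :: "'a measure"
  proof -
    interpret n: finite_borel n by fact
    have i: "integrable lborel (\<lambda>x::'a. indicator (cball 0 r) x * f x)" if "integrable lborel f" for f :: "'a \<Rightarrow> real"
      by (rule integrable_mult_bounded(2)[OF that, where K = 1]) (auto simp: indicator_def)
    have "(\<integral>x. indicator (cball 0 r) x * p.e x \<partial>lborel) \<le> E"
      unfolding E' by (intro integral_mono i p.e_int) (auto simp: indicator_def p.e_bd)
    moreover have "(\<integral>x. indicator (cball 0 r) x * (conv n (mol \<epsilon>) x - p.e x) \<partial>lborel) =
       (\<integral>x. indicator (cball 0 r) x * conv n (mol \<epsilon>) x \<partial>lborel) - (\<integral>x. indicator (cball 0 r) x * p.e x \<partial>lborel)"
      unfolding right_diff_distrib by (intro Bochner_Integration.integral_diff i p.e_int n.conv_integral(1) mol_integrable \<epsilon>)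
    ultimately show ?thesis using ball_mass_le_conv[OF n \<epsilon>, of r] by linarith
  qed
  have "c / 2 * measure lborel (cball (0::'a) r) * (min (measure n1 (cball 0 (r - 1))) (measure n2 (cball 0 (r - 1))) - E) \<le>
     c / 2 * measure lborel (cball (0::'a) r) * min (\<integral>x. indicator (cball 0 r) x * (?a x - p.e x) \<partial>lborel) (\<integral>x. indicator (cball 0 r) x * (?b x - p.e x) \<partial>lborel)"
    using low[OF n1] low[OF n2] c by (intro mult_left_mono) (auto simp: min_def)
  also have "\<dots> \<le> (\<integral>z. p.defect ?w z \<partial>\<nu>)" by (rule p.defect_lower[OF r c hc pw(1)])
  finally have low': "c / 2 * measure lborel (cball (0::'a) r) * (min (measure n1 (cball 0 (r - 1))) (measure n2 (cball 0 (r - 1))) - E) \<le>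
     (\<integral>z. p.defect ?w z \<partial>\<nu>)" .
  have "22 / R * mom * measure n1 UNIV = 11 / R * mom * measure n1 UNIV + 11 / R * mom * measure n1 UNIV" by simp
  then show ?thesis using low' df act \<Lambda> Ti(2) tl(2) by linarith
qed

lemma le_of_linear:
  fixes x y P :: real
  assumes "\<And>\<delta>. \<delta> > 0 \<Longrightarrow> x \<le> y + P * \<delta>"
  shows "x \<le> y"
proof (rule le_of_linear_quadratic[of _ _ P])
  fix h :: real assume "h > 0"
  then show "h * x \<le> h * y + h\<^sup>2 * P"
    using mult_left_mono[OF assms, of h h] by (simp add: power2_eq_square algebra_simps)
qed

theorem (in levy) invariant_measure_unique:
  fixes m1 m2 :: "'a measure"
  assumes m1: "finite_borel m1" and m2: "finite_borel m2" and mass: "measure m1 UNIV = measure m2 UNIV"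
    and Bc: "continuous_on UNIV B"
    and Bl: "\<And>R. \<exists>L\<ge>0. \<forall>x y. norm x \<le> R \<longrightarrow> norm y \<le> R \<longrightarrow> norm (B x - B y) \<le> L * norm (x - y)"
    and diss: "\<And>x. norm x \<ge> R0 \<Longrightarrow> 0 \<le> B x \<bullet> x"
    and inv: "\<And>\<epsilon> x. \<epsilon> > 0 \<Longrightarrow> (\<integral>y. generator \<nu> B \<epsilon> x y \<partial>m1) = 0" "\<And>\<epsilon> x. \<epsilon> > 0 \<Longrightarrow> (\<integral>y. generator \<nu> B \<epsilon> x y \<partial>m2) = 0"
  shows "m1 = m2"
proof -
  interpret m1: finite_borel m1 by fact
  interpret m2: finite_borel m2 by fact
  have Bm [measurable]: "B \<in> borel_measurable borel" by (intro borel_measurable_continuous_onI Bc)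
  have fm: "finite_measure m1" "finite_measure m2" by unfold_locales
  obtain n1 n2 A where J: "finite_measure n1" "finite_measure n2" "sets n1 = sets m1" "sets n2 = sets m1"
    "A \<in> sets m1" "emeasure n1 (space m1 - A) = 0" "emeasure n2 A = 0"
    "\<forall>X\<in>sets m1. emeasure n1 X \<le> emeasure m1 X"
    "\<forall>(f :: 'a \<Rightarrow> real) K. f \<in> borel_measurable m1 \<longrightarrow> (\<forall>x. \<bar>f x\<bar> \<le> K) \<longrightarrow>
       (\<integral>x. f x \<partial>m1) - (\<integral>x. f x \<partial>m2) = (\<integral>x. f x \<partial>n1) - (\<integral>x. f x \<partial>n2)"
    by (rule jordan_decomposition[OF fm trans[OF m2.sets_n m1.sets_n[symmetric]]]) blast
  have n1: "finite_borel n1" and n2: "finite_borel n2"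
    using J(1-4) by (auto simp: finite_borel_def finite_borel_axioms_def)
  interpret n1: finite_borel n1 by (rule n1)
  interpret n2: finite_borel n2 by (rule n2)
  have A: "A \<in> sets borel" "emeasure n1 (- A) = 0" "emeasure n2 A = 0"
    using J(5,6,7) by (simp_all add: Compl_eq_Diff_UNIV)
  have diff: "(\<integral>x. f x \<partial>m1) - (\<integral>x. f x \<partial>m2) = (\<integral>x. f x \<partial>n1) - (\<integral>x. f x \<partial>n2)"
    if "f \<in> borel_measurable borel" "\<And>x. \<bar>f x\<bar> \<le> K" for f :: "'a \<Rightarrow> real" and K
    using that by (intro J(9)[rule_format]) auto
  have n_mass: "measure n1 UNIV = measure n2 UNIV"
    using diff[of "\<lambda>x. 1" 1] mass m1.integral_const_n[of 1] m2.integral_const_n[of 1] n1.integral_const_n[of 1] n2.integral_const_n[of 1]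
    by (simp add: m1.mass_def m2.mass_def n1.mass_def n2.mass_def)
  have eqn: "(\<integral>y. generator \<nu> B \<epsilon> x y \<partial>n1) = (\<integral>y. generator \<nu> B \<epsilon> x y \<partial>n2)" if \<epsilon>: "\<epsilon> > 0" for \<epsilon> x
  proof -
    obtain K where "\<And>y. \<bar>generator \<nu> B \<epsilon> x y\<bar> \<le> K"
      using generator_bump_regular(2)[OF Bc \<epsilon>, of x] unfolding bounded_iff by auto
    then show ?thesis
      using diff[of "generator \<nu> B \<epsilon> x" K] generator_bump_regular(1)[OF Bc \<epsilon>, of x] inv[OF \<epsilon>, of x]
      by (simp add: borel_measurable_continuous_onI)
  qed
  have n1_le: "(\<integral>x. f x \<partial>n1) \<le> (\<integral>x. f x \<partial>m1)"
    if f: "f \<in> borel_measurable borel" "\<And>x. 0 \<le> f x" "\<And>x. f x \<le> K" for f :: "'a \<Rightarrow> real" and K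
  proof -
    have "n1 \<le> m1"
      using J(3,8) by (subst le_measure) auto
    then have "(\<integral>\<^sup>+x. ennreal (f x) \<partial>n1) \<le> (\<integral>\<^sup>+x. ennreal (f x) \<partial>m1)"
      using J(3) by (intro nn_integral_mono_measure) auto
    moreover have "integrable n1 f" "integrable m1 f"
      using f by (auto intro!: n1.integrable_bounded[where K = K] m1.integrable_bounded[where K = K])
    ultimately show ?thesis using f(2) by (simp add: nn_integral_eq_integral)
  qed
  obtain C0 where C0: "C0 \<ge> 0" "\<And>y. norm y \<le> R0 \<Longrightarrow> \<bar>B y \<bullet> y\<bar> \<le> C0"
  proof -
    have "bounded ((\<lambda>y. B y \<bullet> y) ` cball 0 R0)"
      using continuous_on_subset[OF Bc] by (intro compact_imp_bounded compact_continuous_image continuous_on_inner) auto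
    then obtain K where "\<And>y. norm y \<le> R0 \<Longrightarrow> \<bar>B y \<bullet> y\<bar> \<le> K" unfolding bounded_iff by force
    then show ?thesis by (intro that[of "\<bar>K\<bar>"]) (auto intro: order_trans[OF _ abs_ge_self])
  qed
  define K1 where "K1 = 22 * mom * measure n1 UNIV + 4 * C0 * measure m1 UNIV + 11 * mom * measure m1 UNIV"
  have drift_term: "- (\<integral>y. B y \<bullet> bump' R y \<partial>n1) \<le> (4 * C0 * measure m1 UNIV + 11 * mom * measure m1 UNIV) / R" if R1: "R \<ge> 1" for R
  proof -
    have R: "R > 0" using R1 by simp
    obtain N where N: "\<And>y. norm y \<le> R \<Longrightarrow> norm (B y) \<le> N" "N \<ge> 0"
    proof -
      have "bounded (B ` cball 0 R)"
        using continuous_on_subset[OF Bc] by (intro compact_imp_bounded compact_continuous_image) auto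
      then obtain K where "\<And>y. norm y \<le> R \<Longrightarrow> norm (B y) \<le> K" unfolding bounded_iff by force
      then show ?thesis by (intro that[of "\<bar>K\<bar>"]) (auto intro: order_trans[OF _ abs_ge_self])
    qed
    define g where "g y = - (B y \<bullet> bump' R y)" for y
    have g_bd: "\<bar>g y\<bar> \<le> N * (4 / R)" for y
    proof (cases "norm y \<le> R")
      case True
      show ?thesis unfolding g_def
        using Cauchy_Schwarz_ineq2[of "B y" "bump' R y"] mult_mono[OF N(1)[OF True] norm_bump'_le[OF R, of y] N(2)] by simp
    qed (use bump'_eq_0[OF R, of y] N R in \<open>simp add: g_def\<close>)
    have g_lo: "- (4 * C0 / R\<^sup>2) \<le> g y" for y
    proof -
      let ?s = "max 0 (1 - (norm y / R)\<^sup>2)"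
      have s: "0 \<le> ?s" "?s \<le> 1" by auto
      have "- C0 \<le> ?s * (B y \<bullet> y)"
      proof (cases "norm y \<le> R0")
        case True
        have "?s * \<bar>B y \<bullet> y\<bar> \<le> 1 * C0" using C0(2)[OF True] s by (intro mult_mono) auto
        then show ?thesis using s(1) abs_le_iff[of "?s * (B y \<bullet> y)" C0] by (simp add: abs_mult)
      next
        case False
        then have "0 \<le> ?s * (B y \<bullet> y)" using diss[of y] s by (intro mult_nonneg_nonneg) auto
        then show ?thesis using C0(1) by linarith
      qed
      from mult_left_mono[OF this, of "4 / R\<^sup>2"] show ?thesis
        by (simp add: g_def bump'_def ac_simps)
    qed
    have gm [measurable]: "g \<in> borel_measurable borel" unfolding g_def[abs_def] by measurable
    have gi: "integrable n1 g" "integrable m1 g"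
      using g_bd by (auto intro!: n1.integrable_bounded[where K = "N * (4 / R)"] m1.integrable_bounded[where K = "N * (4 / R)"])
    have "(\<integral>y. g y + 4 * C0 / R\<^sup>2 \<partial>n1) \<le> (\<integral>y. g y + 4 * C0 / R\<^sup>2 \<partial>m1)"
    proof (rule n1_le)
      show "0 \<le> g y + 4 * C0 / R\<^sup>2" for y using g_lo[of y] by simp
      show "g y + 4 * C0 / R\<^sup>2 \<le> N * (4 / R) + 4 * C0 / R\<^sup>2" for y using g_bd[of y] by (simp add: abs_le_iff)
    qed measurable
    then have "(\<integral>y. g y \<partial>n1) + 4 * C0 / R\<^sup>2 * measure n1 UNIV \<le> (\<integral>y. g y \<partial>m1) + 4 * C0 / R\<^sup>2 * measure m1 UNIV"
      using gi n1.integral_const_n[of "4 * C0 / R\<^sup>2"] m1.integral_const_n[of "4 * C0 / R\<^sup>2"]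
      by (simp add: n1.mass_def m1.mass_def ac_simps)
    moreover have "0 \<le> 4 * C0 / R\<^sup>2 * measure n1 UNIV" using C0(1) by simp
    moreover have "4 * C0 / R\<^sup>2 * measure m1 UNIV \<le> 4 * C0 / R * measure m1 UNIV"
      using C0(1) R1 self_le_power[of R 2] by (intro mult_right_mono divide_left_mono) auto
    moreover have "(\<integral>y. g y \<partial>m1) \<le> 11 / R * mom * measure m1 UNIV"
    proof -
      let ?l = "\<lambda>y. nonlocal \<nu> UNIV y (\<lambda>w. bump R (w - 0)) (bump' R (y - 0))"
      have lb: "\<bar>?l y\<bar> \<le> 11 / R * mom" for y
        unfolding nonlocal_UNIV by (rule integral_dominated) (simp, use incr_bump_bound[OF R1] in simp)
      have gen: "generator \<nu> B R 0 y = - g y - ?l y" for y by (simp add: generator_def g_def)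
      obtain K where K: "\<And>y. \<bar>generator \<nu> B R 0 y\<bar> \<le> K"
        using generator_bump_regular(2)[OF Bc R, of 0] unfolding bounded_iff by auto
      have geni: "integrable m1 (generator \<nu> B R 0)"
        using generator_bump_regular(1)[OF Bc R, of 0] K
        by (intro m1.integrable_bounded[where K = K]) (auto intro: borel_measurable_continuous_onI)
      have l_eq: "?l y = - g y - generator \<nu> B R 0 y" for y using gen[of y] by simp
      have li: "integrable m1 ?l" unfolding l_eq using gi geni by simp
      have "(\<integral>y. ?l y \<partial>m1) = - (\<integral>y. g y \<partial>m1)"
        unfolding l_eq using gi geni inv(1)[OF R, of 0] by simp
      moreover have "\<bar>\<integral>y. ?l y \<partial>m1\<bar> \<le> 11 / R * mom * m1.mass"
        using li by (intro m1.integral_bounded lb) simp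
      ultimately show ?thesis by (simp add: m1.mass_def)
    qed
    ultimately have "(\<integral>y. g y \<partial>n1) \<le> 4 * C0 / R * measure m1 UNIV + 11 / R * mom * measure m1 UNIV" by linarith
    then show ?thesis using gi(1) by (simp add: g_def add_divide_distrib)
  qed
  have zero: "min (measure n1 (cball 0 (r - 1))) (measure n2 (cball 0 (r - 1))) \<le> 0" if r: "r > 0" for r
  proof -
    obtain c where c: "c > 0" "\<And>h. h \<in> borel_measurable borel \<Longrightarrow>
        ennreal c * (\<integral>\<^sup>+z. h z * indicator (cball 0 (2 * r)) z \<partial>lborel) \<le> (\<integral>\<^sup>+z. h z \<partial>\<nu>)"
      using lower_nu[of "2 * r"] r by auto
    define \<kappa> where "\<kappa> = c / 2 * measure lborel (cball (0::'a) r)"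
    have \<kappa>: "\<kappa> > 0" using c(1) content_cball_pos[OF r, of "0::'a"] by (simp add: \<kappa>_def)
    let ?m = "min (measure n1 (cball 0 (r - 1))) (measure n2 (cball 0 (r - 1)))"
    have R_bound: "\<kappa> * ?m \<le> K1 / R" if R: "R \<ge> 1" "2 * r \<le> R" for R
    proof -
      obtain L where L: "L \<ge> 0" "\<And>x y. norm x \<le> R + 1 \<Longrightarrow> norm y \<le> R + 1 \<Longrightarrow> norm (B x - B y) \<le> L * norm (x - y)"
        using Bl[of "R + 1"] by blast
      define N where "N = norm (B 0) + L * (R + 1)"
      have "norm (B x) \<le> N" if "norm x \<le> R + 1" for x
      proof -
        have "norm (B x) \<le> norm (B 0) + norm (B x - B 0)" using norm_triangle_sub[of "B x" "B 0"] .
        also have "norm (B x - B 0) \<le> L * norm (x - 0)" using that R by (intro L) auto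
        also have "\<dots> \<le> L * (R + 1)" using that L(1) by (intro mult_left_mono) auto
        finally show ?thesis by (simp add: N_def)
      qed
      then have D: "drift B R L N" using Bc L R by unfold_locales auto
      let ?Q = "L * (4 * (2 * 2 ^ DIM('a) * (measure n1 UNIV + measure n2 UNIV)))"
      have "\<kappa> * ?m \<le> K1 / R + L * (2 * (2 * 2 ^ DIM('a) * (measure n1 UNIV + measure n2 UNIV))) * \<eta>" if \<eta>: "\<eta> > 0" for \<eta>
      proof (rule le_of_linear)
        fix \<delta> :: real assume \<delta>: "\<delta> > 0"
        obtain \<epsilon>0 where \<epsilon>0: "\<epsilon>0 > 0" "\<And>\<epsilon>. 0 < \<epsilon> \<Longrightarrow> \<epsilon> < \<epsilon>0 \<Longrightarrow>
           (\<integral>x. min (conv n1 (mol \<epsilon>) x) (conv n2 (mol \<epsilon>) x) \<partial>lborel) \<le> \<delta>"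
          using min_conv_mol_small[OF n1 n2 A \<delta>] by blast
        define \<epsilon> where "\<epsilon> = min (min 1 \<delta>) (\<epsilon>0 / 2)"
        have \<epsilon>: "0 < \<epsilon>" "\<epsilon> \<le> 1" "\<epsilon> \<le> \<delta>" "\<epsilon> < \<epsilon>0" using \<delta> \<epsilon>0(1) by (auto simp: \<epsilon>_def)
        define E where "E = (\<integral>x. min (conv n1 (mol \<epsilon>) x) (conv n2 (mol \<epsilon>) x) \<partial>lborel)"
        have E: "E \<le> \<delta>" unfolding E_def by (rule \<epsilon>0(2)[OF \<epsilon>(1,4)])
        have k: "\<kappa> * (?m - E) \<le> 22 / R * mom * measure n1 UNIV + (- (\<integral>y. B y \<bullet> bump' R y \<partial>n1) + N * (66 / R\<^sup>2) * \<epsilon> * measure n1 UNIV)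
            + real DIM('a) * (3 * N * (4 / R) + L) * E
            + L * (2 / \<eta> * E + 2 * \<eta> * (2 * 2 ^ DIM('a) * (measure n1 UNIV + measure n2 UNIV)))"
          unfolding \<kappa>_def by (rule defect_estimate[OF n1 n2 D \<epsilon>(1,2) \<eta> r R(2) c eqn[OF \<epsilon>(1)] E_def])
        have N0: "N \<ge> 0" using L(1) R by (simp add: N_def)
        have "N * (66 / R\<^sup>2) * measure n1 UNIV * \<epsilon> \<le> N * (66 / R\<^sup>2) * measure n1 UNIV * \<delta>"
          using N0 \<epsilon>(3) by (intro mult_left_mono) auto
        moreover have "real DIM('a) * (3 * N * (4 / R) + L) * E \<le> real DIM('a) * (3 * N * (4 / R) + L) * \<delta>"
          using N0 L(1) R E by (intro mult_left_mono) auto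
        moreover have "L * (2 / \<eta>) * E \<le> L * (2 / \<eta>) * \<delta>" using L(1) \<eta> E by (intro mult_left_mono) auto
        moreover have "\<kappa> * E \<le> \<kappa> * \<delta>" using \<kappa> E by (intro mult_left_mono) auto
        moreover have "K1 / R = 22 / R * mom * measure n1 UNIV + (4 * C0 * measure m1 UNIV + 11 * mom * measure m1 UNIV) / R"
          by (simp add: K1_def add_divide_distrib)
        moreover note drift_term[OF R(1)]
        ultimately show "\<kappa> * ?m \<le> K1 / R + L * (2 * (2 * 2 ^ DIM('a) * (measure n1 UNIV + measure n2 UNIV))) * \<eta>
            + (N * (66 / R\<^sup>2) * measure n1 UNIV + real DIM('a) * (3 * N * (4 / R) + L) + L * (2 / \<eta>) + \<kappa>) * \<delta>"
          using k unfolding right_diff_distrib distrib_left distrib_right by (simp add: ac_simps)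
      qed
      then show ?thesis by (rule le_of_linear)
    qed
    have "\<kappa> * ?m \<le> 0"
    proof (rule le_of_linear)
      fix \<delta> :: real assume \<delta>: "\<delta> > 0"
      define R where "R = max (max 1 (2 * r)) (1 / \<delta>)"
      have R: "R \<ge> 1" "2 * r \<le> R" "1 / \<delta> \<le> R" by (auto simp: R_def)
      have "1 / R \<le> \<delta>" using R(1,3) \<delta> by (simp add: field_simps)
      moreover have "K1 \<ge> 0" unfolding K1_def using C0(1) mom_nonneg by simp
      ultimately have "K1 * (1 / R) \<le> K1 * \<delta>" by (intro mult_left_mono)
      then show "\<kappa> * ?m \<le> 0 + K1 * \<delta>" using R_bound[OF R(1,2)] by simp
    qed
    then show ?thesis using \<kappa> by (simp add: mult_le_0_iff)
  qed
  have lim: "(\<lambda>k. measure n (cball 0 (real k))) \<longlonglongrightarrow> measure n UNIV" if "finite_borel n" for n :: "'a measure"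
  proof -
    interpret n: finite_borel n by fact
    have "(\<Union>k. cball (0::'a) (real k)) = UNIV" using real_arch_simple by fastforce
    moreover have "incseq (\<lambda>k. cball (0::'a) (real k))" by (auto simp: incseq_def)
    moreover have "range (\<lambda>k. cball (0::'a) (real k)) \<subseteq> sets n" by (auto simp: borel_closed)
    ultimately show ?thesis using n.finite_Lim_measure_incseq[of "\<lambda>k. cball (0::'a) (real k)"] by simp
  qed
  have "(\<lambda>k. min (measure n1 (cball 0 (real k))) (measure n2 (cball 0 (real k)))) \<longlonglongrightarrow> min (measure n1 UNIV) (measure n2 UNIV)"
    by (intro tendsto_min lim n1 n2)
  moreover have "min (measure n1 (cball 0 (real k))) (measure n2 (cball 0 (real k))) = 0" for k
    using zero[of "real k + 1"] by (simp add: min_def measure_nonneg split: if_splits) (auto intro: antisym measure_nonneg)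
  ultimately have "min (measure n1 UNIV) (measure n2 UNIV) = 0" by (simp add: LIMSEQ_const_iff)
  then have n0: "n1.mass = 0" "n2.mass = 0" using n_mass by (simp_all add: n1.mass_def n2.mass_def)
  show ?thesis
  proof (rule measure_eqI)
    show "sets m1 = sets m2" by simp
    fix X assume X: "X \<in> sets m1"
    have i: "(\<lambda>x. indicator X x :: real) \<in> borel_measurable borel" "\<bar>indicator X x :: real\<bar> \<le> 1" for x using X by (auto simp: indicator_def)
    have "\<bar>\<integral>x. indicator X x \<partial>n1 :: real\<bar> \<le> 1 * n1.mass" "\<bar>\<integral>x. indicator X x \<partial>n2 :: real\<bar> \<le> 1 * n2.mass"
      by (rule n1.integral_bounded[OF i] n2.integral_bounded[OF i])+
    then have "(\<integral>x. indicator X x \<partial>n1 :: real) = 0" "(\<integral>x. indicator X x \<partial>n2 :: real) = 0" unfolding n0 by linarith+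
    then have "(\<integral>x. indicator X x \<partial>m1 :: real) = (\<integral>x. indicator X x \<partial>m2)" using diff[OF i] by linarith
    then have "measure m1 X = measure m2 X" using X by simp
    then show "emeasure m1 X = emeasure m2 X" by (simp add: m1.emeasure_eq_measure m2.emeasure_eq_measure)
  qed
qed

section \<open>Regularity of \<open>W\<^sup>2\<^sup>,\<^sup>\<infinity>\<close> functions\<close>

definition exp_kernel :: "nat \<Rightarrow> real \<Rightarrow> real" where
  "exp_kernel n t = (if t > 0 then (1 / t) ^ n * exp (- 1 / t) else 0)"

lemma exp_kernel_bound: "\<bar>exp_kernel n t\<bar> \<le> fact (n + 2) * t\<^sup>2"
proof (cases "t > 0")
  case True
  define x where "x = 1 / t"
  have x: "x > 0" using True by (simp add: x_def)
  have "x ^ (n + 2) / fact (n + 2) \<le> exp x"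
    using sum_le_suminf[OF summable_exp_generic[of x], of "{n + 2}"] x
    by (auto simp: exp_def divide_inverse mult.commute)
  then have "x ^ (n + 2) \<le> fact (n + 2) * exp x" by (simp add: divide_le_eq mult.commute)
  then have "x ^ n * x\<^sup>2 * exp (- x) \<le> fact (n + 2) * exp x * exp (- x)"
    by (intro mult_right_mono) (simp_all add: power_add power2_eq_square ac_simps)
  also have "fact (n + 2) * exp x * exp (- x) = fact (n + 2)" by (simp add: mult.assoc exp_minus_inverse)
  finally have "x ^ n * exp (- x) * x\<^sup>2 \<le> fact (n + 2)" by (simp only: ac_simps)
  then have "x ^ n * exp (- x) * x\<^sup>2 * t\<^sup>2 \<le> fact (n + 2) * t\<^sup>2" by (intro mult_right_mono) auto
  moreover have "x\<^sup>2 * t\<^sup>2 = 1" using True by (simp add: x_def power_divide)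
  ultimately have "x ^ n * exp (- x) \<le> fact (n + 2) * t\<^sup>2" by (simp only: mult.assoc mult_1_right)
  moreover have "\<bar>exp_kernel n t\<bar> = x ^ n * exp (- x)" using True by (simp add: exp_kernel_def x_def)
  ultimately show ?thesis by simp
qed (simp add: exp_kernel_def)

lemma exp_kernel_deriv:
  "(exp_kernel n has_real_derivative exp_kernel (n + 2) t - real n * exp_kernel (n + 1) t) (at t)"
proof -
  consider "t > 0" | "t < 0" | "t = 0" by linarith
  then show ?thesis
  proof cases
    case 1
    have "((\<lambda>t. (1 / t) ^ n * exp (- 1 / t)) has_real_derivative
        (1 / t) ^ (n + 2) * exp (- 1 / t) - real n * ((1 / t) ^ (n + 1) * exp (- 1 / t))) (at t)"
    proof -
      have d: "((\<lambda>t. 1 / t) has_real_derivative - ((1 / t)\<^sup>2)) (at t)"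
        using 1 by (auto intro!: derivative_eq_intros simp: power2_eq_square)
      have e: "((\<lambda>t. exp (- 1 / t)) has_real_derivative exp (- 1 / t) * (1 / t)\<^sup>2) (at t)"
        using 1 by (auto intro!: derivative_eq_intros simp: power2_eq_square)
      have p: "real n * (- ((1 / t)\<^sup>2) * (1 / t) ^ (n - Suc 0)) = - real n * (1 / t) ^ (n + 1)"
        by (cases n) (auto simp: power2_eq_square algebra_simps add_divide_distrib diff_divide_distrib)
      show ?thesis
        using DERIV_mult[OF DERIV_power[OF d, of n] e] unfolding p
        by (rule DERIV_cong) (simp add: power_add power2_eq_square ac_simps)
    qed
    then have "(exp_kernel n has_real_derivative
        (1 / t) ^ (n + 2) * exp (- 1 / t) - real n * ((1 / t) ^ (n + 1) * exp (- 1 / t))) (at t)"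
      by (rule has_field_derivative_transform_within_open[of _ _ _ "{0<..}"]) (use 1 in \<open>auto simp: exp_kernel_def\<close>)
    then show ?thesis using 1 by (simp add: exp_kernel_def)
  next
    case 2
    have "(exp_kernel n has_real_derivative 0) (at t)"
      by (rule has_field_derivative_transform_within_open[of "\<lambda>_. 0" _ _ "{..<0}"]) (use 2 in \<open>auto simp: exp_kernel_def\<close>)
    then show ?thesis using 2 by (simp add: exp_kernel_def)
  next
    case 3
    have "GDERIV (exp_kernel n) 0 :> 0"
    proof (rule quad_approx_imp_GDERIV[of 1])
      fix h :: real
      show "\<bar>exp_kernel n (0 + h) - exp_kernel n 0 - 0 \<bullet> h\<bar> \<le> fact (n + 2) * (norm h)\<^sup>2"
        using exp_kernel_bound[of n h] by (simp add: exp_kernel_def)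
    qed simp
    then show ?thesis using 3 by (simp add: exp_kernel_def)
  qed
qed

definition smooth :: "('a::euclidean_space \<Rightarrow> real) \<Rightarrow> bool" where
  "smooth f \<longleftrightarrow> (\<forall>k. Ck_on k UNIV f)"

definition pd :: "'a::euclidean_space \<Rightarrow> ('a \<Rightarrow> real) \<Rightarrow> 'a \<Rightarrow> real" where
  "pd i f x = frechet_derivative f (at x) i"

lemma Ck_on_exp_kernel:
  assumes "smooth g"
  shows "Ck_on k UNIV (\<lambda>x. exp_kernel n (g x))"
proof (induction k arbitrary: n)
  case 0
  have "Ck_on 0 UNIV g" using assms smooth_def by blast
  moreover have "continuous_on UNIV (exp_kernel n)"
    using exp_kernel_deriv[THEN DERIV_isCont] by (simp add: continuous_on_eq_continuous_at)
  ultimately show ?case using continuous_on_compose2[of UNIV "exp_kernel n" UNIV g] by simp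
next
  case (Suc k)
  have "Ck_on (Suc k) UNIV g" using assms smooth_def by blast
  then obtain g' where g: "\<And>x. (g has_derivative g' x) (at x)" "\<And>i. i \<in> Basis \<Longrightarrow> Ck_on k UNIV (\<lambda>x. g' x i)"
    by (rule Ck_on_SucE) blast
  show ?case
  proof (rule Ck_on_SucI)
    fix x
    show "((\<lambda>x. exp_kernel n (g x)) has_derivative
       (\<lambda>h. (exp_kernel (n + 2) (g x) + (- real n) * exp_kernel (n + 1) (g x)) * g' x h)) (at x)"
      using has_derivative_compose[OF g(1) exp_kernel_deriv[of n "g x", unfolded has_field_derivative_def]]
      by simp
  next
    fix i :: 'a assume "i \<in> Basis"
    then show "Ck_on k UNIV (\<lambda>x. (exp_kernel (n + 2) (g x) + (- real n) * exp_kernel (n + 1) (g x)) * g' x i)"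
      by (intro Ck_on_mult Ck_on_add Ck_on_const Suc.IH g)
  qed
qed

lemma smooth_pd: "smooth f \<Longrightarrow> i \<in> Basis \<Longrightarrow> smooth (pd i f)"
  unfolding smooth_def pd_def[abs_def] by (metis Ck_on.simps(2))

lemma smooth_differentiable: "smooth f \<Longrightarrow> f differentiable (at x)"
  unfolding smooth_def by (metis Ck_on.simps(2) UNIV_I)

lemma smooth_continuous: "smooth f \<Longrightarrow> continuous_on S f"
  unfolding smooth_def by (metis Ck_on.simps(1) continuous_on_subset top_greatest)

lemma smooth_has_derivative:
  "smooth f \<Longrightarrow> (f has_derivative (\<lambda>h. \<Sum>j\<in>Basis. (h \<bullet> j) * pd j f x)) (at x)"
  unfolding pd_def
  by (rule has_derivative_Basis_expand) (simp add: smooth_differentiable frechet_derivative_works[symmetric])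

lemma pd_eqI: "(f has_derivative f') (at x) \<Longrightarrow> pd i f x = f' i"
  unfolding pd_def by (simp add: frechet_derivative_at[symmetric])

lemma pd_support:
  assumes "\<And>x. x \<notin> cball a r \<Longrightarrow> f x = 0" "x \<notin> cball a r"
  shows "pd i f x = 0"
proof -
  have "(f has_derivative (\<lambda>h. 0)) (at x)"
    by (rule has_derivative_transform_within_open[of "\<lambda>_. 0" _ _ _ "- cball a r"])
       (use assms in \<open>auto intro: open_Compl simp del: mem_cball\<close>)
  then show ?thesis by (simp add: pd_eqI)
qed

lemma pd_reflect:
  assumes "smooth f"
  shows "pd i (\<lambda>y. f (x - y)) y = - pd i f (x - y)"
proof -
  have d: "(f has_derivative frechet_derivative f (at (x - y))) (at (x - y))"
    using smooth_differentiable[OF assms] by (simp add: frechet_derivative_works[symmetric])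
  have "((\<lambda>y. x - y) has_derivative (\<lambda>h. - h)) (at y)" by (auto intro!: derivative_eq_intros)
  from has_derivative_compose[OF this d]
  have "((\<lambda>y. f (x - y)) has_derivative (\<lambda>h. frechet_derivative f (at (x - y)) (- h))) (at y)" .
  then have "pd i (\<lambda>y. f (x - y)) y = frechet_derivative f (at (x - y)) (- i)" by (rule pd_eqI)
  also have "\<dots> = - frechet_derivative f (at (x - y)) i"
    by (rule linear_neg[OF bounded_linear.linear[OF has_derivative_bounded_linear[OF d]]])
  finally show ?thesis by (simp add: pd_def)
qed

lemma compact_support_bounded:
  assumes "smooth f" "\<And>x. x \<notin> cball a r \<Longrightarrow> f x = 0"
  shows "\<exists>M\<ge>0. \<forall>x. \<bar>f x\<bar> \<le> M"
proof -
  have "bounded (f ` cball a r)"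
    by (intro compact_imp_bounded compact_continuous_image smooth_continuous assms) auto
  then obtain M where M: "\<forall>x\<in>cball a r. \<bar>f x\<bar> \<le> M" unfolding bounded_iff by auto
  have "\<bar>f x\<bar> \<le> \<bar>M\<bar>" for x
  proof (cases "x \<in> cball a r")
    case True
    then show ?thesis using M by fastforce
  qed (simp add: assms(2))
  then show ?thesis by (intro exI[of _ "\<bar>M\<bar>"]) auto
qed

lemma smooth_quad_approx:
  fixes f :: "'a::euclidean_space \<Rightarrow> real"
  assumes f: "smooth f" "\<And>x. x \<notin> cball a r \<Longrightarrow> f x = 0"
  obtains C where "quad_approx C f (\<lambda>x. \<Sum>i\<in>Basis. pd i f x *\<^sub>R i)"
proof -
  have "\<exists>M\<ge>0. \<forall>x. \<bar>pd j (pd i f) x\<bar> \<le> M" if "i \<in> Basis" "j \<in> Basis" for i j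
    by (rule compact_support_bounded[OF smooth_pd[OF smooth_pd[OF f(1) that(1)] that(2)] pd_support[OF pd_support[OF f(2)]]])
  then obtain M where M: "\<And>i j. i \<in> Basis \<Longrightarrow> j \<in> Basis \<Longrightarrow> M i j \<ge> 0 \<and> (\<forall>x. \<bar>pd j (pd i f) x\<bar> \<le> M i j)"
    by metis
  define N where "N = (\<Sum>i\<in>(Basis::'a set). \<Sum>j\<in>(Basis::'a set). M i j)"
  have N: "\<bar>pd j (pd i f) x\<bar> \<le> N" if "i \<in> Basis" "j \<in> Basis" for i j x
  proof -
    have "M i j \<le> (\<Sum>j\<in>(Basis::'a set). M i j)" using that M by (intro member_le_sum) auto
    also have "\<dots> \<le> N" unfolding N_def using that M
      by (intro member_le_sum[of i Basis "\<lambda>i. \<Sum>j\<in>(Basis::'a set). M i j"]) (auto intro: sum_nonneg)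
    finally show ?thesis using M[OF that] order_trans by blast
  qed
  have N0: "N \<ge> 0" unfolding N_def using M by (intro sum_nonneg) auto
  let ?D = "\<lambda>x. \<Sum>i\<in>Basis. pd i f x *\<^sub>R i"
  have lip: "norm (?D x - ?D y) \<le> (real DIM('a) * (real DIM('a) * N)) * norm (x - y)" for x y
  proof -
    have "norm (?D x - ?D y) \<le> (\<Sum>i\<in>(Basis::'a set). real DIM('a) * N * norm (x - y))"
      unfolding sum_subtractf[symmetric] scaleR_diff_left[symmetric]
    proof (rule sum_norm_le)
      fix i :: 'a assume i: "i \<in> Basis"
      have "\<bar>pd i f x - pd i f y\<bar> \<le> real DIM('a) * N * norm (x - y)"
        by (rule bounded_partials_imp_lipschitz[OF convex_UNIV smooth_has_derivative[OF smooth_pd[OF f(1) i]]])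
           (use N[OF i] N0 in auto)
      then show "norm ((pd i f x - pd i f y) *\<^sub>R i) \<le> real DIM('a) * N * norm (x - y)" using i by simp
    qed
    then show ?thesis by simp
  qed
  have G: "GDERIV f x :> ?D x" for x
    using smooth_has_derivative[OF f(1)] unfolding GDERIV_sum_Basis .
  have "quad_approx (real DIM('a) * (real DIM('a) * N)) f ?D"
    unfolding quad_approx_def
    by (intro allI lipschitz_grad_imp_quad[OF convex_UNIV G lip]) (use N0 in auto)
  then show ?thesis by (rule that)
qed

lemma convolution_GDERIV:
  fixes u f :: "'a::euclidean_space \<Rightarrow> real"
  assumes f: "smooth f" "\<And>x. x \<notin> cball 0 r \<Longrightarrow> f x = 0"
    and [measurable]: "u \<in> borel_measurable borel" and U: "\<And>x. \<bar>u x\<bar> \<le> U"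
  shows "((\<lambda>x. \<integral>y. f (x - y) * u y \<partial>lborel) has_derivative
     (\<lambda>h. \<Sum>i\<in>Basis. (h \<bullet> i) * (\<integral>y. pd i f (x - y) * u y \<partial>lborel))) (at x)"
proof -
  obtain C where C: "quad_approx C f (\<lambda>x. \<Sum>i\<in>Basis. pd i f x *\<^sub>R i)" by (rule smooth_quad_approx[OF f])
  have int: "integrable lborel (\<lambda>y. g (z - y) * u y)" if g: "smooth g" "\<And>x. x \<notin> cball 0 r \<Longrightarrow> g x = 0" for g and z :: 'a
  proof -
    obtain M where M: "M \<ge> 0" "\<And>x. \<bar>g x\<bar> \<le> M" using compact_support_bounded[OF g] by blast
    have [measurable]: "g \<in> borel_measurable borel" by (intro borel_measurable_continuous_onI smooth_continuous g)
    show ?thesis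
    proof (rule Bochner_Integration.integrable_bound[OF integrable_mult_left[OF cball_integrable[of z r], of "M * U"]])
      show "AE y in lborel. norm (g (z - y) * u y) \<le> norm (indicator (cball z r) y * (M * U))"
      proof (rule AE_I2)
        fix y
        show "norm (g (z - y) * u y) \<le> norm (indicator (cball z r) y * (M * U))"
        proof (cases "y \<in> cball z r")
          case True
          have "\<bar>g (z - y) * u y\<bar> \<le> M * U" unfolding abs_mult using M U by (intro mult_mono) auto
          then show ?thesis using True by simp
        next
          case False
          then have "z - y \<notin> cball 0 r" by (simp add: dist_norm norm_minus_commute)
          then show ?thesis using g(2) by simp
        qed
      qed
    qed measurable
  qed
  have intf: "integrable lborel (\<lambda>y. f (z - y) * u y)" for z by (rule int[OF f(1)]) (rule f(2))
  let ?K = "C * U * measure lborel (cball x (r + 1))"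
  have "GDERIV (\<lambda>x. \<integral>y. f (x - y) * u y \<partial>lborel) x :> (\<Sum>i\<in>Basis. (\<integral>y. pd i f (x - y) * u y \<partial>lborel) *\<^sub>R i)"
  proof (rule quad_approx_imp_GDERIV[of 1])
    fix h :: 'a assume h: "norm h \<le> 1"
    let ?d = "\<lambda>y. f (x + h - y) * u y - f (x - y) * u y - (\<Sum>i\<in>Basis. (pd i f (x - y) * u y) * (i \<bullet> h))"
    have si: "integrable lborel (\<lambda>y. \<Sum>i\<in>Basis. (pd i f (x - y) * u y) * (i \<bullet> h))"
      by (intro Bochner_Integration.integrable_sum integrable_mult_left int smooth_pd f pd_support)
    have di: "integrable lborel ?d"
      by (intro Bochner_Integration.integrable_diff int f si)
    have "(\<integral>y. ?d y \<partial>lborel) = (\<integral>y. f (x + h - y) * u y \<partial>lborel) - (\<integral>y. f (x - y) * u y \<partial>lborel)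
        - (\<Sum>i\<in>Basis. (\<integral>y. pd i f (x - y) * u y \<partial>lborel) * (i \<bullet> h))"
    proof -
      have "(\<integral>y. (\<Sum>i\<in>Basis. (pd i f (x - y) * u y) * (i \<bullet> h)) \<partial>lborel) = (\<Sum>i\<in>Basis. (\<integral>y. pd i f (x - y) * u y \<partial>lborel) * (i \<bullet> h))"
        by (subst Bochner_Integration.integral_sum) (auto intro!: integrable_mult_left int smooth_pd f pd_support)
      then show ?thesis
        using intf[of "x + h"] intf[of x] si by (simp only: Bochner_Integration.integral_diff Bochner_Integration.integrable_diff)
    qed
    moreover have "\<bar>\<integral>y. ?d y \<partial>lborel\<bar> \<le> (\<integral>y. indicator (cball x (r + 1)) y * (C * (norm h)\<^sup>2 * U) \<partial>lborel)"
    proof (rule order_trans[OF integral_abs_bound], rule integral_mono)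
      fix y
      have d: "?d y = (f ((x - y) + h) - f (x - y) - (\<Sum>i\<in>Basis. pd i f (x - y) *\<^sub>R i) \<bullet> h) * u y"
        by (simp add: inner_sum_left sum_distrib_left sum_distrib_right left_diff_distrib algebra_simps)
      show "\<bar>?d y\<bar> \<le> indicator (cball x (r + 1)) y * (C * (norm h)\<^sup>2 * U)"
      proof (cases "y \<in> cball x (r + 1)")
        case True
        have "\<bar>?d y\<bar> \<le> (C * (norm h)\<^sup>2) * U"
          unfolding d abs_mult using quad_approxD[OF C, of "x - y" h] U quad_approx_nonneg[OF C]
          by (intro mult_mono) auto
        then show ?thesis using True by simp
      next
        case False
        then have "norm (x - y) > r + 1" by (simp add: dist_norm)
        moreover have "norm (x - y) \<le> norm (x - y + h) + norm h" using norm_triangle_ineq4[of "x - y + h" h] by simp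
        ultimately have "x - y \<notin> cball 0 r" "x - y + h \<notin> cball 0 r" using h by auto
        then have "f (x - y) = 0" "f (x - y + h) = 0" using f(2) by blast+
        moreover have "pd i f (x - y) = 0" for i
          using \<open>x - y \<notin> cball 0 r\<close> by (rule pd_support[rotated]) (rule f(2))
        ultimately show ?thesis using False unfolding d by simp
      qed
    qed (intro integrable_abs di, intro integrable_mult_left cball_integrable)
    ultimately show "\<bar>(\<integral>y. f (x + h - y) * u y \<partial>lborel) - (\<integral>y. f (x - y) * u y \<partial>lborel)
        - (\<Sum>i\<in>Basis. (\<integral>y. pd i f (x - y) * u y \<partial>lborel) *\<^sub>R i) \<bullet> h\<bar> \<le> ?K * (norm h)\<^sup>2"
      by (simp add: inner_sum_left ac_simps)
  qed simp
  then show ?thesis unfolding GDERIV_sum_Basis[symmetric] .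
qed

definition smooth_bump :: "real \<Rightarrow> 'a::euclidean_space \<Rightarrow> real" where
  "smooth_bump \<delta> x = exp_kernel 0 (\<delta>\<^sup>2 - (norm x)\<^sup>2)"

lemma smooth_smooth_bump: "smooth (\<lambda>y. smooth_bump \<delta> (y - x))"
proof -
  have "Ck_on k UNIV (\<lambda>y. \<delta>\<^sup>2 + (- 1) * (norm (y - x))\<^sup>2)" for k
    by (intro Ck_on_add Ck_on_mult Ck_on_const Ck_on_sq_norm)
  then have "smooth (\<lambda>y. \<delta>\<^sup>2 - (norm (y - x))\<^sup>2)" by (simp add: smooth_def)
  from Ck_on_exp_kernel[OF this] show ?thesis unfolding smooth_bump_def smooth_def by blast
qed

lemma smooth_bump_support: "\<delta> > 0 \<Longrightarrow> x \<notin> cball 0 \<delta> \<Longrightarrow> smooth_bump \<delta> x = 0"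
  using power_strict_mono[of \<delta> "norm x" 2] by (auto simp: smooth_bump_def exp_kernel_def)

lemma smooth_bump_nonneg: "0 \<le> smooth_bump \<delta> x"
  by (simp add: smooth_bump_def exp_kernel_def)

lemma smooth_bump_pos: "norm x < \<delta> \<Longrightarrow> 0 < smooth_bump \<delta> x"
  using power_strict_mono[of "norm x" \<delta> 2] by (simp add: smooth_bump_def exp_kernel_def)

lemma smooth_bump_measurable [measurable]: "smooth_bump \<delta> \<in> borel_measurable borel"
  using smooth_continuous[OF smooth_smooth_bump[of \<delta> 0]] by (intro borel_measurable_continuous_onI) simp

lemma smooth_bump_integrable:
  assumes "\<delta> > 0"
  shows "integrable lborel (smooth_bump \<delta> :: 'a::euclidean_space \<Rightarrow> real)"
proof -
  have "smooth (smooth_bump \<delta> :: 'a \<Rightarrow> real)" using smooth_smooth_bump[of \<delta> 0] by simp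
  from compact_support_bounded[OF this smooth_bump_support[OF assms]]
  obtain M where M: "M \<ge> 0" "\<And>x::'a. \<bar>smooth_bump \<delta> x\<bar> \<le> M" by blast
  show ?thesis
    by (rule Bochner_Integration.integrable_bound[OF integrable_mult_left[OF cball_integrable[of 0 \<delta>], of M]])
       (use M smooth_bump_support[OF assms] in \<open>auto simp: indicator_def\<close>)
qed

lemma smooth_bump_integral_pos:
  assumes "\<delta> > 0"
  shows "0 < (\<integral>x. smooth_bump \<delta> (x::'a::euclidean_space) \<partial>lborel)"
proof (rule ccontr)
  assume "\<not> ?thesis"
  moreover have "0 \<le> (\<integral>x. smooth_bump \<delta> (x::'a) \<partial>lborel)" by (intro integral_nonneg_AE) (simp add: smooth_bump_nonneg)
  ultimately have "(\<integral>x. smooth_bump \<delta> (x::'a) \<partial>lborel) = 0" by linarith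
  then have "AE x in lborel. smooth_bump \<delta> (x::'a) = 0"
    by (subst (asm) integral_nonneg_eq_0_iff_AE) (auto simp: smooth_bump_nonneg smooth_bump_integrable assms)
  then have "AE x in (lborel :: 'a measure). x \<notin> ball 0 \<delta>"
    by eventually_elim (use smooth_bump_pos in fastforce)
  then have "ball (0::'a) \<delta> \<in> null_sets lborel" by (subst AE_iff_null_sets) auto
  then have "emeasure lborel (ball (0::'a) \<delta>) = 0" by auto
  then show False using content_ball_gt_0_iff[of "0::'a" \<delta>] assms by (simp add: measure_def)
qed

lemma integral_lebesgue_on_support:
  fixes f :: "'a::euclidean_space \<Rightarrow> real"
  assumes "\<Omega> \<in> sets borel" "f \<in> borel_measurable borel" "\<And>x. x \<notin> \<Omega> \<Longrightarrow> f x = 0"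
  shows "(\<integral>x. f x \<partial>lebesgue_on \<Omega>) = (\<integral>x. f x \<partial>lborel)"
proof -
  have "(\<integral>x. f x \<partial>lebesgue_on \<Omega>) = (\<integral>x. indicator \<Omega> x *\<^sub>R f x \<partial>lebesgue)"
    using assms(1) by (intro integral_restrict_space) auto
  also have "(\<lambda>x. indicator \<Omega> x *\<^sub>R f x) = f" using assms(3) by (auto simp: fun_eq_iff indicator_def)
  finally show ?thesis using assms(2) by (simp add: integral_completion)
qed

lemma test_functionI:
  assumes "smooth f" "\<And>x. x \<notin> cball a r \<Longrightarrow> f x = 0" "cball a r \<subseteq> \<Omega>"
  shows "f \<in> test_functions \<Omega>"
  using assms unfolding test_functions_def smooth_def by (auto intro!: exI[of _ "cball a r"])

lemma weak_integral_bound: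
  fixes \<psi> :: "'a::euclidean_space \<Rightarrow> real"
  assumes \<Omega>: "\<Omega> \<in> sets borel" and g: "g \<in> borel_measurable (lebesgue_on \<Omega>)" "AE x in lebesgue_on \<Omega>. \<bar>g x\<bar> \<le> C" and C: "C \<ge> 0"
    and \<psi>: "\<And>x. 0 \<le> \<psi> x" "integrable lborel \<psi>" "\<And>x. x \<notin> \<Omega> \<Longrightarrow> \<psi> x = 0"
  shows "\<bar>\<integral>x. g x * \<psi> x \<partial>lebesgue_on \<Omega>\<bar> \<le> C * (\<integral>x. \<psi> x \<partial>lborel)"
proof -
  have \<psi>m: "\<psi> \<in> borel_measurable borel" using \<psi>(2) by simp
  have \<psi>l: "integrable lebesgue \<psi>" using \<psi>(2) \<psi>m by (simp add: integrable_completion)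
  have \<psi>i: "integrable (lebesgue_on \<Omega>) \<psi>"
    using \<Omega> integrable_mult_indicator[OF _ \<psi>l, of \<Omega>] by (simp add: integrable_restrict_space)
  have \<psi>m' [measurable]: "\<psi> \<in> borel_measurable (lebesgue_on \<Omega>)" using \<psi>i by simp
  note g(1)[measurable]
  have "\<bar>\<integral>x. g x * \<psi> x \<partial>lebesgue_on \<Omega>\<bar> \<le> (\<integral>x. \<bar>g x * \<psi> x\<bar> \<partial>lebesgue_on \<Omega>)" by (rule integral_abs_bound)
  also have "\<dots> \<le> (\<integral>x. C * \<psi> x \<partial>lebesgue_on \<Omega>)"
  proof (rule integral_mono_AE)
    show ae: "AE x in lebesgue_on \<Omega>. \<bar>g x * \<psi> x\<bar> \<le> C * \<psi> x"
      using g(2) by eventually_elim (simp add: abs_mult \<psi>(1) mult_right_mono)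
    show "integrable (lebesgue_on \<Omega>) (\<lambda>x. \<bar>g x * \<psi> x\<bar>)"
      by (rule Bochner_Integration.integrable_bound[OF integrable_mult_right[OF \<psi>i, of C]])
         (measurable, use ae in eventually_elim, simp add: C \<psi>(1))
  qed (intro integrable_mult_right \<psi>i)
  also have "\<dots> = C * (\<integral>x. \<psi> x \<partial>lborel)"
    using integral_lebesgue_on_support[OF \<Omega> \<psi>m \<psi>(3)] by simp
  finally show ?thesis .
qed

lemma weak_derivative_bound:
  fixes u :: "'a::euclidean_space \<Rightarrow> real"
  assumes \<Omega>: "\<Omega> \<in> sets borel" and u: "u \<in> borel_measurable borel" and i: "i \<in> Basis"
    and w: "weak_derivative \<Omega> i u g" and g: "g \<in> borel_measurable (lebesgue_on \<Omega>)" "AE x in lebesgue_on \<Omega>. \<bar>g x\<bar> \<le> C" and C: "C \<ge> 0"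
    and \<psi>: "smooth \<psi>" "\<And>x. x \<notin> cball a r \<Longrightarrow> \<psi> x = 0" "cball a r \<subseteq> \<Omega>" "\<And>x. 0 \<le> \<psi> x" "integrable lborel \<psi>"
  shows "\<bar>\<integral>x. u x * pd i \<psi> x \<partial>lborel\<bar> \<le> C * (\<integral>x. \<psi> x \<partial>lborel)"
proof -
  have m: "(\<lambda>x. u x * pd i \<psi> x) \<in> borel_measurable borel"
    using u borel_measurable_continuous_onI[OF smooth_continuous[OF smooth_pd[OF \<psi>(1) i]]] by simp
  have z: "x \<notin> \<Omega> \<Longrightarrow> u x * pd i \<psi> x = 0" for x 
  proof -
    assume "x \<notin> \<Omega>"
    then have "x \<notin> cball a r" using \<psi>(3) by blast
    then have "pd i \<psi> x = 0" by (rule pd_support[rotated]) (rule \<psi>(2))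
    then show ?thesis by simp
  qed
  have "\<psi> \<in> test_functions \<Omega>" by (rule test_functionI[OF \<psi>(1-3)])
  then have "(\<integral>x. u x * pd i \<psi> x \<partial>lebesgue_on \<Omega>) = - (\<integral>x. g x * \<psi> x \<partial>lebesgue_on \<Omega>)"
    using w unfolding weak_derivative_def pd_def by blast
  then have "(\<integral>x. u x * pd i \<psi> x \<partial>lborel) = - (\<integral>x. g x * \<psi> x \<partial>lebesgue_on \<Omega>)"
    using integral_lebesgue_on_support[OF \<Omega> m z] by simp
  moreover have "\<psi> x = 0" if "x \<notin> \<Omega>" for x using that \<psi>(2)[of x] \<psi>(3) by blast
  ultimately show ?thesis using weak_integral_bound[OF \<Omega> g C \<psi>(4,5)] by simp
qed

lemma weak_derivative2_bound:
  fixes u :: "'a::euclidean_space \<Rightarrow> real"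
  assumes \<Omega>: "\<Omega> \<in> sets borel" and u: "u \<in> borel_measurable borel" and i: "i \<in> Basis" and j: "j \<in> Basis"
    and w: "weak_derivative \<Omega> i u g" "weak_derivative \<Omega> j g h"
    and h: "h \<in> borel_measurable (lebesgue_on \<Omega>)" "AE x in lebesgue_on \<Omega>. \<bar>h x\<bar> \<le> C" and C: "C \<ge> 0"
    and \<psi>: "smooth \<psi>" "\<And>x. x \<notin> cball a r \<Longrightarrow> \<psi> x = 0" "cball a r \<subseteq> \<Omega>" "\<And>x. 0 \<le> \<psi> x" "integrable lborel \<psi>"
  shows "\<bar>\<integral>x. u x * pd i (pd j \<psi>) x \<partial>lborel\<bar> \<le> C * (\<integral>x. \<psi> x \<partial>lborel)"
proof -
  have m: "(\<lambda>x. u x * pd i (pd j \<psi>) x) \<in> borel_measurable borel"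
    using u borel_measurable_continuous_onI[OF smooth_continuous[OF smooth_pd[OF smooth_pd[OF \<psi>(1) j] i]]] by simp
  have z: "x \<notin> \<Omega> \<Longrightarrow> u x * pd i (pd j \<psi>) x = 0" for x
    
  proof -
    assume "x \<notin> \<Omega>"
    then have "x \<notin> cball a r" using \<psi>(3) by blast
    then have "pd i (pd j \<psi>) x = 0" by (rule pd_support[rotated]) (rule pd_support[OF \<psi>(2)])
    then show ?thesis by simp
  qed
  have "\<psi> \<in> test_functions \<Omega>" by (rule test_functionI[OF \<psi>(1-3)])
  moreover have "pd j \<psi> \<in> test_functions \<Omega>"
    by (rule test_functionI[OF smooth_pd[OF \<psi>(1) j] _ \<psi>(3)]) (rule pd_support[OF \<psi>(2)])
  ultimately have "(\<integral>x. u x * pd i (pd j \<psi>) x \<partial>lebesgue_on \<Omega>) = - (\<integral>x. g x * pd j \<psi> x \<partial>lebesgue_on \<Omega>)"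
    "(\<integral>x. g x * pd j \<psi> x \<partial>lebesgue_on \<Omega>) = - (\<integral>x. h x * \<psi> x \<partial>lebesgue_on \<Omega>)"
    using w unfolding weak_derivative_def pd_def by blast+
  then have "(\<integral>x. u x * pd i (pd j \<psi>) x \<partial>lborel) = (\<integral>x. h x * \<psi> x \<partial>lebesgue_on \<Omega>)"
    using integral_lebesgue_on_support[OF \<Omega> m z] by simp
  moreover have "\<psi> x = 0" if "x \<notin> \<Omega>" for x using that \<psi>(2)[of x] \<psi>(3) by blast
  ultimately show ?thesis using weak_integral_bound[OF \<Omega> h C \<psi>(4,5)] by simp
qed

lemma LinftyE:
  assumes "g \<in> Linfty \<Omega>"
  obtains C where "C \<ge> 0" "g \<in> borel_measurable (lebesgue_on \<Omega>)" "AE x in lebesgue_on \<Omega>. \<bar>g x\<bar> \<le> C"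
proof -
  from assms obtain C where C: "g \<in> borel_measurable (lebesgue_on \<Omega>)" "AE x in lebesgue_on \<Omega>. \<bar>g x\<bar> \<le> C"
    unfolding Linfty_def by blast
  from C(2) have "AE x in lebesgue_on \<Omega>. \<bar>g x\<bar> \<le> max C 0" by eventually_elim simp
  with C(1) show ?thesis by (intro that[of "max C 0"]) auto
qed

definition smooth_mass :: "real \<Rightarrow> 'a::euclidean_space itself \<Rightarrow> real" where
  "smooth_mass \<delta> _ = (\<integral>y. smooth_bump \<delta> (y::'a) \<partial>lborel)"

definition smoothing :: "real \<Rightarrow> ('a::euclidean_space \<Rightarrow> real) \<Rightarrow> ('a \<Rightarrow> real) \<Rightarrow> 'a \<Rightarrow> real" where
  "smoothing \<delta> u f x = (\<integral>y. f (x - y) * u y \<partial>lborel) / smooth_mass \<delta> TYPE('a)"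

context
  fixes u :: "'a::euclidean_space \<Rightarrow> real" and U :: real and \<delta> :: real
  assumes u_cont: "continuous_on UNIV u" and u_bd: "\<And>x. \<bar>u x\<bar> \<le> U" and \<delta>: "\<delta> > 0"
begin

private abbreviation "\<eta> \<equiv> (smooth_bump \<delta> :: 'a \<Rightarrow> real)"

lemma u_meas [measurable]: "u \<in> borel_measurable borel"
  by (intro borel_measurable_continuous_onI u_cont)

lemma Z_pos: "smooth_mass \<delta> TYPE('a) > 0" unfolding smooth_mass_def by (rule smooth_bump_integral_pos[OF \<delta>])

lemma \<eta>_smooth: "smooth \<eta>" using smooth_smooth_bump[of \<delta> "0::'a"] by simp

lemma \<eta>_supp: "x \<notin> cball 0 \<delta> \<Longrightarrow> \<eta> x = 0" by (rule smooth_bump_support[OF \<delta>])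

lemma smoothing_has_derivative:
  assumes "smooth f" "\<And>x. x \<notin> cball 0 \<delta> \<Longrightarrow> f x = 0"
  shows "(smoothing \<delta> u f has_derivative (\<lambda>h. \<Sum>i\<in>Basis. (h \<bullet> i) * smoothing \<delta> u (pd i f) x)) (at x)"
proof -
  have "((\<lambda>x. (\<integral>y. f (x - y) * u y \<partial>lborel) / smooth_mass \<delta> TYPE('a)) has_derivative
     (\<lambda>h. (\<Sum>i\<in>Basis. (h \<bullet> i) * (\<integral>y. pd i f (x - y) * u y \<partial>lborel)) / smooth_mass \<delta> TYPE('a))) (at x)"
    by (rule bounded_linear.has_derivative[OF bounded_linear_divide convolution_GDERIV[OF assms u_meas u_bd]])
  then show ?thesis unfolding smoothing_def[abs_def] by (simp add: sum_divide_distrib)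
qed

lemma translate_facts:
  shows "smooth (\<lambda>y. \<eta> (x - y))" "y \<notin> cball x \<delta> \<Longrightarrow> \<eta> (x - y) = 0" "integrable lborel (\<lambda>y. \<eta> (x - y))"
    "(\<integral>y. \<eta> (x - y) \<partial>lborel) = smooth_mass \<delta> TYPE('a)"
proof -
  have r: "\<eta> (x - y) = \<eta> (y - x)" for y by (simp add: smooth_bump_def norm_minus_commute)
  show "smooth (\<lambda>y. \<eta> (x - y))" unfolding r by (rule smooth_smooth_bump)
  show "y \<notin> cball x \<delta> \<Longrightarrow> \<eta> (x - y) = 0" by (intro \<eta>_supp) (simp add: dist_norm norm_minus_commute)
  show "integrable lborel (\<lambda>y. \<eta> (x - y))"
    unfolding r using integrable_lborel_translate[OF smooth_bump_integrable[OF \<delta>], of "- x"] by simp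
  show "(\<integral>y. \<eta> (x - y) \<partial>lborel) = smooth_mass \<delta> TYPE('a)"
    unfolding r using integral_lborel_translate[of \<eta> "- x"] by (simp add: smooth_mass_def)
qed

lemma smoothing_partial_bound:
  assumes i: "i \<in> Basis" and w: "weak_derivative \<Omega> i u g" and g: "g \<in> borel_measurable (lebesgue_on \<Omega>)" "AE x in lebesgue_on \<Omega>. \<bar>g x\<bar> \<le> C" and C: "C \<ge> 0"
    and \<Omega>: "\<Omega> \<in> sets borel" "cball x \<delta> \<subseteq> \<Omega>"
  shows "\<bar>smoothing \<delta> u (pd i \<eta>) x\<bar> \<le> C"
proof -
  have "\<bar>\<integral>y. u y * pd i (\<lambda>y. \<eta> (x - y)) y \<partial>lborel\<bar> \<le> C * (\<integral>y. \<eta> (x - y) \<partial>lborel)"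
    by (rule weak_derivative_bound[OF \<Omega>(1) u_meas i w g C translate_facts(1,2) \<Omega>(2) smooth_bump_nonneg translate_facts(3)])
  then have "\<bar>\<integral>y. pd i \<eta> (x - y) * u y \<partial>lborel\<bar> \<le> C * smooth_mass \<delta> TYPE('a)"
    unfolding translate_facts(4) pd_reflect[OF \<eta>_smooth] by (simp add: mult.commute)
  then show ?thesis using Z_pos by (simp add: smoothing_def divide_le_eq)
qed

lemma smoothing_partial2_bound:
  assumes i: "i \<in> Basis" and j: "j \<in> Basis" and w: "weak_derivative \<Omega> i u g" "weak_derivative \<Omega> j g h"
    and h: "h \<in> borel_measurable (lebesgue_on \<Omega>)" "AE x in lebesgue_on \<Omega>. \<bar>h x\<bar> \<le> C" and C: "C \<ge> 0"
    and \<Omega>: "\<Omega> \<in> sets borel" "cball x \<delta> \<subseteq> \<Omega>"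
  shows "\<bar>smoothing \<delta> u (pd i (pd j \<eta>)) x\<bar> \<le> C"
proof -
  have pr: "pd j (\<lambda>y. \<eta> (x - y)) = (\<lambda>y. - pd j \<eta> (x - y))" using pd_reflect[OF \<eta>_smooth] by (intro ext)
  have s: "smooth (pd j \<eta>)" by (rule smooth_pd[OF \<eta>_smooth j])
  have pr2: "pd i (\<lambda>y. - pd j \<eta> (x - y)) y = pd i (pd j \<eta>) (x - y)" for y
  proof -
    have d: "(\<lambda>y. pd j \<eta> (x - y)) differentiable (at y)"
    proof -
      have "smooth (pd j (\<lambda>y. \<eta> (x - y)))" by (rule smooth_pd[OF translate_facts(1) j])
      then have "(\<lambda>y. - pd j \<eta> (x - y)) differentiable (at y)" unfolding pr by (rule smooth_differentiable)
      then have "(\<lambda>y. - (- pd j \<eta> (x - y))) differentiable (at y)" by (rule differentiable_minus)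
      then show ?thesis by simp
    qed
    have "pd i (\<lambda>y. - pd j \<eta> (x - y)) y = - pd i (\<lambda>y. pd j \<eta> (x - y)) y"
    proof -
      have "((\<lambda>y. - pd j \<eta> (x - y)) has_derivative (\<lambda>h. - frechet_derivative (\<lambda>y. pd j \<eta> (x - y)) (at y) h)) (at y)"
        using d by (intro has_derivative_minus) (simp add: frechet_derivative_works[symmetric])
      then show ?thesis by (simp only: pd_eqI pd_def[of i "\<lambda>y. pd j \<eta> (x - y)" y])
    qed
    then show ?thesis using pd_reflect[OF s, of i x y] by simp
  qed
  have "\<bar>\<integral>y. u y * pd i (pd j (\<lambda>y. \<eta> (x - y))) y \<partial>lborel\<bar> \<le> C * (\<integral>y. \<eta> (x - y) \<partial>lborel)"
    by (rule weak_derivative2_bound[OF \<Omega>(1) u_meas i j w h C translate_facts(1,2) \<Omega>(2) smooth_bump_nonneg translate_facts(3)])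
  then have "\<bar>\<integral>y. pd i (pd j \<eta>) (x - y) * u y \<partial>lborel\<bar> \<le> C * smooth_mass \<delta> TYPE('a)"
    unfolding translate_facts(4) pr pr2 by (simp add: mult.commute)
  then show ?thesis using Z_pos by (simp add: smoothing_def divide_le_eq)
qed

lemma smoothing_close:
  assumes "\<And>y. dist y x \<le> \<delta> \<Longrightarrow> \<bar>u y - u x\<bar> \<le> e"
  shows "\<bar>smoothing \<delta> u \<eta> x - u x\<bar> \<le> e"
proof -
  note i = translate_facts(3)[of x]
  have iu: "integrable lborel (\<lambda>y. \<eta> (x - y) * u y)" by (rule integrable_mult_bounded(1)[OF i _ u_bd]) simp
  have "\<bar>(\<integral>y. \<eta> (x - y) * u y \<partial>lborel) - (\<integral>y. \<eta> (x - y) * u x \<partial>lborel)\<bar> = \<bar>\<integral>y. \<eta> (x - y) * (u y - u x) \<partial>lborel\<bar>"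
    using iu i by (simp add: right_diff_distrib)
  also have "\<dots> \<le> (\<integral>y. \<eta> (x - y) * e \<partial>lborel)"
  proof (rule order_trans[OF integral_abs_bound], rule integral_mono)
    show "integrable lborel (\<lambda>y. \<bar>\<eta> (x - y) * (u y - u x)\<bar>)"
      unfolding right_diff_distrib by (intro integrable_abs Bochner_Integration.integrable_diff iu integrable_mult_left i)
    show "integrable lborel (\<lambda>y. \<eta> (x - y) * e)" by (intro integrable_mult_left i)
    fix y
    show "\<bar>\<eta> (x - y) * (u y - u x)\<bar> \<le> \<eta> (x - y) * e"
    proof (cases "y \<in> cball x \<delta>")
      case True
      then show ?thesis using assms[of y] smooth_bump_nonneg[of \<delta> "x - y"]
        by (simp add: abs_mult dist_commute mult_left_mono)
    qed (use translate_facts(2) in simp)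
  qed
  finally have "\<bar>(\<integral>y. \<eta> (x - y) * u y \<partial>lborel) - smooth_mass \<delta> TYPE('a) * u x\<bar> \<le> smooth_mass \<delta> TYPE('a) * e" using translate_facts(4)[of x] by simp
  moreover have "(\<integral>y. \<eta> (x - y) * u y \<partial>lborel) - smooth_mass \<delta> TYPE('a) * u x = smooth_mass \<delta> TYPE('a) * (smoothing \<delta> u \<eta> x - u x)"
    using Z_pos by (simp add: smoothing_def field_simps)
  ultimately show ?thesis using Z_pos by (simp add: abs_mult)
qed

lemma smoothing_quad:
  assumes b: "\<And>x i j. norm x \<le> R \<Longrightarrow> i \<in> Basis \<Longrightarrow> j \<in> Basis \<Longrightarrow> \<bar>smoothing \<delta> u (pd i (pd j \<eta>)) x\<bar> \<le> C" and C: "C \<ge> 0"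
    and x: "norm x \<le> R" "norm (x + h) \<le> R"
  shows "\<bar>smoothing \<delta> u \<eta> (x + h) - smoothing \<delta> u \<eta> x - (\<Sum>i\<in>Basis. smoothing \<delta> u (pd i \<eta>) x *\<^sub>R i) \<bullet> h\<bar>
    \<le> (real DIM('a) * (real DIM('a) * C)) * (norm h)\<^sup>2"
proof (rule lipschitz_grad_imp_quad[of "cball 0 R"])
  let ?D = "\<lambda>x. \<Sum>i\<in>Basis. smoothing \<delta> u (pd i \<eta>) x *\<^sub>R i"
  show "GDERIV (smoothing \<delta> u \<eta>) y :> ?D y" for y
    using smoothing_has_derivative[OF \<eta>_smooth \<eta>_supp] unfolding GDERIV_sum_Basis .
  fix y z :: 'a assume yz: "y \<in> cball 0 R" "z \<in> cball 0 R"
  have "norm (?D y - ?D z) \<le> (\<Sum>i\<in>(Basis::'a set). real DIM('a) * C * norm (y - z))"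
    unfolding sum_subtractf[symmetric] scaleR_diff_left[symmetric]
  proof (rule sum_norm_le)
    fix i :: 'a assume i: "i \<in> Basis"
    have "\<bar>smoothing \<delta> u (pd i \<eta>) y - smoothing \<delta> u (pd i \<eta>) z\<bar> \<le> real DIM('a) * C * norm (y - z)"
      by (rule bounded_partials_imp_lipschitz[OF convex_cball[of 0 R] smoothing_has_derivative[OF smooth_pd[OF \<eta>_smooth i] pd_support[of 0 \<delta> \<eta>, OF \<eta>_supp]]])
         (use b i C yz in simp_all)
    then show "norm ((smoothing \<delta> u (pd i \<eta>) y - smoothing \<delta> u (pd i \<eta>) z) *\<^sub>R i) \<le> real DIM('a) * C * norm (y - z)"
      using i by simp
  qed
  then show "norm (?D y - ?D z) \<le> (real DIM('a) * (real DIM('a) * C)) * norm (y - z)" by simp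
qed (use x C in auto)

end

theorem Wk_infty_imp_quad_approx_loc:
  fixes u :: "'a::euclidean_space \<Rightarrow> real"
  assumes u_cont: "continuous_on UNIV u" and u_bd: "\<And>x. \<bar>u x\<bar> \<le> U"
    and W1: "u \<in> Wk_infty 1 UNIV" and W2: "u \<in> Wk_infty_loc 2"
  obtains u' K where "quad_approx_loc u u'" "\<And>x. norm (u' x) \<le> K"
proof -
  have "\<exists>C\<ge>0. \<forall>\<delta>>0. \<forall>x. \<bar>smoothing \<delta> u (pd i (smooth_bump \<delta>)) x\<bar> \<le> C" if i: "i \<in> Basis" for i
  proof -
    obtain g where g: "g \<in> Linfty UNIV" "weak_derivative UNIV i u g" using W1 i by auto
    obtain C where C: "C \<ge> 0" "g \<in> borel_measurable (lebesgue_on UNIV)" "AE x in lebesgue_on UNIV. \<bar>g x\<bar> \<le> C"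
      using g(1) by (rule LinftyE)
    have "\<bar>smoothing \<delta> u (pd i (smooth_bump \<delta>)) x\<bar> \<le> C" if "\<delta> > 0" for \<delta> x
      by (rule smoothing_partial_bound[OF u_cont u_bd that i g(2) C(2,3,1)]) auto
    with C(1) show ?thesis by blast
  qed
  then obtain Ci where Ci: "\<And>i. i \<in> Basis \<Longrightarrow> Ci i \<ge> 0 \<and> (\<forall>\<delta>>0. \<forall>x. \<bar>smoothing \<delta> u (pd i (smooth_bump \<delta>)) x\<bar> \<le> Ci i)"
    by metis
  define K where "K = (\<Sum>i\<in>(Basis::'a set). Ci i)"
  define \<delta> where "\<delta> n = 1 / real (Suc n)" for n
  have \<delta>: "0 < \<delta> n" "\<delta> n \<le> 1" for n by (auto simp: \<delta>_def)
  define S where "S n = smoothing (\<delta> n) u (smooth_bump (\<delta> n))" for n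
  define D where "D n x = (\<Sum>i\<in>Basis. smoothing (\<delta> n) u (pd i (smooth_bump (\<delta> n))) x *\<^sub>R i)" for n x
  have D: "norm (D n x) \<le> K" for n x
    unfolding D_def K_def by (rule sum_norm_le) (use Ci \<delta> in simp)
  have S: "(\<lambda>n. S n x) \<longlonglongrightarrow> u x" for x
  proof (rule metric_LIMSEQ_I)
    fix e :: real assume e: "e > 0"
    have "isCont u x" using u_cont by (simp add: continuous_on_eq_continuous_at)
    then obtain d where d: "d > 0" "\<And>y. dist y x < d \<Longrightarrow> dist (u y) (u x) < e / 2"
      using e unfolding continuous_at_eps_delta by (metis half_gt_zero)
    have "eventually (\<lambda>n. \<delta> n < d) sequentially"
      unfolding \<delta>_def using LIMSEQ_inverse_real_of_nat d(1) by (intro order_tendstoD(2)) (auto simp: inverse_eq_divide)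
    then obtain n0 where n0: "\<And>n. n \<ge> n0 \<Longrightarrow> \<delta> n < d" unfolding eventually_sequentially by blast
    have "dist (S n x) (u x) < e" if n: "n \<ge> n0" for n
    proof -
      have "\<bar>u y - u x\<bar> \<le> e / 2" if "dist y x \<le> \<delta> n" for y
        using d(2)[of y] n0[OF n] that by (simp add: dist_real_def)
      then have "\<bar>S n x - u x\<bar> \<le> e / 2" unfolding S_def by (rule smoothing_close[OF u_cont u_bd \<delta>(1)])
      then show ?thesis using e by (simp add: dist_real_def)
    qed
    then show "\<exists>n0. \<forall>n\<ge>n0. dist (S n x) (u x) < e" by blast
  qed
  have quad: "\<exists>C\<ge>0. \<forall>n x h. norm x \<le> R \<longrightarrow> norm (x + h) \<le> R \<longrightarrow> \<bar>S n (x + h) - S n x - D n x \<bullet> h\<bar> \<le> C * (norm h)\<^sup>2" for R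
  proof -
    let ?\<Omega> = "ball 0 (\<bar>R\<bar> + 2) :: 'a set"
    have u2: "u \<in> Wk_infty (Suc (Suc 0)) ?\<Omega>"
      using W2 unfolding Wk_infty_loc_def by (simp add: numeral_2_eq_2)
    have "\<exists>C\<ge>0. \<forall>n x. norm x \<le> R \<longrightarrow> \<bar>smoothing (\<delta> n) u (pd i (pd j (smooth_bump (\<delta> n)))) x\<bar> \<le> C" if ij: "i \<in> Basis" "j \<in> Basis" for i j
    proof -
      obtain g where g: "g \<in> Wk_infty (Suc 0) ?\<Omega>" "weak_derivative ?\<Omega> i u g" using u2 ij by (subst (asm) Wk_infty.simps) blast
      obtain h where h: "h \<in> Linfty ?\<Omega>" "weak_derivative ?\<Omega> j g h" using g(1) ij by auto
      obtain C where C: "C \<ge> 0" "h \<in> borel_measurable (lebesgue_on ?\<Omega>)" "AE x in lebesgue_on ?\<Omega>. \<bar>h x\<bar> \<le> C"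
        using h(1) by (rule LinftyE)
      have "\<bar>smoothing (\<delta> n) u (pd i (pd j (smooth_bump (\<delta> n)))) x\<bar> \<le> C" if x: "norm x \<le> R" for n x
      proof (rule smoothing_partial2_bound[OF u_cont u_bd \<delta>(1) ij g(2) h(2) C(2,3,1)])
        show "cball x (\<delta> n) \<subseteq> ?\<Omega>"
        proof
          fix y assume "y \<in> cball x (\<delta> n)"
          then have "norm (y - x) \<le> 1" using \<delta>(2)[of n] by (simp add: dist_norm norm_minus_commute)
          moreover have "norm y \<le> norm x + norm (y - x)" using norm_triangle_sub .
          ultimately show "y \<in> ?\<Omega>" using x by simp
        qed
      qed simp
      with C(1) show ?thesis by blast
    qed
    then obtain M where M: "\<And>i j. i \<in> Basis \<Longrightarrow> j \<in> Basis \<Longrightarrow> M i j \<ge> 0 \<and>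
       (\<forall>n x. norm x \<le> R \<longrightarrow> \<bar>smoothing (\<delta> n) u (pd i (pd j (smooth_bump (\<delta> n)))) x\<bar> \<le> M i j)" by metis
    define N where "N = (\<Sum>i\<in>(Basis::'a set). \<Sum>j\<in>(Basis::'a set). M i j)"
    have N0: "N \<ge> 0" unfolding N_def using M by (intro sum_nonneg) auto
    have N: "\<bar>smoothing (\<delta> n) u (pd i (pd j (smooth_bump (\<delta> n)))) x\<bar> \<le> N" if "norm x \<le> R" "i \<in> Basis" "j \<in> Basis" for n x i j
    proof -
      have "M i j \<le> (\<Sum>j\<in>(Basis::'a set). M i j)" using that M by (intro member_le_sum) auto
      also have "\<dots> \<le> N" unfolding N_def using that M
        by (intro member_le_sum[of i Basis "\<lambda>i. \<Sum>j\<in>(Basis::'a set). M i j"]) (auto intro: sum_nonneg)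
      finally show ?thesis using M[OF that(2,3)] that(1) order_trans by blast
    qed
    have "\<bar>S n (x + h) - S n x - D n x \<bullet> h\<bar> \<le> (real DIM('a) * (real DIM('a) * N)) * (norm h)\<^sup>2"
      if "norm x \<le> R" "norm (x + h) \<le> R" for n x h
      unfolding S_def D_def by (rule smoothing_quad[OF u_cont u_bd \<delta>(1) N N0 that])
    then show ?thesis using N0 by (intro exI[of _ "real DIM('a) * (real DIM('a) * N)"]) auto
  qed
  have "\<exists>l. norm l \<le> K \<and> (\<exists>r. strict_mono r \<and> (\<lambda>n. D (r n) x) \<longlonglongrightarrow> l)" for x
  proof -
    have "seq_compact (cball (0::'a) K)" using compact_cball by (rule compact_imp_seq_compact)
    then obtain l r where "l \<in> cball 0 K" "strict_mono r" "((\<lambda>n. D n x) \<circ> r) \<longlonglongrightarrow> l"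
      using D by (elim seq_compactE[of _ "\<lambda>n. D n x"]) auto
    then show ?thesis by (auto simp: o_def)
  qed
  then obtain u' r where u': "\<And>x. norm (u' x) \<le> K" "\<And>x. strict_mono (r x)" "\<And>x. (\<lambda>n. D (r x n) x) \<longlonglongrightarrow> u' x"
    by metis
  have "quad_approx_loc u u'"
    unfolding quad_approx_loc_def
  proof
    fix R
    obtain C where C: "C \<ge> 0" "\<And>n x h. norm x \<le> R + 1 \<Longrightarrow> norm (x + h) \<le> R + 1 \<Longrightarrow> \<bar>S n (x + h) - S n x - D n x \<bullet> h\<bar> \<le> C * (norm h)\<^sup>2"
      using quad[of "R + 1"] by blast
    have "\<bar>u (x + h) - u x - u' x \<bullet> h\<bar> \<le> C * (norm h)\<^sup>2" if "norm x \<le> R" "norm h \<le> 1" for x h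
    proof (rule LIMSEQ_le_const2)
      have sub: "(\<lambda>n. S (r x n) y) \<longlonglongrightarrow> u y" for y
        using LIMSEQ_subseq_LIMSEQ[OF S[of y] u'(2)[of x]] by (simp add: o_def)
      show "(\<lambda>n. \<bar>S (r x n) (x + h) - S (r x n) x - D (r x n) x \<bullet> h\<bar>) \<longlonglongrightarrow> \<bar>u (x + h) - u x - u' x \<bullet> h\<bar>"
        by (intro tendsto_intros sub u'(3))
      have "norm (x + h) \<le> R + 1" using norm_triangle_ineq[of x h] that by linarith
      then show "\<exists>N. \<forall>n\<ge>N. \<bar>S (r x n) (x + h) - S (r x n) x - D (r x n) x \<bullet> h\<bar> \<le> C * (norm h)\<^sup>2"
        using that by (intro exI[of _ 0] allI impI C(2)) auto
    qed
    with C(1) show "\<exists>C\<ge>0. \<forall>x h. norm x \<le> R \<longrightarrow> norm h \<le> 1 \<longrightarrow> \<bar>u (x + h) - u x - u' x \<bullet> h\<bar> \<le> C * (norm h)\<^sup>2" by blast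
  qed
  with u'(1) show ?thesis by (intro that)
qed

section \<open>The mean field game system\<close>

lemma usc_lsc_imp_continuous:
  assumes "usc_on UNIV u" "lsc_on UNIV u"
  shows "continuous_on UNIV u"
  using assms unfolding usc_on_def lsc_on_def continuous_on_def
  by (auto intro!: order_tendstoI)

lemma GDERIV_norm_le:
  fixes f :: "'a::euclidean_space \<Rightarrow> real"
  assumes "GDERIV f x :> D" and L: "\<And>y. \<bar>f y - f x\<bar> \<le> L * norm (y - x)"
  shows "norm D \<le> L"
proof (cases "D = 0")
  case True
  obtain b :: 'a where "b \<in> Basis" using nonempty_Basis by blast
  then have "0 \<le> L" using L[of "x + b"] by simp
  then show ?thesis using True by simp
next
  case False
  have "((\<lambda>t. x + t *\<^sub>R D) has_derivative (\<lambda>t. t *\<^sub>R D)) (at (0::real))"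
    by (auto intro!: derivative_eq_intros)
  moreover have "(f has_derivative (\<lambda>h. h \<bullet> D)) (at (x + 0 *\<^sub>R D))" using assms(1) by (simp add: gderiv_def)
  ultimately have "((\<lambda>t. f (x + t *\<^sub>R D)) has_derivative (\<lambda>t. (t *\<^sub>R D) \<bullet> D)) (at 0)"
    by (rule has_derivative_compose)
  then have "((\<lambda>t. f (x + t *\<^sub>R D)) has_real_derivative (D \<bullet> D)) (at 0)"
    by (simp add: has_field_derivative_def mult_commute_abs)
  then have "(\<lambda>h. (f (x + (0 + h) *\<^sub>R D) - f (x + 0 *\<^sub>R D)) / h) \<midarrow>0\<rightarrow> D \<bullet> D" by (rule DERIV_D)
  then have "D \<bullet> D \<le> L * norm D"
  proof (rule tendsto_upperbound)
    show "\<forall>\<^sub>F h in at 0. (f (x + (0 + h) *\<^sub>R D) - f (x + 0 *\<^sub>R D)) / h \<le> L * norm D"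
    proof (rule eventually_at_topological[THEN iffD2], intro exI[of _ UNIV] conjI ballI impI)
      fix h :: real assume "h \<noteq> 0"
      have "\<bar>(f (x + (0 + h) *\<^sub>R D) - f (x + 0 *\<^sub>R D)) / h\<bar> = \<bar>f (x + h *\<^sub>R D) - f x\<bar> / \<bar>h\<bar>" by simp
      also have "\<dots> \<le> (L * norm (h *\<^sub>R D)) / \<bar>h\<bar>" using L[of "x + h *\<^sub>R D"] by (intro divide_right_mono) auto
      also have "\<dots> = L * norm D" using \<open>h \<noteq> 0\<close> by simp
      finally show "(f (x + (0 + h) *\<^sub>R D) - f (x + 0 *\<^sub>R D)) / h \<le> L * norm D" by linarith
    qed auto
  qed simp
  then have "norm D * norm D \<le> L * norm D" by (simp add: power2_norm_eq_inner[symmetric] power2_eq_square)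
  then show ?thesis using False by simp
qed

lemma D_p_regular:
  fixes H :: "'a::euclidean_space \<Rightarrow> 'a \<Rightarrow> real"
  assumes C2: "Ck_on 2 UNIV (\<lambda>(x, p). H x p)"
  shows "GDERIV (H x) p :> D_p H x p"
    and "(\<lambda>q. D_p H x q) differentiable (at p)"
    and "\<exists>L\<ge>0. \<forall>x p y q. norm x \<le> R \<longrightarrow> norm p \<le> R \<longrightarrow> norm y \<le> R \<longrightarrow> norm q \<le> R \<longrightarrow>
       norm (D_p H x p - D_p H y q) \<le> L * (norm (x - y) + norm (p - q))"
proof -
  define \<phi> where "\<phi> = (\<lambda>(x, p). H x p)"
  define F where "F i w = frechet_derivative \<phi> (at w) (0, i)" for i :: 'a and w
  have bas: "(0, i) \<in> (Basis :: ('a \<times> 'a) set)" if "i \<in> Basis" for i :: 'a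
    using that by (simp add: Basis_prod_def)
  have \<phi>2: "Ck_on (Suc (Suc 0)) UNIV \<phi>" using C2 by (simp add: \<phi>_def numeral_2_eq_2)
  have d1: "\<phi> differentiable (at w)" for w
    using \<phi>2 by (simp only: Ck_on.simps) blast
  have c1: "Ck_on (Suc 0) UNIV (F i)" if "i \<in> Basis" for i
    using \<phi>2 bas[OF that] unfolding F_def by (subst (asm) Ck_on.simps) blast
  have slice: "((\<lambda>p. g (x, p)) has_derivative (\<lambda>h. frechet_derivative g (at (x, p)) (0, h))) (at p)"
    if "g differentiable (at (x, p))" for g :: "'a \<times> 'a \<Rightarrow> real" and x p
  proof -
    have "(g has_derivative frechet_derivative g (at (x, p))) (at (x, p))"
      using that by (simp add: frechet_derivative_works)
    moreover have "((\<lambda>p. (x, p)) has_derivative (\<lambda>h. (0, h))) (at p)"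
      by (auto intro!: derivative_eq_intros)
    ultimately show ?thesis using has_derivative_compose by fastforce
  qed
  have G: "GDERIV (H x) p :> (\<Sum>i\<in>Basis. F i (x, p) *\<^sub>R i)" for x p
    using has_derivative_Basis_expand[OF slice[OF d1, of x p]] unfolding GDERIV_sum_Basis F_def \<phi>_def by simp
  have Dp: "D_p H x p = (\<Sum>i\<in>Basis. F i (x, p) *\<^sub>R i)" for x p
    unfolding D_p_def by (rule grad_eqI) (rule G)
  show "GDERIV (H x) p :> D_p H x p" unfolding Dp by (rule G)
  have "(\<lambda>q. F i (x, q)) differentiable (at p)" if "i \<in> Basis" for i
    using slice[of "F i" x p] c1[OF that] unfolding Ck_on.simps by (meson UNIV_I differentiableI)
  then show "(\<lambda>q. D_p H x q) differentiable (at p)"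
    unfolding Dp by (intro differentiable_sum) auto
  have "\<exists>M. \<forall>w\<in>cball 0 (2 * \<bar>R\<bar>). \<bar>frechet_derivative (F i) (at w) b\<bar> \<le> M" if "i \<in> Basis" "b \<in> Basis" for i :: 'a and b
  proof -
    have "continuous_on (cball 0 (2 * \<bar>R\<bar>)) (\<lambda>w. frechet_derivative (F i) (at w) b)"
      using c1[OF that(1)] that(2) by (auto intro: continuous_on_subset)
    then have "bounded ((\<lambda>w. frechet_derivative (F i) (at w) b) ` cball 0 (2 * \<bar>R\<bar>))"
      by (intro compact_imp_bounded compact_continuous_image) auto
    then show ?thesis unfolding bounded_iff by (auto simp del: mem_cball)
  qed
  then obtain M where M: "\<And>i b w. i \<in> Basis \<Longrightarrow> b \<in> Basis \<Longrightarrow> w \<in> cball 0 (2 * \<bar>R\<bar>) \<Longrightarrow> \<bar>frechet_derivative (F i) (at w) b\<bar> \<le> M i b"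
    by metis
  define N where "N = (\<Sum>i\<in>(Basis::'a set). \<Sum>b\<in>(Basis::('a \<times> 'a) set). \<bar>M i b\<bar>)"
  have N0: "N \<ge> 0" unfolding N_def by (intro sum_nonneg) auto
  have N: "\<bar>frechet_derivative (F i) (at w) b\<bar> \<le> N" if "i \<in> Basis" "b \<in> Basis" "w \<in> cball 0 (2 * \<bar>R\<bar>)" for i b w
  proof -
    have "\<bar>M i b\<bar> \<le> (\<Sum>b\<in>(Basis::('a \<times> 'a) set). \<bar>M i b\<bar>)" using that by (intro member_le_sum) auto
    also have "\<dots> \<le> N" unfolding N_def using that
      by (intro member_le_sum[of i Basis "\<lambda>i. \<Sum>b\<in>(Basis::('a \<times> 'a) set). \<bar>M i b\<bar>"]) (auto intro: sum_nonneg)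
    finally show ?thesis using M[OF that] by linarith
  qed
  let ?K = "real DIM('a \<times> 'a) * N"
  have FL: "\<bar>F i v - F i w\<bar> \<le> ?K * norm (v - w)" if i: "i \<in> Basis" and vw: "v \<in> cball 0 (2 * \<bar>R\<bar>)" "w \<in> cball 0 (2 * \<bar>R\<bar>)" for i v w
  proof (rule bounded_partials_imp_lipschitz[OF convex_cball _ _ vw N0])
    have "(F i has_derivative frechet_derivative (F i) (at z)) (at z)" for z
      unfolding frechet_derivative_works[symmetric] using c1[OF i] unfolding Ck_on.simps by blast
    then show "(F i has_derivative (\<lambda>h. \<Sum>j\<in>Basis. (h \<bullet> j) * frechet_derivative (F i) (at z) j)) (at z)" for z
      by (rule has_derivative_Basis_expand)
  qed (rule N[OF i])
  have in_ball: "(x, p) \<in> cball 0 (2 * \<bar>R\<bar>)" if "norm x \<le> R" "norm p \<le> R" for x p :: 'a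
    using norm_Pair_le[of x p] that by simp
  show "\<exists>L\<ge>0. \<forall>x p y q. norm x \<le> R \<longrightarrow> norm p \<le> R \<longrightarrow> norm y \<le> R \<longrightarrow> norm q \<le> R \<longrightarrow>
       norm (D_p H x p - D_p H y q) \<le> L * (norm (x - y) + norm (p - q))"
  proof (intro exI[of _ "real DIM('a) * ?K"] conjI allI impI)
    fix x p y q :: 'a
    assume xp: "norm x \<le> R" "norm p \<le> R" "norm y \<le> R" "norm q \<le> R"
    have "norm (D_p H x p - D_p H y q) \<le> (\<Sum>i\<in>(Basis::'a set). ?K * (norm (x - y) + norm (p - q)))"
      unfolding Dp sum_subtractf[symmetric] scaleR_diff_left[symmetric]
    proof (rule sum_norm_le)
      fix i :: 'a assume i: "i \<in> Basis"
      have "\<bar>F i (x, p) - F i (y, q)\<bar> \<le> ?K * norm ((x, p) - (y, q))"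
        by (rule FL[OF i in_ball in_ball]) (use xp in auto)
      also have "\<dots> \<le> ?K * (norm (x - y) + norm (p - q))"
        using norm_Pair_le[of "x - y" "p - q"] N0 by (intro mult_left_mono) auto
      finally show "norm ((F i (x, p) - F i (y, q)) *\<^sub>R i) \<le> ?K * (norm (x - y) + norm (p - q))" using i by simp
    qed
    then show "norm (D_p H x p - D_p H y q) \<le> real DIM('a) * ?K * (norm (x - y) + norm (p - q))" by simp
  qed (use N0 in auto)
qed

lemma strictly_convex_excess:
  fixes H :: "'a::euclidean_space \<Rightarrow> 'a \<Rightarrow> real"
  assumes H4: "cond_H4 H" and pq: "p \<noteq> q"
  shows "0 < H x q - H x p - D_p H x p \<bullet> (q - p)"
proof -
  have C2: "Ck_on 2 UNIV (\<lambda>(x, p). H x p)" using H4 by (simp add: cond_H4_def)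
  define v where "v = q - p"
  define K where "K = norm p + norm q + 1"
  have "K > 0" unfolding K_def by (simp add: add_nonneg_pos)
  then obtain \<alpha> where \<alpha>: "\<alpha> > 0" "\<And>x p v. norm p \<le> K \<Longrightarrow> \<alpha> * (v \<bullet> v) \<le> v \<bullet> hess_p H x p v"
    using H4 unfolding cond_H4_def by metis
  have seg: "norm (p + t *\<^sub>R v) \<le> K" if "0 \<le> t" "t \<le> 1" for t
  proof -
    have "p + t *\<^sub>R v = (1 - t) *\<^sub>R p + t *\<^sub>R q" by (simp add: v_def algebra_simps)
    also have "norm \<dots> \<le> (1 - t) * norm p + t * norm q"
      using norm_triangle_ineq[of "(1 - t) *\<^sub>R p" "t *\<^sub>R q"] that by simp
    also have "\<dots> \<le> 1 * norm p + 1 * norm q" using that by (intro add_mono mult_right_mono) auto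
    finally show ?thesis by (simp add: K_def)
  qed
  have line: "((\<lambda>t. p + t *\<^sub>R v) has_derivative (\<lambda>h. h *\<^sub>R v)) (at t)" for t :: real
    by (auto intro!: derivative_eq_intros)
  define g where "g t = D_p H x (p + t *\<^sub>R v) \<bullet> v" for t
  have d1: "((\<lambda>t. H x (p + t *\<^sub>R v)) has_real_derivative g t) (at t)" for t
    using has_derivative_compose[OF line D_p_regular(1)[OF C2, unfolded gderiv_def]]
    by (simp add: has_field_derivative_def g_def inner_commute mult.commute[of _ "v \<bullet> _"] mult_commute_abs)
  have d2: "(g has_real_derivative (v \<bullet> hess_p H x (p + t *\<^sub>R v) v)) (at t)" for t
  proof -
    have D: "((\<lambda>q. D_p H x q) has_derivative hess_p H x (p + t *\<^sub>R v)) (at (p + t *\<^sub>R v))"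
      unfolding hess_p_def using D_p_regular(2)[OF C2] by (simp add: frechet_derivative_works[symmetric])
    have "bounded_linear (hess_p H x (p + t *\<^sub>R v))" by (rule has_derivative_bounded_linear[OF D])
    then have lin: "hess_p H x (p + t *\<^sub>R v) (h *\<^sub>R v) = h *\<^sub>R hess_p H x (p + t *\<^sub>R v) v" for h
      by (simp add: linear_simps)
    have "((\<lambda>t. D_p H x (p + t *\<^sub>R v)) has_derivative (\<lambda>h. hess_p H x (p + t *\<^sub>R v) (h *\<^sub>R v))) (at t)"
      by (rule has_derivative_compose[OF line D])
    then have "(g has_derivative (\<lambda>h. hess_p H x (p + t *\<^sub>R v) (h *\<^sub>R v) \<bullet> v)) (at t)"
      unfolding g_def[abs_def] by (rule has_derivative_inner_left)
    then show ?thesis unfolding lin by (simp add: has_field_derivative_def inner_commute mult_commute_abs)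
  qed
  obtain s where s: "0 < s" "s < 1" "H x (p + 1 *\<^sub>R v) - H x (p + 0 *\<^sub>R v) = (1 - 0) * g s"
    using MVT2[of 0 1 "\<lambda>t. H x (p + t *\<^sub>R v)" g] d1 by auto
  obtain t where t: "0 < t" "t < s" "g s - g 0 = (s - 0) * (v \<bullet> hess_p H x (p + t *\<^sub>R v) v)"
    using MVT2[of 0 s g "\<lambda>t. v \<bullet> hess_p H x (p + t *\<^sub>R v) v"] d2 s(1) by auto
  have "0 < \<alpha> * (v \<bullet> v)" using \<alpha>(1) pq by (simp add: v_def)
  also have "\<dots> \<le> v \<bullet> hess_p H x (p + t *\<^sub>R v) v" by (rule \<alpha>(2)[OF seg]) (use s t in auto)
  finally have "0 < g s - g 0" using t(3) s(1) by simp
  moreover have "H x q - H x p - D_p H x p \<bullet> (q - p) = g s - g 0"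
    using s(3) by (simp add: g_def v_def)
  ultimately show ?thesis by simp
qed

lemma cond_B2_imp_lipschitz:
  fixes b :: "'a::euclidean_space \<Rightarrow> 'a"
  assumes "cond_B2 b"
  shows "\<exists>L\<ge>0. \<forall>x y. norm x \<le> R \<longrightarrow> norm y \<le> R \<longrightarrow> norm (b x - b y) \<le> L * norm (x - y)"
proof -
  have "local_lipschitz {0::real} (cball 0 R) (\<lambda>_. b)"
  proof (rule local_lipschitzI)
    fix t :: real and x
    obtain r L where r: "r > 0" "L-lipschitz_on (ball x r) b" using assms unfolding cond_B2_def by blast
    have "L-lipschitz_on (cball x (r / 2) \<inter> cball 0 R) b"
      using r by (intro lipschitz_on_subset[OF r(2)]) auto
    then show "\<exists>u>0. \<exists>L. \<forall>t\<in>cball t u \<inter> {0}. L-lipschitz_on (cball x u \<inter> cball 0 R) b"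
      using r(1) by (intro exI[of _ "r / 2"] exI[of _ L] conjI ballI) auto
  qed
  then obtain L where "\<And>t. t \<in> {0::real} \<Longrightarrow> L-lipschitz_on (cball 0 R) b"
    using local_lipschitz_compact_implies_lipschitz[of "{0::real}" "cball 0 R" "\<lambda>_. b"] by auto
  then have L: "L-lipschitz_on (cball 0 R) b" by blast
  show ?thesis
    using lipschitz_on_nonneg[OF L] lipschitz_onD[OF L] by (intro exI[of _ L]) (auto simp: dist_norm)
qed

text \<open>Outside the ball the bump vanishes together with its gradient, and jumps into the ball make
  the generator strictly negative there.\<close>

lemma (in levy) invariant_full_support:
  assumes m: "finite_borel m" "measure m UNIV = 1" and B: "continuous_on UNIV B" and \<epsilon>: "\<epsilon> > 0"
    and inv: "(\<integral>y. generator \<nu> B \<epsilon> x y \<partial>m) = 0"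
  shows "emeasure m (ball x \<epsilon>) \<noteq> 0"
proof
  assume z: "emeasure m (ball x \<epsilon>) = 0"
  interpret m: finite_borel m by (rule m(1))
  have neg: "generator \<nu> B \<epsilon> x y < 0" if y: "y \<notin> ball x \<epsilon>" for y
  proof -
    have y': "norm (y - x) \<ge> \<epsilon>" using y by (simp add: dist_norm norm_minus_commute)
    have z0: "bump \<epsilon> (y - x) = 0" "bump' \<epsilon> (y - x) = 0" using bump_eq_0[OF \<epsilon> y'] bump'_eq_0[OF \<epsilon> y'] .
    let ?f = "\<lambda>z. bump \<epsilon> (y + z - x)"
    have inc: "incr (\<lambda>w. bump \<epsilon> (w - x)) (bump' \<epsilon> (y - x)) y = ?f" by (simp add: incr_def z0 fun_eq_iff)
    have fi: "integrable \<nu> ?f"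
    proof -
      have q: "quad_approx_loc (\<lambda>w. bump \<epsilon> (w - x)) (\<lambda>w. bump' \<epsilon> (w - x))"
        by (rule quad_approx_imp_loc[OF quad_approx_translate[OF quad_approx_bump[OF \<epsilon>]]])
      have "bounded (range (\<lambda>w. bump \<epsilon> (w - x)))"
        unfolding bounded_iff by (intro exI[of _ 1]) (auto simp: bump_nonneg bump_le_1)
      from integrable_incr[OF q this, of y] show ?thesis unfolding inc .
    qed
    define r where "r = norm (x - y) + \<epsilon>"
    have "r > 0" unfolding r_def using \<epsilon> by (simp add: add_nonneg_pos)
    then obtain c where c: "c > 0" "\<And>h. h \<in> borel_measurable borel \<Longrightarrow>
        ennreal c * (\<integral>\<^sup>+z. h z * indicator (cball 0 r) z \<partial>lborel) \<le> (\<integral>\<^sup>+z. h z \<partial>\<nu>)"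
      using lower_nu[of r] by auto
    have "0 < ennreal c * (ennreal (1 / 2) * emeasure lborel (ball (x - y) (\<epsilon> / 2)))"
      using c(1) \<epsilon> content_ball_gt_0_iff[of "x - y" "\<epsilon> / 2"]
      by (auto simp: ennreal_zero_less_mult_iff measure_def zero_less_iff_neq_zero)
    also have "\<dots> = ennreal c * (\<integral>\<^sup>+z. ennreal (1 / 2) * indicator (ball (x - y) (\<epsilon> / 2)) z \<partial>lborel)"
      by (subst nn_integral_cmult_indicator) auto
    also have "\<dots> \<le> ennreal c * (\<integral>\<^sup>+z. ennreal (?f z) * indicator (cball 0 r) z \<partial>lborel)"
    proof (intro mult_left_mono nn_integral_mono)
      fix z
      show "ennreal (1 / 2) * indicator (ball (x - y) (\<epsilon> / 2)) z \<le> ennreal (?f z) * indicator (cball 0 r) z"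
      proof (cases "z \<in> ball (x - y) (\<epsilon> / 2)")
        case True
        then have n: "norm (y + z - x) < \<epsilon> / 2" by (simp add: dist_norm norm_minus_commute algebra_simps)
        have "norm z \<le> norm (x - y) + norm (y + z - x)" using norm_triangle_ineq[of "x - y" "y + z - x"] by simp
        then have "z \<in> cball 0 r" using n \<epsilon> by (simp add: r_def)
        then have i: "indicator (cball 0 r) z = (1::ennreal)" "indicator (ball (x - y) (\<epsilon> / 2)) z = (1::ennreal)"
          using True by (auto simp del: mem_cball mem_ball)
        have "1 / 2 \<le> ?f z" using n by (intro bump_ge_half \<epsilon>) simp
        then show ?thesis unfolding i mult_1_right by (rule ennreal_leI)
      qed simp
    qed simp
    also have "\<dots> \<le> (\<integral>\<^sup>+z. ennreal (?f z) \<partial>\<nu>)" by (rule c(2)) measurable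
    also have "\<dots> = ennreal (\<integral>z. ?f z \<partial>\<nu>)" using fi by (intro nn_integral_eq_integral) (auto simp: bump_nonneg)
    finally have "0 < (\<integral>z. ?f z \<partial>\<nu>)" by simp
    then show ?thesis unfolding generator_def nonlocal_UNIV inc by (simp add: z0(2))
  qed
  have "AE y in m. y \<notin> ball x \<epsilon>" using z by (intro AE_not_in) (auto simp: null_sets_def)
  then have an: "AE y in m. generator \<nu> B \<epsilon> x y < 0" by eventually_elim (rule neg)
  obtain K where K: "\<And>y. \<bar>generator \<nu> B \<epsilon> x y\<bar> \<le> K"
    using generator_bump_regular(2)[OF B \<epsilon>, of x] unfolding bounded_iff by auto
  have gi: "integrable m (generator \<nu> B \<epsilon> x)"
    using generator_bump_regular(1)[OF B \<epsilon>, of x] K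
    by (intro m.integrable_bounded[where K = K]) (auto intro: borel_measurable_continuous_onI)
  have "AE y in m. - generator \<nu> B \<epsilon> x y = 0"
  proof (subst integral_nonneg_eq_0_iff_AE[symmetric])
    show "AE y in m. 0 \<le> - generator \<nu> B \<epsilon> x y" using an by eventually_elim simp
  qed (use gi inv in auto)
  with an have "AE y in m. y \<notin> UNIV" by eventually_elim simp
  then have "UNIV \<in> null_sets m" by (subst AE_iff_null_sets) auto
  then show False using m(2) by (simp add: measure_def null_setsD1)
qed

lemma continuous_on_if_locally_lipschitz:
  fixes B :: "'a::euclidean_space \<Rightarrow> 'a"
  assumes "\<And>R. \<exists>L\<ge>0. \<forall>x y. norm x \<le> R \<longrightarrow> norm y \<le> R \<longrightarrow> norm (B x - B y) \<le> L * norm (x - y)"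
  shows "continuous_on UNIV B"
proof -
  have "isCont B x" for x
  proof -
    obtain L where L: "L \<ge> 0" "\<And>y z. norm y \<le> norm x + 1 \<Longrightarrow> norm z \<le> norm x + 1 \<Longrightarrow> norm (B y - B z) \<le> L * norm (y - z)"
      using assms[of "norm x + 1"] by blast
    have "L-lipschitz_on (ball 0 (norm x + 1)) B"
      using L by (intro lipschitz_onI) (auto simp: dist_norm)
    then have "continuous_on (ball 0 (norm x + 1)) B" by (rule lipschitz_on_continuous_on)
    then show ?thesis by (simp add: continuous_on_eq_continuous_at)
  qed
  then show ?thesis by (simp add: continuous_on_eq_continuous_at)
qed

lemma cond_F2_regular:
  assumes F2: "cond_F2 F" and m: "m \<in> Prob"
  shows "continuous_on UNIV (\<lambda>x. F x m)" and "bounded (range (\<lambda>x. F x m))"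
proof -
  let ?S = "{f::'a \<Rightarrow> real. (\<exists>L. L-lipschitz_on UNIV f) \<and> (\<forall>x. \<bar>f x\<bar> \<le> 1) \<and>
                  (AE x in lebesgue. \<exists>D. GDERIV f x :> D \<and> norm D \<le> 1)}"
  have "GDERIV (\<lambda>x. 0::real) x :> 0" for x :: 'a by (rule GDERIV_const)
  then have "\<exists>D. GDERIV (\<lambda>x. 0::real) x :> D \<and> norm D \<le> 1" for x :: 'a by (metis norm_zero zero_le_one)
  then have "(\<lambda>x. 0) \<in> ?S" using lipschitz_on_constant[of UNIV "0::real"] by auto
  then have "?S \<noteq> {}" by blast
  then have d0: "d0 m m = 0" unfolding d0_def diff_self by (rule cSUP_const)
  obtain C where C: "C > 0" "\<And>x y. \<bar>F x m\<bar> + \<bar>F x m - F y m\<bar> / (norm (x - y) + d0 m m) \<le> C"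
    using F2 m unfolding cond_F2_def by metis
  have bd: "\<bar>F x m\<bar> \<le> C" for x using C(2)[of x x] by simp
  then show "bounded (range (\<lambda>x. F x m))" unfolding bounded_iff by auto
  have "\<bar>F x m - F y m\<bar> \<le> C * norm (x - y)" for x y
  proof (cases "x = y")
    case False
    have "\<bar>F x m - F y m\<bar> / norm (x - y) \<le> C" using C(2)[of x y] d0 by simp
    then show ?thesis using False by (simp add: divide_le_eq)
  qed simp
  then have "C-lipschitz_on UNIV (\<lambda>x. F x m)" using C(1) by (intro lipschitz_onI) (auto simp: dist_norm)
  then show "continuous_on UNIV (\<lambda>x. F x m)" by (rule lipschitz_on_continuous_on)
qed

lemma norm_D_p_le:
  fixes H :: "'a::euclidean_space \<Rightarrow> 'a \<Rightarrow> real"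
  assumes "cond_H2 H" "cond_H4 H"
  obtains L where "L > 0" "\<And>x p. norm (D_p H x p) \<le> L"
proof -
  obtain L where L: "L > 0" "\<And>x p q. \<bar>H x p - H x q\<bar> \<le> L * norm (p - q)"
    using assms(1) unfolding cond_H2_def by blast
  have "norm (D_p H x p) \<le> L" for x p
  proof (rule GDERIV_norm_le)
    show "GDERIV (H x) p :> D_p H x p" using assms(2) by (intro D_p_regular(1)) (simp add: cond_H4_def)
  qed (rule L(2))
  with L(1) show thesis by (rule that)
qed

lemma optimal_drift_locally_lipschitz:
  fixes H :: "'a::euclidean_space \<Rightarrow> 'a \<Rightarrow> real"
  assumes B2: "cond_B2 b" and H4: "cond_H4 H" and q: "quad_approx_loc u u'" and K: "\<And>x. norm (u' x) \<le> K"
  shows "\<exists>L\<ge>0. \<forall>x y. norm x \<le> R \<longrightarrow> norm y \<le> R \<longrightarrow>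
    norm ((b x + D_p H x (u' x)) - (b y + D_p H y (u' y))) \<le> L * norm (x - y)"
proof -
  obtain Lb where Lb: "Lb \<ge> 0" "\<And>x y. norm x \<le> R \<Longrightarrow> norm y \<le> R \<Longrightarrow> norm (b x - b y) \<le> Lb * norm (x - y)"
    using cond_B2_imp_lipschitz[OF B2, of R] by blast
  obtain Lu where Lu: "Lu \<ge> 0" "\<And>x y. norm x \<le> R \<Longrightarrow> norm y \<le> R \<Longrightarrow> norm (u' x - u' y) \<le> Lu * norm (x - y)"
    using quad_approx_loc_grad_lipschitz[OF q, of R] by blast
  have C2: "Ck_on 2 UNIV (\<lambda>(x, p). H x p)" using H4 by (simp add: cond_H4_def)
  obtain L where L: "L \<ge> 0" "\<And>x p y q. norm x \<le> max R K \<Longrightarrow> norm p \<le> max R K \<Longrightarrow> norm y \<le> max R K \<Longrightarrow>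
      norm q \<le> max R K \<Longrightarrow> norm (D_p H x p - D_p H y q) \<le> L * (norm (x - y) + norm (p - q))"
    using D_p_regular(3)[OF C2, of "max R K"] by blast
  show ?thesis
  proof (intro exI[of _ "Lb + L * (1 + Lu)"] conjI allI impI)
    fix x y :: 'a assume xy: "norm x \<le> R" "norm y \<le> R"
    have "norm ((b x + D_p H x (u' x)) - (b y + D_p H y (u' y))) =
        norm ((b x - b y) + (D_p H x (u' x) - D_p H y (u' y)))" by (simp add: algebra_simps)
    also have "\<dots> \<le> norm (b x - b y) + norm (D_p H x (u' x) - D_p H y (u' y))" by (rule norm_triangle_ineq)
    also have "norm (D_p H x (u' x) - D_p H y (u' y)) \<le> L * (norm (x - y) + norm (u' x - u' y))"
      using xy K[of x] K[of y] by (intro L(2)) auto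
    also have "L * (norm (x - y) + norm (u' x - u' y)) \<le> L * (norm (x - y) + Lu * norm (x - y))"
      using Lu(2)[OF xy] L(1) by (intro mult_left_mono) auto
    finally show "norm ((b x + D_p H x (u' x)) - (b y + D_p H y (u' y))) \<le> (Lb + L * (1 + Lu)) * norm (x - y)"
      using Lb(2)[OF xy] by (simp add: algebra_simps)
  qed (use Lb Lu L in auto)
qed

lemma optimal_drift_dissipative:
  fixes b :: "'a::euclidean_space \<Rightarrow> 'a"
  assumes B1: "cond_B1 b" and L: "L \<ge> 0" "\<And>x. norm (h x) \<le> L"
  obtains R where "\<And>x. norm x \<ge> R \<Longrightarrow> 0 \<le> (b x + h x) \<bullet> x"
proof -
  obtain \<alpha> \<beta> where ab: "\<alpha> > 0" "\<And>x y. (b x - b y) \<bullet> (x - y) \<ge> \<alpha> * (norm (x - y))\<^sup>2 - \<beta> * norm (x - y)"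
    using B1 unfolding cond_B1_def by blast
  have "0 \<le> (b x + h x) \<bullet> x" if x: "norm x \<ge> (\<beta> + norm (b 0) + L) / \<alpha>" for x
  proof -
    have "\<alpha> * (norm x)\<^sup>2 - \<beta> * norm x \<le> (b x - b 0) \<bullet> x" using ab(2)[of x 0] by simp
    moreover have "- (norm (b 0) * norm x) \<le> b 0 \<bullet> x" using Cauchy_Schwarz_ineq2[of "b 0" x] by linarith
    moreover have "- (L * norm x) \<le> h x \<bullet> x"
      using Cauchy_Schwarz_ineq2[of "h x" x] mult_right_mono[OF L(2)[of x] norm_ge_zero[of x]] by linarith
    ultimately have "norm x * (\<alpha> * norm x - (\<beta> + norm (b 0) + L)) \<le> (b x + h x) \<bullet> x"
      by (simp add: algebra_simps inner_diff_left inner_add_left power2_eq_square)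
    moreover have "0 \<le> \<alpha> * norm x - (\<beta> + norm (b 0) + L)"
      using x ab(1) by (simp add: divide_le_eq mult.commute)
    ultimately show ?thesis using mult_nonneg_nonneg[OF norm_ge_zero[of x]] by (metis order_trans)
  qed
  then show thesis by (rule that)
qed

lemma (in levy) duality_sol_generator:
  assumes m: "m \<in> Prob" and d: "duality_sol \<nu> B m" and B: "continuous_on UNIV B" and \<epsilon>: "\<epsilon> > 0"
  shows "(\<integral>y. generator \<nu> B \<epsilon> x y \<partial>m) = 0"
proof (rule duality_sol_stationary[OF m d])
  show "bounded (range (\<lambda>w. bump \<epsilon> (w - x)))"
    unfolding bounded_iff by (intro exI[of _ 1]) (auto simp: bump_nonneg bump_le_1)
  show "quad_approx_loc (\<lambda>w. bump \<epsilon> (w - x)) (\<lambda>w. bump' \<epsilon> (w - x))"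
    by (rule quad_approx_imp_loc[OF quad_approx_translate[OF quad_approx_bump[OF \<epsilon>]]])
qed (use generator_bump_regular[OF B \<epsilon>, of x] in \<open>simp_all add: generator_def\<close>)

lemma (in levy) ergodic_MFG_solution_classical:
  assumes u: "u \<in> Wk_infty 1 UNIV \<inter> Wk_infty_loc 2" and s: "ergodic_MFG_solution \<nu> b H F l u m"
  obtains u' K where "quad_approx_loc u u'" "\<And>x. norm (u' x) \<le> K" "bounded (range u)"
    "duality_sol \<nu> (\<lambda>x. b x + D_p H x (u' x)) m"
    "\<And>x. l + H x (u' x) + b x \<bullet> u' x - F x m = nonlocal \<nu> UNIV x u (u' x)"
proof -
  have v: "visc_sol \<nu> (\<lambda>x p. l + H x p + b x \<bullet> p - F x m) u"
    and d: "duality_sol \<nu> (\<lambda>x. b x + D_p H x (grad u x)) m"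
    using s unfolding ergodic_MFG_solution_def by auto
  have bu: "bounded (range u)" and c: "continuous_on UNIV u"
    using v unfolding visc_sol_def visc_subsol_def visc_supersol_def by (auto intro: usc_lsc_imp_continuous)
  obtain U where "\<And>x. \<bar>u x\<bar> \<le> U" using bu unfolding bounded_iff by auto
  then obtain u' K where q: "quad_approx_loc u u'" and K: "\<And>x. norm (u' x) \<le> K"
    using Wk_infty_imp_quad_approx_loc[of u U] c u by blast
  have "grad u = u'" by (intro ext grad_eqI quad_approx_loc_GDERIV[OF q])
  with d have "duality_sol \<nu> (\<lambda>x. b x + D_p H x (u' x)) m" by simp
  from q K bu this visc_sol_imp_classical[OF v q] show thesis by (rule that)
qed

lemma (in levy) cross_testing:
  assumes H1: "cond_H1 H" and H2: "cond_H2 H" and H4: "cond_H4 H" and F2: "cond_F2 F"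
    and m: "m \<in> Prob" and n: "n \<in> Prob"
    and q: "quad_approx_loc u u'" and K: "\<And>x. norm (u' x) \<le> K" and bu: "bounded (range u)"
    and eq: "\<And>x. l + H x (u' x) + b x \<bullet> u' x - F x m = nonlocal \<nu> UNIV x u (u' x)"
    and Dc: "continuous_on UNIV (\<lambda>x. D_p H x (v' x))"
    and d: "duality_sol \<nu> (\<lambda>x. b x + D_p H x (v' x)) n"
  defines "c \<equiv> \<lambda>x. F x m - l - H x (u' x) + D_p H x (v' x) \<bullet> u' x"
  shows "continuous_on UNIV c" and "bounded (range c)" and "integrable n c" and "(\<integral>x. c x \<partial>n) = 0"
proof -
  interpret n: prob_space n using n by (simp add: Prob_def)
  have n_sets [measurable_cong]: "sets n = sets borel" using n by (simp add: Prob_def)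
  have uc: "continuous_on UNIV u'" by (rule quad_approx_loc_grad_continuous[OF q])
  have Hc: "continuous_on UNIV (\<lambda>(x, p). H x p)" using H1 by (simp add: cond_H1_def)
  have "continuous_on UNIV (\<lambda>x. (\<lambda>(x, p). H x p) (x, u' x))"
    by (rule continuous_on_compose2[OF Hc]) (auto intro!: continuous_intros uc)
  then show cc: "continuous_on UNIV c"
    unfolding c_def by (auto intro!: continuous_intros uc Dc cond_F2_regular(1)[OF F2 m])
  obtain CH where CH: "CH > 0" "\<And>x p. \<bar>H x p\<bar> \<le> CH * (1 + norm p)" using H1 unfolding cond_H1_def by blast
  obtain L where L: "L > 0" "\<And>x p. norm (D_p H x p) \<le> L" by (rule norm_D_p_le[OF H2 H4]) blast
  obtain CF where CF: "\<And>x. \<bar>F x m\<bar> \<le> CF" using cond_F2_regular(2)[OF F2 m] unfolding bounded_iff by auto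
  have cb: "\<bar>c x\<bar> \<le> CF + \<bar>l\<bar> + CH * (1 + K) + L * K" for x
  proof -
    have "\<bar>H x (u' x)\<bar> \<le> CH * (1 + K)"
      using CH(2)[of x "u' x"] mult_left_mono[OF add_left_mono[OF K[of x], of 1], of CH] CH(1) by linarith
    moreover have "\<bar>D_p H x (v' x) \<bullet> u' x\<bar> \<le> L * K"
      using Cauchy_Schwarz_ineq2[of "D_p H x (v' x)" "u' x"] mult_mono[OF L(2)[of x "v' x"] K[of x]] L(1) by simp
    ultimately show ?thesis using CF[of x] unfolding c_def by linarith
  qed
  then show bc: "bounded (range c)" unfolding bounded_iff by auto
  show "integrable n c"
    using cc cb by (intro n.integrable_const_bound) (auto intro!: borel_measurable_continuous_onI simp: measurable_cong_sets[OF n_sets refl])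
  show "(\<integral>x. c x \<partial>n) = 0"
  proof (rule duality_sol_stationary[OF n d bu q _ cc bc])
    fix x show "c x = (b x + D_p H x (v' x)) \<bullet> u' x - nonlocal \<nu> UNIV x u (u' x)"
      unfolding eq[symmetric] c_def by (simp add: inner_add_left)
  qed
qed

theorem theorem5p4:
  fixes \<nu> :: "'a::euclidean_space measure"
    and b :: "'a \<Rightarrow> 'a"
    and H :: "'a \<Rightarrow> 'a \<Rightarrow> real"
    and F :: "'a \<Rightarrow> 'a measure \<Rightarrow> real"
    and \<sigma> k :: real
  assumes "cond_nu \<sigma> \<nu>"
    and "cond_B1 b" and "cond_B2 b"
    and "cond_H1 H" and "cond_H2 H" and "cond_H3 H" and "cond_H4 H"
    and "F_continuous F" and "cond_F1 F" and "cond_F2 F"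
    and "0 < k" and "k < \<sigma>"
  shows "\<exists>\<^sub>\<le>\<^sub>1(l, u, m). u \<in> Wk_infty 1 UNIV \<inter> Wk_infty_loc 2 \<and> m \<in> Prob_moment k \<and>
           ergodic_MFG_solution \<nu> b H F l u m"
proof -
  note B1 = assms(2) and B2 = assms(3) and H1 = assms(4) and H2 = assms(5) and H4 = assms(7)
    and F1 = assms(9) and F2 = assms(10)
  interpret levy \<nu> by (rule cond_nu_imp_levy[OF assms(1)])
  have "l1 = l2 \<and> u1 = u2 \<and> m1 = m2"
    if u1: "u1 \<in> Wk_infty 1 UNIV \<inter> Wk_infty_loc 2" and m1: "m1 \<in> Prob_moment k"
      and s1: "ergodic_MFG_solution \<nu> b H F l1 u1 m1"
      and u2: "u2 \<in> Wk_infty 1 UNIV \<inter> Wk_infty_loc 2" and m2: "m2 \<in> Prob_moment k"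
      and s2: "ergodic_MFG_solution \<nu> b H F l2 u2 m2" for l1 l2 u1 u2 m1 m2
  proof -
    have P1: "m1 \<in> Prob" and P2: "m2 \<in> Prob" using m1 m2 by (auto simp: Prob_moment_def)
    interpret m1: prob_space m1 using P1 by (simp add: Prob_def)
    interpret m2: prob_space m2 using P2 by (simp add: Prob_def)
    have fb1: "finite_borel m1" and fb2: "finite_borel m2"
      using P1 P2 by (auto simp: Prob_def finite_borel_def finite_borel_axioms_def prob_space.finite_measure)
    have sp: "space m1 = UNIV" "space m2 = UNIV"
      using P1 P2 by (auto simp: Prob_def dest: sets_eq_imp_space_eq)
    have one: "measure m1 UNIV = 1" "measure m2 UNIV = 1"
      using m1.prob_space m2.prob_space unfolding sp by auto
    obtain u1' K1 where q1: "quad_approx_loc u1 u1'" and K1: "\<And>x. norm (u1' x) \<le> K1"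
      and b1: "bounded (range u1)" and d1: "duality_sol \<nu> (\<lambda>x. b x + D_p H x (u1' x)) m1"
      and e1: "\<And>x. l1 + H x (u1' x) + b x \<bullet> u1' x - F x m1 = nonlocal \<nu> UNIV x u1 (u1' x)"
      by (rule ergodic_MFG_solution_classical[OF u1 s1]) blast
    obtain u2' K2 where q2: "quad_approx_loc u2 u2'" and K2: "\<And>x. norm (u2' x) \<le> K2"
      and b2: "bounded (range u2)" and d2: "duality_sol \<nu> (\<lambda>x. b x + D_p H x (u2' x)) m2"
      and e2: "\<And>x. l2 + H x (u2' x) + b x \<bullet> u2' x - F x m2 = nonlocal \<nu> UNIV x u2 (u2' x)"
      by (rule ergodic_MFG_solution_classical[OF u2 s2]) blast
    define B where "B x = b x + D_p H x (u1' x)" for x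
    have Bl: "\<exists>L\<ge>0. \<forall>x y. norm x \<le> R \<longrightarrow> norm y \<le> R \<longrightarrow> norm (B x - B y) \<le> L * norm (x - y)" for R
      unfolding B_def by (rule optimal_drift_locally_lipschitz[OF B2 H4 q1 K1])
    have Bc: "continuous_on UNIV B" by (rule continuous_on_if_locally_lipschitz[OF Bl])
    have bc: "continuous_on UNIV b" using B1 by (simp add: cond_B1_def)
    have D1: "continuous_on UNIV (\<lambda>x. D_p H x (u1' x))"
      using continuous_on_diff[OF Bc bc] by (simp add: B_def)
    have "continuous_on UNIV (\<lambda>x. b x + D_p H x (u2' x))"
      by (rule continuous_on_if_locally_lipschitz) (rule optimal_drift_locally_lipschitz[OF B2 H4 q2 K2])
    from continuous_on_diff[OF this bc] have D2: "continuous_on UNIV (\<lambda>x. D_p H x (u2' x))" by simp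
    define \<Phi> where "\<Phi> x = F x m1 - F x m2" for x
    define E1 where "E1 x = H x (u2' x) - H x (u1' x) - D_p H x (u1' x) \<bullet> (u2' x - u1' x)" for x
    define E2 where "E2 x = H x (u1' x) - H x (u2' x) - D_p H x (u2' x) \<bullet> (u1' x - u2' x)" for x
    have E1: "0 \<le> E1 x" and E2: "0 \<le> E2 x" for x
      using strictly_convex_excess[OF H4, of "u1' x" "u2' x" x] strictly_convex_excess[OF H4, of "u2' x" "u1' x" x]
      unfolding E1_def E2_def by (cases "u1' x = u2' x"; simp)+
    have \<Phi>c: "continuous_on UNIV \<Phi>" and \<Phi>b: "bounded (range \<Phi>)"
      unfolding \<Phi>_def using cond_F2_regular[OF F2 P1] cond_F2_regular[OF F2 P2]
      by (auto intro!: continuous_intros bounded_minus_comp)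
    obtain C where C: "\<And>x. \<bar>\<Phi> x\<bar> \<le> C" using \<Phi>b unfolding bounded_iff by auto
    have \<Phi>1: "integrable m1 \<Phi>" and \<Phi>2: "integrable m2 \<Phi>"
      using finite_borel.integrable_bounded[OF fb1, of \<Phi> C] finite_borel.integrable_bounded[OF fb2, of \<Phi> C]
        C borel_measurable_continuous_onI[OF \<Phi>c] by auto
    define G11 where "G11 x = F x m1 - l1 - H x (u1' x) + D_p H x (u1' x) \<bullet> u1' x" for x
    define G12 where "G12 x = F x m1 - l1 - H x (u1' x) + D_p H x (u2' x) \<bullet> u1' x" for x
    define G21 where "G21 x = F x m2 - l2 - H x (u2' x) + D_p H x (u1' x) \<bullet> u2' x" for x
    define G22 where "G22 x = F x m2 - l2 - H x (u2' x) + D_p H x (u2' x) \<bullet> u2' x" for x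
    note c11 = cross_testing[OF H1 H2 H4 F2 P1 P1 q1 K1 b1 e1 D1 d1, folded G11_def]
    note c12 = cross_testing[OF H1 H2 H4 F2 P1 P2 q1 K1 b1 e1 D2 d2, folded G12_def]
    note c21 = cross_testing[OF H1 H2 H4 F2 P2 P1 q2 K2 b2 e2 D1 d1, folded G21_def]
    note c22 = cross_testing[OF H1 H2 H4 F2 P2 P2 q2 K2 b2 e2 D2 d2, folded G22_def]
    have E1_eq: "E1 x = G11 x - G21 x - \<Phi> x + (l1 - l2)" for x
      by (simp add: E1_def \<Phi>_def G11_def G21_def inner_diff_right)
    have E2_eq: "E2 x = G22 x - G12 x + \<Phi> x - (l1 - l2)" for x
      by (simp add: E2_def \<Phi>_def G22_def G12_def inner_diff_right)
    have i1: "integrable m1 E1" unfolding E1_eq[abs_def] using c11(3) c21(3) \<Phi>1 by auto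
    have I1: "(\<integral>x. E1 x \<partial>m1) = (l1 - l2) - (\<integral>x. \<Phi> x \<partial>m1)"
      unfolding E1_eq[abs_def] using c11(3,4) c21(3,4) \<Phi>1 by (simp add: m1.prob_space)
    have I2: "(\<integral>x. E2 x \<partial>m2) = (\<integral>x. \<Phi> x \<partial>m2) - (l1 - l2)"
      unfolding E2_eq[abs_def] using c12(3,4) c22(3,4) \<Phi>2 by (simp add: m2.prob_space)
    have "0 \<le> (\<integral>x. \<Phi> x \<partial>m1) - (\<integral>x. \<Phi> x \<partial>m2)"
      using F1 P1 P2 unfolding cond_F1_def \<Phi>_def by blast
    moreover have "0 \<le> (\<integral>x. E1 x \<partial>m1)" "0 \<le> (\<integral>x. E2 x \<partial>m2)"
      by (auto intro!: integral_nonneg_AE simp: E1 E2)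
    ultimately have I10: "(\<integral>x. E1 x \<partial>m1) = 0" using I1 I2 by linarith
    then have ae: "AE x in m1. E1 x = 0" using integral_nonneg_eq_0_iff_AE[OF i1] E1 by simp
    have E1c: "continuous_on UNIV E1" unfolding E1_eq[abs_def]
      by (intro continuous_intros c11(1) c21(1) \<Phi>c)
    have inv1: "(\<integral>y. generator \<nu> B \<epsilon> x y \<partial>m1) = 0" if "\<epsilon> > 0" for \<epsilon> x
      by (rule duality_sol_generator[OF P1 _ Bc that]) (use d1 in \<open>simp add: B_def[abs_def]\<close>)
    have E10: "E1 x = 0" for x
    proof (rule ccontr)
      assume "E1 x \<noteq> 0"
      then have "0 < E1 x" using E1[of x] by simp
      moreover have "isCont E1 x" using E1c by (simp add: continuous_on_eq_continuous_at)
      ultimately have "\<forall>\<^sub>F y in nhds x. 0 < E1 y"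
        unfolding isCont_def tendsto_at_iff_tendsto_nhds by (auto dest: order_tendstoD)
      then obtain \<epsilon> where \<epsilon>: "\<epsilon> > 0" "\<And>y. dist y x < \<epsilon> \<Longrightarrow> 0 < E1 y"
        unfolding eventually_nhds_metric by blast
      have "AE y in m1. y \<notin> ball x \<epsilon>"
        using ae by eventually_elim (use \<epsilon>(2) in \<open>force simp: dist_commute\<close>)
      then have "ball x \<epsilon> \<in> null_sets m1" using P1 by (subst AE_iff_null_sets) (auto simp: Prob_def)
      then have "emeasure m1 (ball x \<epsilon>) = 0" by (rule null_setsD1)
      then show False using invariant_full_support[OF fb1 one(1) Bc \<epsilon>(1) inv1[OF \<epsilon>(1)]] by blast
    qed
    have grad_eq: "u1' = u2'"
    proof
      fix x show "u1' x = u2' x"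
        using strictly_convex_excess[OF H4, of "u1' x" "u2' x" x] E10[of x] unfolding E1_def by fastforce
    qed
    have "GDERIV (\<lambda>x. u1 x - u2 x) x :> 0" for x
      using GDERIV_diff[OF quad_approx_loc_GDERIV[OF q1] quad_approx_loc_GDERIV[OF q2], of x] grad_eq by simp
    then have "\<bar>(u1 x - u2 x) - (u1 0 - u2 0)\<bar> \<le> 0 * norm (x - 0)" for x
      by (intro GDERIV_bound_imp_lipschitz[where f' = "\<lambda>_. 0"]) auto
    moreover have "u1 0 = 0" "u2 0 = 0" using s1 s2 by (auto simp: ergodic_MFG_solution_def)
    ultimately have "u1 = u2" by (intro ext) (simp add: fun_eq_iff)
    obtain L where L: "L > 0" "\<And>x p. norm (D_p H x p) \<le> L" by (rule norm_D_p_le[OF H2 H4]) blast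
    obtain R where R: "\<And>x. norm x \<ge> R \<Longrightarrow> 0 \<le> B x \<bullet> x"
      using optimal_drift_dissipative[OF B1 less_imp_le[OF L(1)], of "\<lambda>x. D_p H x (u1' x)"] L(2)
      unfolding B_def by blast
    have inv2: "(\<integral>y. generator \<nu> B \<epsilon> x y \<partial>m2) = 0" if "\<epsilon> > 0" for \<epsilon> x
      by (rule duality_sol_generator[OF P2 _ Bc that]) (use d2 grad_eq in \<open>simp add: B_def[abs_def]\<close>)
    have m_eq: "m1 = m2"
      by (rule invariant_measure_unique[OF fb1 fb2 _ Bc Bl R inv1 inv2]) (use one in auto)
    have "(\<integral>x. \<Phi> x \<partial>m1) = 0" unfolding \<Phi>_def m_eq by simp
    with I1 I10 have "l1 = l2" by simp
    with \<open>u1 = u2\<close> m_eq show ?thesis by simp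
  qed
  then show ?thesis unfolding Uniq_def by auto
qed

end
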